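(* Let $\overline M$ be a $7$-dimensional Riemannian manifold with a $G_2$-structure of type $\mathcal P$. Let $\iota:M\to\overline M$ be an orientable hypersurface with unit normal vector field $n$, with the induced $SU(3)$-structure determined by $n$ and the constant function $\theta=0$ (resp. $\theta=\pi/2$). Put $\varepsilon=+$ if $\theta=0$ and $\varepsilon=-$ if $\theta=\pi/2$. Then $M$ is of type $\mathcal W_1^{\varepsilon}+\mathcal W_2^{\varepsilon}+\mathcal W_3$. Moreover, the $SU(3)$-structure on $M$ is of the type given on the left if and only if the condition on the right holds: 1. $\mathcal W_1^{\varepsilon}+\mathcal W_2^{\varepsilon}$: $IB=B$. 2. $\mathcal W_1^{\varepsilon}+\mathcal W_3$: $(1+I)B=2h\langle\cdot,\cdot\rangle$. 3. $\mathcal W_2^{\varepsilon}+\mathcal W_3$: $M$ is a minimal variety. 4. $\mathcal W_3$: $IB=-B$. 5. $\mathcal W_2^{\varepsilon}$: $IB=B$ and $M$ is a minimal variety. 6. $\mathcal W_1^{\varepsilon}$: $M$ is totally umbilic. 7. $\{0\}$: $M$ is totally geodesic.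
   Context: $G_2$-structures: a $G_2$-structure on a Riemannian $7$-manifold $(\overline M,\langle\cdot,\cdot\rangle)$ is given by a global three-form $\varphi$ such that locally there is an orthonormal frame $\{e_0,\dots,e_6\}$ (indices in $\mathbb Z_7$) with $\varphi=\sum_ie_i\wedge e_{i+1}\wedge e_{i+3}$ (vectors are identified with one-forms via the metric). $\langle P(x,y),z\rangle=\varphi(x,y,z)$, and $*\varphi=-\sum_{i}e_{i+2}\wedge e_{i+4}\wedge e_{i+5}\wedge e_{i+6}$ (Hodge dual for the orientation $e_0\wedge\dots\wedge e_6$). Type $\mathcal P$ (parallel): $\overline\nabla\varphi=0$, where $\overline\nabla$ is the Levi-Civita connection of $\overline M$. For $p$-forms, $\langle a,b\rangle=\frac1{p!}\sum a(e_{i_1},\dots)b(e_{i_1},\dots)$. Induced structure on $M$: the induced metric, $Ix=P(n,x)$, and $\Psi=\psi_++i\psi_-$ with $\psi_+=\cos\theta\,\iota^*\varphi-\sin\theta\,\iota^*(n\lrcorner*\varphi)$, $\psi_-=\sin\theta\,\iota^*\varphi+\cos\theta\,\iota^*(n\lrcorner*\varphi)$. $B(x,y)=\langle II(x,y),n\rangle=\langle\overline\nabla_xy,n\rangle$ is the second fundamental form, $h=\frac16\mathrm{Tr}\,B$ (so $h=\langle H,n\rangle$, $H$ the mean curvature); minimal variety means $h=0$, totally umbilic $B=h\langle\cdot,\cdot\rangle$, totally geodesic $B=0$. For a bilinear form $b$ on $M$, $(Ib)(x,y)=b(Ix,Iy)$; for a one-form $\mu$, $(I\mu)(x)=-\mu(Ix)$.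 Types of $SU(3)$-structure: $\nabla$ is the Levi-Civita connection of $M$, $\omega(x,y)=\langle x,Iy\rangle$. $\nabla\omega$ lies in $\{\alpha\mid\alpha(x,y,z)=-\alpha(x,z,y)=-\alpha(x,Iy,Iz)\}=\mathcal W_1\oplus\mathcal W_2\oplus\mathcal W_3\oplus\mathcal W_4$ (Gray–Hervella), where $\mathcal W_1$: $\alpha$ totally skew; $\mathcal W_2$: cyclic sum of $\alpha(x,y,z)$ is zero; $\mathcal W_3$: $\alpha(Ix,Iy,z)=\alpha(x,y,z)$ and $\sum_i\alpha(e_i,e_i,z)=0$; $\mathcal W_4$: $\alpha(x,y,z)=\langle x,y\rangle\tau(z)-\langle x,z\rangle\tau(y)-\langle x,Iy\rangle\tau(Iz)+\langle x,Iz\rangle\tau(Iy)$ for some one-form $\tau$. With $r(\alpha)(x,y)=\frac12\langle x\lrcorner\alpha,y\lrcorner\psi_+\rangle$, for $i=1,2$ one has $\mathcal W_i=\mathcal W_i^+\oplus\mathcal W_i^-$, where $\mathcal W_i^+$ (resp. $\mathcal W_i^-$) is the set of $\alpha\in\mathcal W_i$ with $r(\alpha)$ symmetric (resp. skew-symmetric). The $\mathcal W_5$-part of the torsion is the one-form $\eta$ determined by requiring that the metric connection $\nabla+\eta+\xi$, with $\eta_XY=(I\eta)(X)IY$ and $\xi_XY=-\frac12I(\nabla_XI)Y$, makes $\omega,\psi_+,\psi_-$ parallel; equivalently $(I\eta)(X)=-\frac1{12}\langle\nabla_X\psi_+,\psi_-\rangle$. $M$ is of type $\mathcal U$, a sum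 of some of $\mathcal W_1^\pm,\mathcal W_2^\pm,\mathcal W_3,\mathcal W_4,\mathcal W_5$, if the components of $\nabla\omega$ in the $\mathcal W$'s not occurring in $\mathcal U$ vanish everywhere and, when $\mathcal W_5$ does not occur, $\eta=0$; type $\{0\}$ means $\nabla\omega=0$ and $\eta=0$. *)

theory Defs
  imports "HOL-Analysis.Analysis" "HOL-Combinatorics.Permutations"
begin

section \<open>Smooth maps between open subsets of normed spaces\<close>

text \<open>Used only for open \<open>S\<close> and finite-dimensional domains, where existence and continuity of
  all iterated directional derivatives, together with differentiability at each stage, is the usual
  notion of a \<open>C\<^sup>k\<close> map.\<close>

primrec Ck_on :: "nat \<Rightarrow> 'a::real_normed_vector set \<Rightarrow> ('a \<Rightarrow> 'b::real_normed_vector) \<Rightarrow> bool" where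
  "Ck_on 0 S f = continuous_on S f"
| "Ck_on (Suc k) S f =
     ((\<forall>x\<in>S. f differentiable (at x)) \<and> (\<forall>v. Ck_on k S (\<lambda>x. frechet_derivative f (at x) v)))"

definition smooth_on :: "'a::real_normed_vector set \<Rightarrow> ('a \<Rightarrow> 'b::real_normed_vector) \<Rightarrow> bool" where
  "smooth_on S f \<longleftrightarrow> (\<forall>k. Ck_on k S f)"

section \<open>Smooth manifolds\<close>

text \<open>A chart is a pair of an open domain and a coordinate map. The manifold is a whole type,
  of class \<open>t2_space\<close> and \<open>second_countable_topology\<close>; its dimension is the cardinality of the
  index type \<open>'n\<close>.\<close>

type_synonym ('m, 'n) chart = "'m set \<times> ('m \<Rightarrow> real ^ 'n)"

definition chart_inv :: "('m, 'n) chart \<Rightarrow> real ^ 'n \<Rightarrow> 'm" where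
  "chart_inv c = inv_into (fst c) (snd c)"

definition is_chart :: "('m::topological_space, 'n::finite) chart \<Rightarrow> bool" where
  "is_chart c \<longleftrightarrow> open (fst c) \<and> open (snd c ` fst c)
     \<and> homeomorphism (fst c) (snd c ` fst c) (snd c) (chart_inv c)"

definition smooth_atlas :: "('m::topological_space, 'n::finite) chart set \<Rightarrow> bool" where
  "smooth_atlas A \<longleftrightarrow> (\<forall>c\<in>A. is_chart c) \<and> (\<Union>c\<in>A. fst c) = UNIV
     \<and> (\<forall>c\<in>A. \<forall>c'\<in>A. smooth_on (snd c ` (fst c \<inter> fst c')) (snd c' \<circ> chart_inv c))"

definition charts_at :: "('m, 'n) chart set \<Rightarrow> 'm \<Rightarrow> ('m, 'n) chart set" where
  "charts_at A p = {c \<in> A. p \<in> fst c}"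

definition chart_of :: "('m, 'n) chart set \<Rightarrow> 'm \<Rightarrow> ('m, 'n) chart" where
  "chart_of A p = (SOME c. c \<in> charts_at A p)"

definition smooth_map ::
  "('m::topological_space, 'k::finite) chart set \<Rightarrow> ('q::topological_space, 'n::finite) chart set
    \<Rightarrow> ('m \<Rightarrow> 'q) \<Rightarrow> bool" where
  "smooth_map A A' f \<longleftrightarrow> continuous_on UNIV f
     \<and> (\<forall>c\<in>A. \<forall>d\<in>A'. smooth_on (snd c ` (fst c \<inter> f -` fst d)) (snd d \<circ> f \<circ> chart_inv c))"

section \<open>Tangent vectors\<close>

text \<open>A tangent vector at \<open>p\<close> is a family of component vectors, one for each chart around \<open>p\<close>,
  related by the Jacobians of the changes of coordinates (and \<open>0\<close> for all other charts). The type
  \<open>tvec\<close> consists of arbitrary families, with the pointwise vector space structure; the tangent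
  spaces are subspaces of it.\<close>

typedef (overloaded) ('m, 'n::finite) tvec = "UNIV :: (('m, 'n) chart \<Rightarrow> real ^ 'n) set"
  morphisms coord Abs_tvec
  by simp

lemma coord_Abs_tvec [simp]: "coord (Abs_tvec f) = f"
  by (simp add: Abs_tvec_inverse)

lemma tvec_eq_iff: "v = w \<longleftrightarrow> (\<forall>c. coord v c = coord w c)"
  by (metis coord_inject ext)

instantiation tvec :: (type, finite) real_vector
begin

definition "0 = Abs_tvec (\<lambda>c. 0)"
definition "v + w = Abs_tvec (\<lambda>c. coord v c + coord w c)"
definition "v - w = Abs_tvec (\<lambda>c. coord v c - coord w c)"
definition "- v = Abs_tvec (\<lambda>c. - coord v c)"
definition "a *\<^sub>R v = Abs_tvec (\<lambda>c. a *\<^sub>R coord v c)"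

instance
  by standard
    (simp_all add: tvec_eq_iff zero_tvec_def plus_tvec_def minus_tvec_def uminus_tvec_def
      scaleR_tvec_def algebra_simps)

end

definition tangent_space :: "('m, 'n::finite) chart set \<Rightarrow> 'm \<Rightarrow> ('m, 'n) tvec set" where
  "tangent_space A p = {v.
     (\<forall>c\<in>charts_at A p. \<forall>c'\<in>charts_at A p.
        coord v c' = frechet_derivative (snd c' \<circ> chart_inv c) (at (snd c p)) (coord v c))
     \<and> (\<forall>c. c \<notin> charts_at A p \<longrightarrow> coord v c = 0)}"

text \<open>The tangent vector at \<open>p\<close> with components \<open>u\<close> in the chart \<open>c\<close>. For fixed \<open>u\<close> and varying
  \<open>p\<close> in the domain of \<open>c\<close> this is the coordinate vector field \<open>\<Sum>i. u\<^sub>i \<partial>/\<partial>x\<^sub>i\<close>.\<close>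

definition coord_field :: "('m, 'n::finite) chart set \<Rightarrow> ('m, 'n) chart \<Rightarrow> real ^ 'n \<Rightarrow> 'm
    \<Rightarrow> ('m, 'n) tvec" where
  "coord_field A c u p = Abs_tvec (\<lambda>c'. if c' \<in> charts_at A p
     then frechet_derivative (snd c' \<circ> chart_inv c) (at (snd c p)) u else 0)"

text \<open>An extension of a tangent vector \<open>y\<close> at \<open>p\<close> to a vector field near \<open>p\<close>.\<close>

definition const_ext :: "('m, 'n::finite) chart set \<Rightarrow> 'm \<Rightarrow> ('m, 'n) tvec \<Rightarrow> 'm \<Rightarrow> ('m, 'n) tvec" where
  "const_ext A p y = coord_field A (chart_of A p) (coord y (chart_of A p))"

text \<open>Derivative at \<open>p\<close> of \<open>f\<close> in the direction of a tangent vector \<open>x\<close> at \<open>p\<close>. Here and below the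
  chart \<open>chart_of A p\<close> is used for computing; for \<open>f\<close> smooth near \<open>p\<close> the result does not depend
  on it.\<close>

definition dir_deriv :: "('m, 'n::finite) chart set \<Rightarrow> 'm \<Rightarrow> ('m, 'n) tvec
    \<Rightarrow> ('m \<Rightarrow> 'b::real_normed_vector) \<Rightarrow> 'b" where
  "dir_deriv A p x f =
     frechet_derivative (f \<circ> chart_inv (chart_of A p)) (at (snd (chart_of A p) p))
       (coord x (chart_of A p))"

definition differential :: "('q, 'k::finite) chart set \<Rightarrow> ('m, 'n::finite) chart set \<Rightarrow> ('q \<Rightarrow> 'm)
    \<Rightarrow> 'q \<Rightarrow> ('q, 'k) tvec \<Rightarrow> ('m, 'n) tvec" where
  "differential A A' f q x =
     Abs_tvec (\<lambda>d. if d \<in> charts_at A' (f q) then dir_deriv A q x (snd d \<circ> f) else 0)"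

definition immersion :: "('q::topological_space, 'k::finite) chart set
    \<Rightarrow> ('m::topological_space, 'n::finite) chart set \<Rightarrow> ('q \<Rightarrow> 'm) \<Rightarrow> bool" where
  "immersion A A' f \<longleftrightarrow> smooth_map A A' f
     \<and> (\<forall>q. inj_on (differential A A' f q) (tangent_space A q))"

definition smooth_vector_field :: "('m::topological_space, 'n::finite) chart set \<Rightarrow> 'm set
    \<Rightarrow> ('m \<Rightarrow> ('m, 'n) tvec) \<Rightarrow> bool" where
  "smooth_vector_field A U X \<longleftrightarrow> (\<forall>p\<in>U. X p \<in> tangent_space A p)
     \<and> (\<forall>c\<in>A. smooth_on (snd c ` (fst c \<inter> U)) (\<lambda>a. coord (X (chart_inv c a)) c))"

definition smooth_field_along :: "('q::topological_space, 'k::finite) chart set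
    \<Rightarrow> ('m::topological_space, 'n::finite) chart set \<Rightarrow> ('q \<Rightarrow> 'm) \<Rightarrow> ('q \<Rightarrow> ('m, 'n) tvec) \<Rightarrow> bool" where
  "smooth_field_along A A' f W \<longleftrightarrow> (\<forall>q. W q \<in> tangent_space A' (f q))
     \<and> (\<forall>c\<in>A. \<forall>d\<in>A'. smooth_on (snd c ` (fst c \<inter> f -` fst d)) (\<lambda>a. coord (W (chart_inv c a)) d))"

section \<open>Linear algebra on a tangent space\<close>

text \<open>\<open>V\<close> is a tangent space and \<open>g\<close> an inner product on it. (Multi)linear maps on \<open>V\<close> are functions
  on the whole type of which only the values on \<open>V\<close> matter.\<close>

definition lin_on :: "'v::real_vector set \<Rightarrow> ('v \<Rightarrow> real) \<Rightarrow> bool" where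
  "lin_on V f \<longleftrightarrow> (\<forall>x\<in>V. \<forall>y\<in>V. \<forall>a b. f (a *\<^sub>R x + b *\<^sub>R y) = a * f x + b * f y)"

definition trilin_on :: "'v::real_vector set \<Rightarrow> ('v \<Rightarrow> 'v \<Rightarrow> 'v \<Rightarrow> real) \<Rightarrow> bool" where
  "trilin_on V f \<longleftrightarrow> (\<forall>x\<in>V. \<forall>y\<in>V.
     lin_on V (\<lambda>z. f z x y) \<and> lin_on V (\<lambda>z. f x z y) \<and> lin_on V (\<lambda>z. f x y z))"

definition orthonormal_basis :: "'v::real_vector set \<Rightarrow> ('v \<Rightarrow> 'v \<Rightarrow> real) \<Rightarrow> ('n \<Rightarrow> 'v) \<Rightarrow> bool" where
  "orthonormal_basis V g e \<longleftrightarrow> range e \<subseteq> V \<and> span (range e) = V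
     \<and> (\<forall>i j. g (e i) (e j) = (if i = j then 1 else 0))"

text \<open>The following sums do not depend on the orthonormal basis.\<close>

definition onb :: "('m, 'n::finite) tvec set \<Rightarrow> (('m, 'n) tvec \<Rightarrow> ('m, 'n) tvec \<Rightarrow> real)
    \<Rightarrow> 'n \<Rightarrow> ('m, 'n) tvec" where
  "onb V g = (SOME e. orthonormal_basis V g e)"

definition trace_form :: "('m, 'n::finite) tvec set \<Rightarrow> (('m, 'n) tvec \<Rightarrow> ('m, 'n) tvec \<Rightarrow> real)
    \<Rightarrow> (('m, 'n) tvec \<Rightarrow> ('m, 'n) tvec \<Rightarrow> real) \<Rightarrow> real" where
  "trace_form V g b = (\<Sum>i\<in>UNIV. b (onb V g i) (onb V g i))"

definition inner_2form :: "('m, 'n::finite) tvec set \<Rightarrow> (('m, 'n) tvec \<Rightarrow> ('m, 'n) tvec \<Rightarrow> real)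
    \<Rightarrow> (('m, 'n) tvec \<Rightarrow> ('m, 'n) tvec \<Rightarrow> real) \<Rightarrow> (('m, 'n) tvec \<Rightarrow> ('m, 'n) tvec \<Rightarrow> real) \<Rightarrow> real" where
  "inner_2form V g a b = (1 / fact 2) *
     (\<Sum>i\<in>UNIV. \<Sum>j\<in>UNIV. a (onb V g i) (onb V g j) * b (onb V g i) (onb V g j))"

definition inner_3form :: "('m, 'n::finite) tvec set \<Rightarrow> (('m, 'n) tvec \<Rightarrow> ('m, 'n) tvec \<Rightarrow> real)
    \<Rightarrow> (('m, 'n) tvec \<Rightarrow> ('m, 'n) tvec \<Rightarrow> ('m, 'n) tvec \<Rightarrow> real)
    \<Rightarrow> (('m, 'n) tvec \<Rightarrow> ('m, 'n) tvec \<Rightarrow> ('m, 'n) tvec \<Rightarrow> real) \<Rightarrow> real" where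
  "inner_3form V g a b = (1 / fact 3) *
     (\<Sum>i\<in>UNIV. \<Sum>j\<in>UNIV. \<Sum>k\<in>UNIV.
        a (onb V g i) (onb V g j) (onb V g k) * b (onb V g i) (onb V g j) (onb V g k))"

text \<open>\<open>(a\<^sub>0 \<and> \<dots> \<and> a\<^sub>k)(x\<^sub>0, \<dots>, x\<^sub>k) = det (a\<^sub>i(x\<^sub>j))\<close> for one-forms \<open>a\<^sub>i\<close>.\<close>

definition wedge :: "('v \<Rightarrow> real) list \<Rightarrow> 'v list \<Rightarrow> real" where
  "wedge as xs = (\<Sum>\<pi> | \<pi> permutes {..<length as}.
     of_int (sign \<pi>) * (\<Prod>i<length as. (as ! i) (xs ! \<pi> i)))"

section \<open>Riemannian metrics and the Levi-Civita connection\<close>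

definition riemannian_metric :: "('m::topological_space, 'n::finite) chart set
    \<Rightarrow> ('m \<Rightarrow> ('m, 'n) tvec \<Rightarrow> ('m, 'n) tvec \<Rightarrow> real) \<Rightarrow> bool" where
  "riemannian_metric A g \<longleftrightarrow>
     (\<forall>p. \<forall>x\<in>tangent_space A p. lin_on (tangent_space A p) (g p x)
        \<and> (\<forall>y\<in>tangent_space A p. g p x y = g p y x)
        \<and> (x \<noteq> 0 \<longrightarrow> g p x x > 0))
     \<and> (\<forall>c\<in>A. \<forall>u v. smooth_on (snd c ` fst c)
          ((\<lambda>p. g p (coord_field A c u p) (coord_field A c v p)) \<circ> chart_inv c))"

text \<open>The Christoffel map at \<open>p\<close> of the Levi-Civita connection in the chart \<open>c\<close>, i.e. the components
  of \<open>\<nabla>\<^sub>u v\<close> for coordinate vector fields \<open>u\<close>, \<open>v\<close>. It is the unique bilinear map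
  that is symmetric (the connection has no torsion) and compatible with the metric.\<close>

definition christoffel :: "('m, 'n::finite) chart set \<Rightarrow> ('m \<Rightarrow> ('m, 'n) tvec \<Rightarrow> ('m, 'n) tvec \<Rightarrow> real)
    \<Rightarrow> ('m, 'n) chart \<Rightarrow> 'm \<Rightarrow> real ^ 'n \<Rightarrow> real ^ 'n \<Rightarrow> real ^ 'n" where
  "christoffel A g c p =
     (let G = (\<lambda>v w p. g p (coord_field A c v p) (coord_field A c w p))
      in THE \<Gamma>. bilinear \<Gamma> \<and> (\<forall>u v. \<Gamma> u v = \<Gamma> v u)
           \<and> (\<forall>u v w. frechet_derivative (G v w \<circ> chart_inv c) (at (snd c p)) u
                = G (\<Gamma> u v) w p + G v (\<Gamma> u w) p))"

text \<open>Covariant derivative, in the direction \<open>x\<close> tangent at \<open>q\<close>, of a vector field \<open>W\<close> along a map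
  \<open>f\<close> into the Riemannian manifold \<open>(A', g')\<close>.\<close>

definition cov_deriv_along :: "('q, 'k::finite) chart set \<Rightarrow> ('m, 'n::finite) chart set
    \<Rightarrow> ('m \<Rightarrow> ('m, 'n) tvec \<Rightarrow> ('m, 'n) tvec \<Rightarrow> real) \<Rightarrow> ('q \<Rightarrow> 'm)
    \<Rightarrow> 'q \<Rightarrow> ('q, 'k) tvec \<Rightarrow> ('q \<Rightarrow> ('m, 'n) tvec) \<Rightarrow> ('m, 'n) tvec" where
  "cov_deriv_along A A' g' f q x W =
     (let d = chart_of A' (f q)
      in coord_field A' d
           (dir_deriv A q x (\<lambda>q'. coord (W q') d)
             + christoffel A' g' d (f q) (coord (differential A A' f q x) d) (coord (W q) d))
           (f q))"

definition levi_civita :: "('m, 'n::finite) chart set \<Rightarrow> ('m \<Rightarrow> ('m, 'n) tvec \<Rightarrow> ('m, 'n) tvec \<Rightarrow> real)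
    \<Rightarrow> 'm \<Rightarrow> ('m, 'n) tvec \<Rightarrow> ('m \<Rightarrow> ('m, 'n) tvec) \<Rightarrow> ('m, 'n) tvec" where
  "levi_civita A g = cov_deriv_along A A g (\<lambda>p. p)"

text \<open>\<open>(\<nabla>\<^sub>x T)(y, \<dots>)\<close> for covariant tensor fields \<open>T\<close> of rank 2 and 3. As a tensor in \<open>y, \<dots>\<close> it does not
  depend on the extensions of \<open>y, \<dots>\<close> to vector fields.\<close>

definition nabla2 :: "('m, 'n::finite) chart set \<Rightarrow> ('m \<Rightarrow> ('m, 'n) tvec \<Rightarrow> ('m, 'n) tvec \<Rightarrow> real)
    \<Rightarrow> ('m \<Rightarrow> ('m, 'n) tvec \<Rightarrow> ('m, 'n) tvec \<Rightarrow> real)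
    \<Rightarrow> 'm \<Rightarrow> ('m, 'n) tvec \<Rightarrow> ('m, 'n) tvec \<Rightarrow> ('m, 'n) tvec \<Rightarrow> real" where
  "nabla2 A g T p x y z =
     dir_deriv A p x (\<lambda>p'. T p' (const_ext A p y p') (const_ext A p z p'))
     - T p (levi_civita A g p x (const_ext A p y)) z
     - T p y (levi_civita A g p x (const_ext A p z))"

definition nabla3 :: "('m, 'n::finite) chart set \<Rightarrow> ('m \<Rightarrow> ('m, 'n) tvec \<Rightarrow> ('m, 'n) tvec \<Rightarrow> real)
    \<Rightarrow> ('m \<Rightarrow> ('m, 'n) tvec \<Rightarrow> ('m, 'n) tvec \<Rightarrow> ('m, 'n) tvec \<Rightarrow> real)
    \<Rightarrow> 'm \<Rightarrow> ('m, 'n) tvec \<Rightarrow> ('m, 'n) tvec \<Rightarrow> ('m, 'n) tvec \<Rightarrow> ('m, 'n) tvec \<Rightarrow> real" where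
  "nabla3 A g T p x y z w =
     dir_deriv A p x (\<lambda>p'. T p' (const_ext A p y p') (const_ext A p z p') (const_ext A p w p'))
     - T p (levi_civita A g p x (const_ext A p y)) z w
     - T p y (levi_civita A g p x (const_ext A p z)) w
     - T p y z (levi_civita A g p x (const_ext A p w))"

section \<open>\<open>G\<^sub>2\<close>-structures\<close>

definition three_form :: "('m::topological_space, 'n::finite) chart set
    \<Rightarrow> ('m \<Rightarrow> ('m, 'n) tvec \<Rightarrow> ('m, 'n) tvec \<Rightarrow> ('m, 'n) tvec \<Rightarrow> real) \<Rightarrow> bool" where
  "three_form A \<phi> \<longleftrightarrow>
     (\<forall>p. trilin_on (tangent_space A p) (\<phi> p)
        \<and> (\<forall>x\<in>tangent_space A p. \<forall>y\<in>tangent_space A p. \<forall>z\<in>tangent_space A p.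
             \<phi> p x y z = - \<phi> p y x z \<and> \<phi> p x y z = - \<phi> p x z y))
     \<and> (\<forall>c\<in>A. \<forall>u v w. smooth_on (snd c ` fst c)
          ((\<lambda>p. \<phi> p (coord_field A c u p) (coord_field A c v p) (coord_field A c w p))
             \<circ> chart_inv c))"

text \<open>The index type \<open>7\<close> carries arithmetic modulo 7.\<close>

definition G2_frame :: "('m, 7) chart set \<Rightarrow> ('m \<Rightarrow> ('m, 7) tvec \<Rightarrow> ('m, 7) tvec \<Rightarrow> real)
    \<Rightarrow> ('m \<Rightarrow> ('m, 7) tvec \<Rightarrow> ('m, 7) tvec \<Rightarrow> ('m, 7) tvec \<Rightarrow> real)
    \<Rightarrow> 'm \<Rightarrow> (7 \<Rightarrow> ('m, 7) tvec) \<Rightarrow> bool" where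
  "G2_frame A g \<phi> p e \<longleftrightarrow> orthonormal_basis (tangent_space A p) (g p) e
     \<and> (\<forall>x\<in>tangent_space A p. \<forall>y\<in>tangent_space A p. \<forall>z\<in>tangent_space A p.
          \<phi> p x y z = (\<Sum>i\<in>UNIV. wedge [g p (e i), g p (e (i + 1)), g p (e (i + 3))] [x, y, z]))"

definition G2_structure :: "('m::topological_space, 7) chart set
    \<Rightarrow> ('m \<Rightarrow> ('m, 7) tvec \<Rightarrow> ('m, 7) tvec \<Rightarrow> real)
    \<Rightarrow> ('m \<Rightarrow> ('m, 7) tvec \<Rightarrow> ('m, 7) tvec \<Rightarrow> ('m, 7) tvec \<Rightarrow> real) \<Rightarrow> bool" where
  "G2_structure A g \<phi> \<longleftrightarrow> three_form A \<phi>
     \<and> (\<forall>p. \<exists>U e. open U \<and> p \<in> U \<and> (\<forall>i. smooth_vector_field A U (e i))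
          \<and> (\<forall>p'\<in>U. G2_frame A g \<phi> p' (\<lambda>i. e i p')))"

definition type_P :: "('m, 7) chart set \<Rightarrow> ('m \<Rightarrow> ('m, 7) tvec \<Rightarrow> ('m, 7) tvec \<Rightarrow> real)
    \<Rightarrow> ('m \<Rightarrow> ('m, 7) tvec \<Rightarrow> ('m, 7) tvec \<Rightarrow> ('m, 7) tvec \<Rightarrow> real) \<Rightarrow> bool" where
  "type_P A g \<phi> \<longleftrightarrow> (\<forall>p. \<forall>x\<in>tangent_space A p. \<forall>y\<in>tangent_space A p.
     \<forall>z\<in>tangent_space A p. \<forall>w\<in>tangent_space A p. nabla3 A g \<phi> p x y z w = 0)"

text \<open>The vector cross product \<open>P\<close>.\<close>

definition cross_P :: "('m, 7) chart set \<Rightarrow> ('m \<Rightarrow> ('m, 7) tvec \<Rightarrow> ('m, 7) tvec \<Rightarrow> real)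
    \<Rightarrow> ('m \<Rightarrow> ('m, 7) tvec \<Rightarrow> ('m, 7) tvec \<Rightarrow> ('m, 7) tvec \<Rightarrow> real)
    \<Rightarrow> 'm \<Rightarrow> ('m, 7) tvec \<Rightarrow> ('m, 7) tvec \<Rightarrow> ('m, 7) tvec" where
  "cross_P A g \<phi> p x y =
     (THE v. v \<in> tangent_space A p \<and> (\<forall>z\<in>tangent_space A p. g p v z = \<phi> p x y z))"

text \<open>\<open>*\<phi>\<close>, which does not depend on the frame chosen at \<open>p\<close>.\<close>

definition star_form :: "('m, 7) chart set \<Rightarrow> ('m \<Rightarrow> ('m, 7) tvec \<Rightarrow> ('m, 7) tvec \<Rightarrow> real)
    \<Rightarrow> ('m \<Rightarrow> ('m, 7) tvec \<Rightarrow> ('m, 7) tvec \<Rightarrow> ('m, 7) tvec \<Rightarrow> real)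
    \<Rightarrow> 'm \<Rightarrow> ('m, 7) tvec \<Rightarrow> ('m, 7) tvec \<Rightarrow> ('m, 7) tvec \<Rightarrow> ('m, 7) tvec \<Rightarrow> real" where
  "star_form A g \<phi> p x y z w =
     (let e = (SOME e. G2_frame A g \<phi> p e)
      in - (\<Sum>i\<in>UNIV. wedge [g p (e (i + 2)), g p (e (i + 4)), g p (e (i + 5)), g p (e (i + 6))]
              [x, y, z, w]))"

section \<open>Hypersurfaces of a manifold with a \<open>G\<^sub>2\<close>-structure\<close>

record ('m, 'q) hypersurface =
  amb_atlas :: "('m, 7) chart set"
  amb_metric :: "'m \<Rightarrow> ('m, 7) tvec \<Rightarrow> ('m, 7) tvec \<Rightarrow> real"
  amb_form :: "'m \<Rightarrow> ('m, 7) tvec \<Rightarrow> ('m, 7) tvec \<Rightarrow> ('m, 7) tvec \<Rightarrow> real"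
  atlas :: "('q, 6) chart set"
  incl :: "'q \<Rightarrow> 'm"
  normal_field :: "'q \<Rightarrow> ('m, 7) tvec"

definition TM :: "('m, 'q) hypersurface \<Rightarrow> 'q \<Rightarrow> ('q, 6) tvec set" where
  "TM H q = tangent_space (atlas H) q"

definition dincl :: "('m, 'q) hypersurface \<Rightarrow> 'q \<Rightarrow> ('q, 6) tvec \<Rightarrow> ('m, 7) tvec" where
  "dincl H = differential (atlas H) (amb_atlas H) (incl H)"

definition unit_normal :: "('m::topological_space, 'q::topological_space) hypersurface \<Rightarrow> bool" where
  "unit_normal H \<longleftrightarrow> smooth_field_along (atlas H) (amb_atlas H) (incl H) (normal_field H)
     \<and> (\<forall>q. amb_metric H (incl H q) (normal_field H q) (normal_field H q) = 1
          \<and> (\<forall>x\<in>TM H q. amb_metric H (incl H q) (normal_field H q) (dincl H q x) = 0))"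

definition ind_metric :: "('m, 'q) hypersurface \<Rightarrow> 'q \<Rightarrow> ('q, 6) tvec \<Rightarrow> ('q, 6) tvec \<Rightarrow> real" where
  "ind_metric H q x y = amb_metric H (incl H q) (dincl H q x) (dincl H q y)"

definition second_ff :: "('m, 'q) hypersurface \<Rightarrow> 'q \<Rightarrow> ('q, 6) tvec \<Rightarrow> ('q, 6) tvec \<Rightarrow> real" where
  "second_ff H q x y =
     amb_metric H (incl H q)
       (cov_deriv_along (atlas H) (amb_atlas H) (amb_metric H) (incl H) q x
          (\<lambda>q'. dincl H q' (const_ext (atlas H) q y q')))
       (normal_field H q)"

definition mean_h :: "('m, 'q) hypersurface \<Rightarrow> 'q \<Rightarrow> real" where
  "mean_h H q = (1 / 6) * trace_form (TM H q) (ind_metric H q) (second_ff H q)"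

definition minimal_variety :: "('m, 'q) hypersurface \<Rightarrow> bool" where
  "minimal_variety H \<longleftrightarrow> (\<forall>q. mean_h H q = 0)"

definition totally_umbilic :: "('m, 'q) hypersurface \<Rightarrow> bool" where
  "totally_umbilic H \<longleftrightarrow>
     (\<forall>q. \<forall>x\<in>TM H q. \<forall>y\<in>TM H q. second_ff H q x y = mean_h H q * ind_metric H q x y)"

definition totally_geodesic :: "('m, 'q) hypersurface \<Rightarrow> bool" where
  "totally_geodesic H \<longleftrightarrow> (\<forall>q. \<forall>x\<in>TM H q. \<forall>y\<in>TM H q. second_ff H q x y = 0)"

section \<open>The induced \<open>SU(3)\<close>-structure\<close>

definition cplx :: "('m, 'q) hypersurface \<Rightarrow> 'q \<Rightarrow> ('q, 6) tvec \<Rightarrow> ('q, 6) tvec" where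
  "cplx H q x = (THE y. y \<in> TM H q
     \<and> dincl H q y
         = cross_P (amb_atlas H) (amb_metric H) (amb_form H) (incl H q) (normal_field H q) (dincl H q x))"

definition cplx_act :: "('m, 'q) hypersurface \<Rightarrow> ('q \<Rightarrow> ('q, 6) tvec \<Rightarrow> ('q, 6) tvec \<Rightarrow> real)
    \<Rightarrow> 'q \<Rightarrow> ('q, 6) tvec \<Rightarrow> ('q, 6) tvec \<Rightarrow> real" where
  "cplx_act H b q x y = b q (cplx H q x) (cplx H q y)"

definition omega :: "('m, 'q) hypersurface \<Rightarrow> 'q \<Rightarrow> ('q, 6) tvec \<Rightarrow> ('q, 6) tvec \<Rightarrow> real" where
  "omega H q x y = ind_metric H q x (cplx H q y)"

definition pull_form :: "('m, 'q) hypersurface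
    \<Rightarrow> 'q \<Rightarrow> ('q, 6) tvec \<Rightarrow> ('q, 6) tvec \<Rightarrow> ('q, 6) tvec \<Rightarrow> real" where
  "pull_form H q x y z = amb_form H (incl H q) (dincl H q x) (dincl H q y) (dincl H q z)"

definition pull_normal_star :: "('m, 'q) hypersurface
    \<Rightarrow> 'q \<Rightarrow> ('q, 6) tvec \<Rightarrow> ('q, 6) tvec \<Rightarrow> ('q, 6) tvec \<Rightarrow> real" where
  "pull_normal_star H q x y z =
     star_form (amb_atlas H) (amb_metric H) (amb_form H) (incl H q)
       (normal_field H q) (dincl H q x) (dincl H q y) (dincl H q z)"

definition psi_plus :: "('m, 'q) hypersurface \<Rightarrow> real
    \<Rightarrow> 'q \<Rightarrow> ('q, 6) tvec \<Rightarrow> ('q, 6) tvec \<Rightarrow> ('q, 6) tvec \<Rightarrow> real" where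
  "psi_plus H \<theta> q x y z = cos \<theta> * pull_form H q x y z - sin \<theta> * pull_normal_star H q x y z"

definition psi_minus :: "('m, 'q) hypersurface \<Rightarrow> real
    \<Rightarrow> 'q \<Rightarrow> ('q, 6) tvec \<Rightarrow> ('q, 6) tvec \<Rightarrow> ('q, 6) tvec \<Rightarrow> real" where
  "psi_minus H \<theta> q x y z = sin \<theta> * pull_form H q x y z + cos \<theta> * pull_normal_star H q x y z"

section \<open>Types of \<open>SU(3)\<close>-structures\<close>

datatype pm = Plus | Minus

datatype W_class = W1 pm | W2 pm | W3 | W4 | W5

definition r_map :: "('m, 'q) hypersurface \<Rightarrow> real \<Rightarrow> 'q
    \<Rightarrow> (('q, 6) tvec \<Rightarrow> ('q, 6) tvec \<Rightarrow> ('q, 6) tvec \<Rightarrow> real)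
    \<Rightarrow> ('q, 6) tvec \<Rightarrow> ('q, 6) tvec \<Rightarrow> real" where
  "r_map H \<theta> q \<alpha> x y = (1 / 2) * inner_2form (TM H q) (ind_metric H q) (\<alpha> x) (psi_plus H \<theta> q y)"

definition r_parity :: "('m, 'q) hypersurface \<Rightarrow> real \<Rightarrow> 'q \<Rightarrow> pm
    \<Rightarrow> (('q, 6) tvec \<Rightarrow> ('q, 6) tvec \<Rightarrow> ('q, 6) tvec \<Rightarrow> real) \<Rightarrow> bool" where
  "r_parity H \<theta> q s \<alpha> \<longleftrightarrow> (\<forall>x\<in>TM H q. \<forall>y\<in>TM H q.
     r_map H \<theta> q \<alpha> y x = (case s of Plus \<Rightarrow> r_map H \<theta> q \<alpha> x y | Minus \<Rightarrow> - r_map H \<theta> q \<alpha> x y))"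

definition GH_space :: "('m, 'q) hypersurface \<Rightarrow> 'q
    \<Rightarrow> (('q, 6) tvec \<Rightarrow> ('q, 6) tvec \<Rightarrow> ('q, 6) tvec \<Rightarrow> real) set" where
  "GH_space H q = {\<alpha>. trilin_on (TM H q) \<alpha>
     \<and> (\<forall>x\<in>TM H q. \<forall>y\<in>TM H q. \<forall>z\<in>TM H q.
          \<alpha> x y z = - \<alpha> x z y \<and> \<alpha> x y z = - \<alpha> x (cplx H q y) (cplx H q z))}"

text \<open>The classes of the Gray--Hervella part of the torsion; \<open>W5\<close> is not one of them and is handled
  separately below.\<close>

definition GH_classes :: "W_class set" where
  "GH_classes = {W1 Plus, W1 Minus, W2 Plus, W2 Minus, W3, W4}"

fun W_condition :: "('m, 'q) hypersurface \<Rightarrow> real \<Rightarrow> 'q \<Rightarrow> W_class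
    \<Rightarrow> (('q, 6) tvec \<Rightarrow> ('q, 6) tvec \<Rightarrow> ('q, 6) tvec \<Rightarrow> real) \<Rightarrow> bool" where
  "W_condition H \<theta> q (W1 s) \<alpha> \<longleftrightarrow>
     (\<forall>x\<in>TM H q. \<forall>y\<in>TM H q. \<forall>z\<in>TM H q. \<alpha> x y z = - \<alpha> y x z \<and> \<alpha> x y z = - \<alpha> x z y)
     \<and> r_parity H \<theta> q s \<alpha>"
| "W_condition H \<theta> q (W2 s) \<alpha> \<longleftrightarrow>
     (\<forall>x\<in>TM H q. \<forall>y\<in>TM H q. \<forall>z\<in>TM H q. \<alpha> x y z + \<alpha> y z x + \<alpha> z x y = 0)
     \<and> r_parity H \<theta> q s \<alpha>"
| "W_condition H \<theta> q W3 \<alpha> \<longleftrightarrow>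
     (\<forall>x\<in>TM H q. \<forall>y\<in>TM H q. \<forall>z\<in>TM H q. \<alpha> (cplx H q x) (cplx H q y) z = \<alpha> x y z)
     \<and> (\<forall>z\<in>TM H q. trace_form (TM H q) (ind_metric H q) (\<lambda>x y. \<alpha> x y z) = 0)"
| "W_condition H \<theta> q W4 \<alpha> \<longleftrightarrow>
     (\<exists>\<tau>. lin_on (TM H q) \<tau> \<and> (\<forall>x\<in>TM H q. \<forall>y\<in>TM H q. \<forall>z\<in>TM H q.
        \<alpha> x y z = ind_metric H q x y * \<tau> z - ind_metric H q x z * \<tau> y
          - ind_metric H q x (cplx H q y) * \<tau> (cplx H q z)
          + ind_metric H q x (cplx H q z) * \<tau> (cplx H q y)))"
| "W_condition H \<theta> q W5 \<alpha> \<longleftrightarrow> False"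

definition W_space :: "('m, 'q) hypersurface \<Rightarrow> real \<Rightarrow> 'q \<Rightarrow> W_class
    \<Rightarrow> (('q, 6) tvec \<Rightarrow> ('q, 6) tvec \<Rightarrow> ('q, 6) tvec \<Rightarrow> real) set" where
  "W_space H \<theta> q w = {\<alpha> \<in> GH_space H q. W_condition H \<theta> q w \<alpha>}"

definition nabla_omega :: "('m, 'q) hypersurface
    \<Rightarrow> 'q \<Rightarrow> ('q, 6) tvec \<Rightarrow> ('q, 6) tvec \<Rightarrow> ('q, 6) tvec \<Rightarrow> real" where
  "nabla_omega H = nabla2 (atlas H) (ind_metric H) (omega H)"

text \<open>The one-form \<open>\<eta>\<close> with \<open>(I\<eta>)(x) = -\<langle>\<nabla>\<^sub>x \<psi>\<^sub>+, \<psi>\<^sub>-\<rangle>/12\<close>. Since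
  \<open>(I\<eta>)(x) = -\<eta>(Ix)\<close> and \<open>I\<^sup>2 = -1\<close>, one has \<open>\<eta>(x) = (I\<eta>)(Ix)\<close>.\<close>

definition eta :: "('m, 'q) hypersurface \<Rightarrow> real \<Rightarrow> 'q \<Rightarrow> ('q, 6) tvec \<Rightarrow> real" where
  "eta H \<theta> q x = - (1 / 12) *
     inner_3form (TM H q) (ind_metric H q)
       (nabla3 (atlas H) (ind_metric H) (psi_plus H \<theta>) q (cplx H q x)) (psi_minus H \<theta> q)"

text \<open>Below, \<open>\<beta> w\<close> is the \<open>w\<close>-component of \<open>\<nabla>\<omega>\<close> at \<open>q\<close>; it is unique on the tangent space,
  because the sum of the spaces \<open>W_space H \<theta> q w\<close> is direct. The type \<open>{0}\<close> is \<open>su3_type H \<theta> {}\<close>.\<close>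

definition su3_type :: "('m, 'q) hypersurface \<Rightarrow> real \<Rightarrow> W_class set \<Rightarrow> bool" where
  "su3_type H \<theta> U \<longleftrightarrow>
     (\<forall>q. \<exists>\<beta>. (\<forall>w\<in>GH_classes. \<beta> w \<in> W_space H \<theta> q w)
        \<and> (\<forall>x\<in>TM H q. \<forall>y\<in>TM H q. \<forall>z\<in>TM H q.
             nabla_omega H q x y z = (\<Sum>w\<in>GH_classes. \<beta> w x y z)
             \<and> (\<forall>w\<in>GH_classes - U. \<beta> w x y z = 0)))
     \<and> (W5 \<notin> U \<longrightarrow> (\<forall>q. \<forall>x\<in>TM H q. eta H \<theta> q x = 0))"

end

(* The pulled-back form phi0 of phi and the structure I satisfy phi0(Ix,y,z) = phi0(x,Iy,z), and
   parallelism of phi gives (nabla_x omega)(y,z) = phi0(Ax,y,z), where A is the shape operator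
   (so B(x,y) = <Ax,y>). Split A = h + A2 + A3 with A2 trace-free and commuting with I, and A3
   anticommuting with I. The three forms phi0(hx,y,z), phi0(A2 x,y,z), phi0(A3 x,y,z) are the W1, W2 and W3
   components of nabla omega, and each vanishes exactly when the corresponding part of A does; the
   only non-formal point is that the cyclic sum of phi0(A2 x,y,z) is zero. Contracting with psi_+
   gives r(alpha) = <Sx,y> for theta = 0 and <Sx,Iy> for theta = pi/2, which explains the sign eps.
   Finally eta = 0: up to sign, nabla_x psi_+ is the wedge of omega with the one-form <Ax,.> (theta = 0) or
   the restriction of the contraction of *phi with Ax (theta = pi/2), and both are orthogonal to psi_-. *)

theory Submission
  imports Defs
begin

section \<open>Derivatives of smooth maps\<close>

text \<open>The definition of \<open>su3_type\<close> asks only for some components in the classes,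
  so the converse directions rest on recovering them. The substitution (Ix, Iy, z) does this:
  elements of \<open>W1\<close> and \<open>W2\<close> change sign under it, those of
  \<open>W3\<close> do not. Adapted unitary frames would make the linear algebra unwieldy. Instead
  everything follows from one quadratic contraction identity, that of the cross product P(a, b). It
  is checked on a \<open>G2_frame\<close> and passed to the hypersurface through an orthonormal
  basis made of n and tangent vectors. The obstacle in the analysis is \<open>star_form\<close>: its
  frame is chosen separately at each point and cannot be differentiated. A contraction of \<phi>
  with itself expresses it in every frame, so a smooth local frame may be used, whose own derivative
  is a skew matrix and drops out. The Levi-Civita connection of the induced metric is recognized by
  uniqueness: the tangential part of the ambient derivative has the properties that characterize its
  Christoffel map.\<close>

lemma frechet_derivative_cong_nhds:
  assumes "\<forall>\<^sub>F x in nhds a. f x = g x"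
  shows "frechet_derivative f (at a) = frechet_derivative g (at a)"
proof -
  obtain S where S: "open S" "a \<in> S" "\<And>x. x \<in> S \<Longrightarrow> f x = g x"
    using assms unfolding eventually_nhds by metis
  \<comment> \<open>Both sides are choices from the set of all derivatives at \<open>a\<close>, and
    the two sets are equal, empty or not.\<close>
  have "(f has_derivative D) (at a) \<longleftrightarrow> (g has_derivative D) (at a)" for D
    using has_derivative_transform_within_open[OF _ S(1,2)] S(3) by metis
  then show ?thesis unfolding frechet_derivative_def by simp
qed

lemma has_derivative_cong_nhds:
  assumes "\<forall>\<^sub>F x in nhds a. f x = g x" and "(f has_derivative D) (at a)"
  shows "(g has_derivative D) (at a)"
proof -
  obtain S where S: "open S" "a \<in> S" "\<And>x. x \<in> S \<Longrightarrow> f x = g x"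
    using assms(1) unfolding eventually_nhds by metis
  show ?thesis
    using has_derivative_transform_within_open[OF assms(2) S(1,2)] S(3) by metis
qed

lemma smooth_on_has_derivative:
  assumes "smooth_on S f" "x \<in> S"
  shows "(f has_derivative frechet_derivative f (at x)) (at x)"
proof -
  have "Ck_on (Suc 0) S f" using assms(1) unfolding smooth_on_def by blast
  then show ?thesis using assms(2) by (simp add: frechet_derivative_works[symmetric])
qed

lemma smooth_on_frechet_derivative:
  assumes "smooth_on S f"
  shows "smooth_on S (\<lambda>x. frechet_derivative f (at x) v)"
  unfolding smooth_on_def
proof
  fix k
  have "Ck_on (Suc k) S f" using assms(1) unfolding smooth_on_def by blast
  then show "Ck_on k S (\<lambda>x. frechet_derivative f (at x) v)" by simp
qed

lemma smooth_on_continuous_on: "smooth_on S f \<Longrightarrow> continuous_on S f"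
  unfolding smooth_on_def by (metis Ck_on.simps(1))

text \<open>Two applications of the mean value theorem: in direction \<open>u\<close> to the
  increment in \<open>v\<close>, then in direction \<open>v\<close> to the derivative in
  \<open>u\<close>. Pairing with \<open>b\<close> makes the maps real-valued, so the intermediate
  point depends on \<open>b\<close>.\<close>

lemma second_difference:
  fixes f :: "'a::real_normed_vector \<Rightarrow> 'b::real_inner"
  assumes f: "smooth_on S f" and t: "0 < t"
    and S: "\<And>s r. \<lbrakk>0 \<le> s; s \<le> t; 0 \<le> r; r \<le> t\<rbrakk> \<Longrightarrow> a + s *\<^sub>R u + r *\<^sub>R v \<in> S"
  shows "\<exists>\<xi>>0. \<exists>\<zeta>>0. \<xi> < t \<and> \<zeta> < t \<and>
    (f (a + t *\<^sub>R u + t *\<^sub>R v) - f (a + t *\<^sub>R u) - f (a + t *\<^sub>R v) + f a) \<bullet> b =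
    t * t * (frechet_derivative (\<lambda>x. frechet_derivative f (at x) u) (at (a + \<xi> *\<^sub>R u + \<zeta> *\<^sub>R v)) v \<bullet> b)"
proof -
  define f' where "f' x = frechet_derivative f (at x)" for x
  have lin: "\<And>x. x \<in> S \<Longrightarrow> linear (f' x)"
    unfolding f'_def using smooth_on_has_derivative[OF f] has_derivative_linear by blast
  have d1: "((\<lambda>s. f (a + s *\<^sub>R u + r *\<^sub>R v) \<bullet> b) has_real_derivative f' (a + s *\<^sub>R u + r *\<^sub>R v) u \<bullet> b) (at s)"
    if "0 \<le> s" "s \<le> t" "0 \<le> r" "r \<le> t" for s r
  proof -
    have i: "a + s *\<^sub>R u + r *\<^sub>R v \<in> S" using S that by blast
    have "((\<lambda>s. a + s *\<^sub>R u + r *\<^sub>R v) has_derivative (\<lambda>h. h *\<^sub>R u)) (at s)"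
      by (auto intro!: derivative_eq_intros)
    from has_derivative_compose[OF this smooth_on_has_derivative[OF f i]]
    have "((\<lambda>s. f (a + s *\<^sub>R u + r *\<^sub>R v) \<bullet> b) has_derivative (\<lambda>h. f' (a + s *\<^sub>R u + r *\<^sub>R v) (h *\<^sub>R u) \<bullet> b)) (at s)"
      unfolding f'_def by (rule has_derivative_inner_left)
    moreover have "(\<lambda>h. f' (a + s *\<^sub>R u + r *\<^sub>R v) (h *\<^sub>R u) \<bullet> b) = (*) (f' (a + s *\<^sub>R u + r *\<^sub>R v) u \<bullet> b)"
      using lin[OF i] by (auto simp: linear_scale fun_eq_iff)
    ultimately show ?thesis unfolding has_field_derivative_def by simp
  qed
  have "\<exists>z>0. z < t \<and> (f (a + t *\<^sub>R u + t *\<^sub>R v) \<bullet> b - f (a + t *\<^sub>R u + 0 *\<^sub>R v) \<bullet> b)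
      - (f (a + 0 *\<^sub>R u + t *\<^sub>R v) \<bullet> b - f (a + 0 *\<^sub>R u + 0 *\<^sub>R v) \<bullet> b)
      = (t - 0) * (f' (a + z *\<^sub>R u + t *\<^sub>R v) u \<bullet> b - f' (a + z *\<^sub>R u + 0 *\<^sub>R v) u \<bullet> b)"
    by (rule MVT2[OF t]) (intro DERIV_diff d1, use t in auto)
  then obtain \<xi> where \<xi>: "0 < \<xi>" "\<xi> < t" and e1: "(f (a + t *\<^sub>R u + t *\<^sub>R v) \<bullet> b - f (a + t *\<^sub>R u) \<bullet> b)
      - (f (a + t *\<^sub>R v) \<bullet> b - f a \<bullet> b)
      = t * (f' (a + \<xi> *\<^sub>R u + t *\<^sub>R v) u \<bullet> b - f' (a + \<xi> *\<^sub>R u + 0 *\<^sub>R v) u \<bullet> b)"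
    by auto
  define k where "k = (\<lambda>x. frechet_derivative f (at x) u)"
  have k: "smooth_on S k" unfolding k_def by (rule smooth_on_frechet_derivative[OF f])
  have d2: "((\<lambda>r. k (a + \<xi> *\<^sub>R u + r *\<^sub>R v) \<bullet> b) has_real_derivative frechet_derivative k (at (a + \<xi> *\<^sub>R u + r *\<^sub>R v)) v \<bullet> b) (at r)"
    if "0 \<le> r" "r \<le> t" for r
  proof -
    have i: "a + \<xi> *\<^sub>R u + r *\<^sub>R v \<in> S" using S that \<xi> by auto
    have "((\<lambda>r. a + \<xi> *\<^sub>R u + r *\<^sub>R v) has_derivative (\<lambda>h. h *\<^sub>R v)) (at r)"
      by (auto intro!: derivative_eq_intros)
    from has_derivative_compose[OF this smooth_on_has_derivative[OF k i]]
    have "((\<lambda>r. k (a + \<xi> *\<^sub>R u + r *\<^sub>R v) \<bullet> b) has_derivative (\<lambda>h. frechet_derivative k (at (a + \<xi> *\<^sub>R u + r *\<^sub>R v)) (h *\<^sub>R v) \<bullet> b)) (at r)"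
      by (rule has_derivative_inner_left)
    moreover have "linear (frechet_derivative k (at (a + \<xi> *\<^sub>R u + r *\<^sub>R v)))"
      using smooth_on_has_derivative[OF k i] has_derivative_linear by blast
    then have "(\<lambda>h. frechet_derivative k (at (a + \<xi> *\<^sub>R u + r *\<^sub>R v)) (h *\<^sub>R v) \<bullet> b) = (*) (frechet_derivative k (at (a + \<xi> *\<^sub>R u + r *\<^sub>R v)) v \<bullet> b)"
      by (auto simp: linear_scale fun_eq_iff)
    ultimately show ?thesis unfolding has_field_derivative_def by simp
  qed
  have "\<exists>z>0. z < t \<and> k (a + \<xi> *\<^sub>R u + t *\<^sub>R v) \<bullet> b - k (a + \<xi> *\<^sub>R u + 0 *\<^sub>R v) \<bullet> b
      = (t - 0) * (frechet_derivative k (at (a + \<xi> *\<^sub>R u + z *\<^sub>R v)) v \<bullet> b)"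
    by (rule MVT2[OF t d2]) auto
  then obtain \<zeta> where "0 < \<zeta>" "\<zeta> < t" "k (a + \<xi> *\<^sub>R u + t *\<^sub>R v) \<bullet> b - k (a + \<xi> *\<^sub>R u) \<bullet> b
      = t * (frechet_derivative k (at (a + \<xi> *\<^sub>R u + \<zeta> *\<^sub>R v)) v \<bullet> b)"
    by auto
  then show ?thesis using \<xi> e1 unfolding f'_def k_def
    by (intro exI[of _ \<xi>] conjI exI[of _ \<zeta>]) (auto simp: inner_diff_left inner_add_left)
qed

text \<open>The second difference over the parallelogram spanned by t u and t v is symmetric in u
  and v. Divided by t^2 it is a mixed derivative, in either order, at a point near \<open>a\<close>;
  continuity of both mixed derivatives forces equality at \<open>a\<close>.\<close>

lemma smooth_on_second_derivative_symmetric: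
  fixes f :: "'a::real_normed_vector \<Rightarrow> 'b::real_inner"
  assumes "open S" "smooth_on S f" "a \<in> S"
  shows "frechet_derivative (\<lambda>x. frechet_derivative f (at x) u) (at a) v
       = frechet_derivative (\<lambda>x. frechet_derivative f (at x) v) (at a) u"
proof -
  define F where "F u v x = frechet_derivative (\<lambda>x. frechet_derivative f (at x) u) (at x) v" for u v x
  have cont: "isCont (F u v) a" for u v
    unfolding F_def using assms
    by (intro continuous_on_interior[of S] smooth_on_continuous_on smooth_on_frechet_derivative)
      (auto simp: interior_open)
  have "F u v a \<bullet> b = F v u a \<bullet> b" for b
  proof (rule ccontr)
    assume ne: "F u v a \<bullet> b \<noteq> F v u a \<bullet> b"
    \<comment> \<open>Half the gap: two equal numbers, each within \<open>e\<close> of one of the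
      two values, would make the gap smaller than 2 e.\<close>
    define e where "e = \<bar>F u v a \<bullet> b - F v u a \<bullet> b\<bar> / 2"
    have "e > 0" using ne by (simp add: e_def)
    have c: "isCont (\<lambda>x. F u v x \<bullet> b) a" for u v
      by (intro continuous_inner cont continuous_const)
    obtain d1 where d1: "d1 > 0" "\<And>x. dist x a < d1 \<Longrightarrow> dist (F u v x \<bullet> b) (F u v a \<bullet> b) < e"
      using c[of u v] \<open>e > 0\<close> unfolding continuous_at_eps_delta by metis
    obtain d2 where d2: "d2 > 0" "\<And>x. dist x a < d2 \<Longrightarrow> dist (F v u x \<bullet> b) (F v u a \<bullet> b) < e"
      using c[of v u] \<open>e > 0\<close> unfolding continuous_at_eps_delta by metis
    obtain d3 where d3: "d3 > 0" "\<And>x. dist x a < d3 \<Longrightarrow> x \<in> S"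
      using assms unfolding open_dist by metis
    define d where "d = min d1 (min d2 d3)"
    have d: "d > 0" "d \<le> d1" "d \<le> d2" "d \<le> d3" using d1 d2 d3 by (auto simp: d_def)
    \<comment> \<open>Scaled so that the whole parallelogram lies in the ball of radius
      \<open>d\<close>; the summand 1 keeps the denominator positive when u = v = 0.\<close>
    define t where "t = d / (norm u + norm v + 1)"
    have np: "norm u + norm v + 1 > 0" using norm_ge_zero[of u] norm_ge_zero[of v] by linarith
    have t: "t > 0" using d np by (simp add: t_def)
    have tn: "t * (norm u + norm v) < d"
      using d np by (simp add: t_def field_simps)
    have close: "dist (a + s *\<^sub>R u + r *\<^sub>R v) a < d" if "0 \<le> s" "s \<le> t" "0 \<le> r" "r \<le> t" for s r
    proof -
      have "dist (a + s *\<^sub>R u + r *\<^sub>R v) a \<le> norm (s *\<^sub>R u) + norm (r *\<^sub>R v)"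
        using norm_triangle_ineq[of "s *\<^sub>R u" "r *\<^sub>R v"] by (simp add: dist_norm add.assoc)
      also have "\<dots> = s * norm u + r * norm v" using that by simp
      also have "\<dots> \<le> t * norm u + t * norm v" using that by (intro add_mono mult_right_mono) auto
      finally show ?thesis using tn by (simp add: algebra_simps)
    qed
    have close': "dist (a + s *\<^sub>R v + r *\<^sub>R u) a < d" if "0 \<le> s" "s \<le> t" "0 \<le> r" "r \<le> t" for s r
      using close[of r s] that by (simp add: algebra_simps)
    obtain x where x: "dist x a < d" "(f (a + t *\<^sub>R u + t *\<^sub>R v) - f (a + t *\<^sub>R u) - f (a + t *\<^sub>R v) + f a) \<bullet> b = t * t * (F u v x \<bullet> b)"
    proof -
      have "a + s *\<^sub>R u + r *\<^sub>R v \<in> S" if "0 \<le> s" "s \<le> t" "0 \<le> r" "r \<le> t" for s r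
        using d3(2) close[OF that] d(4) by (meson less_le_trans)
      from second_difference[OF assms(2) t this, where b = b] obtain \<xi> \<zeta>
        where xz: "0 < \<xi>" "0 < \<zeta>" "\<xi> < t" "\<zeta> < t"
         "(f (a + t *\<^sub>R u + t *\<^sub>R v) - f (a + t *\<^sub>R u) - f (a + t *\<^sub>R v) + f a) \<bullet> b = t * t * (F u v (a + \<xi> *\<^sub>R u + \<zeta> *\<^sub>R v) \<bullet> b)"
        unfolding F_def by blast
      show thesis
        by (rule that[OF close xz(5)]) (use xz in auto)
    qed
    obtain y where y: "dist y a < d" "(f (a + t *\<^sub>R v + t *\<^sub>R u) - f (a + t *\<^sub>R v) - f (a + t *\<^sub>R u) + f a) \<bullet> b = t * t * (F v u y \<bullet> b)"
    proof -
      have "a + s *\<^sub>R v + r *\<^sub>R u \<in> S" if "0 \<le> s" "s \<le> t" "0 \<le> r" "r \<le> t" for s r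
        using d3(2) close'[OF that] d(4) by (meson less_le_trans)
      from second_difference[OF assms(2) t this, where b = b] obtain \<xi> \<zeta>
        where xz: "0 < \<xi>" "0 < \<zeta>" "\<xi> < t" "\<zeta> < t"
         "(f (a + t *\<^sub>R v + t *\<^sub>R u) - f (a + t *\<^sub>R v) - f (a + t *\<^sub>R u) + f a) \<bullet> b = t * t * (F v u (a + \<xi> *\<^sub>R v + \<zeta> *\<^sub>R u) \<bullet> b)"
        unfolding F_def by blast
      show thesis
        by (rule that[OF close' xz(5)]) (use xz in auto)
    qed
    have "t * t * (F u v x \<bullet> b) = t * t * (F v u y \<bullet> b)"
      unfolding x(2)[symmetric] y(2)[symmetric] by (simp add: algebra_simps)
    then have "F u v x \<bullet> b = F v u y \<bullet> b" using t by simp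
    moreover have "dist (F u v x \<bullet> b) (F u v a \<bullet> b) < e" "dist (F v u y \<bullet> b) (F v u a \<bullet> b) < e"
      using d1 d2 x(1) y(1) d by auto
    ultimately show False unfolding e_def dist_real_def by argo
  qed
  then show ?thesis unfolding F_def by (metis inner_commute vector_eq_rdot)
qed

text \<open>Product rule for a moving linear form applied to a moving vector: in the standard basis
  it is a finite sum of products of real functions. It serves to pass from tensors on coordinate
  fields to tensors on fields with variable components.\<close>

lemma has_derivative_linear_family:
  fixes L :: "'x::real_normed_vector \<Rightarrow> real ^ 'n::finite \<Rightarrow> real"
  assumes L: "\<forall>\<^sub>F x in nhds a. linear (L x)"
    and DL: "\<And>v. ((\<lambda>x. L x v) has_derivative DL v) (at a)"
    and w: "(w has_derivative w') (at a)"
  shows "((\<lambda>x. L x (w x)) has_derivative (\<lambda>h. DL (w a) h + L a (w' h))) (at a)"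
proof -
  have ex: "l v = (\<Sum>i\<in>UNIV. v $ i * l (axis i 1))" if "linear l" for l :: "real ^ 'n \<Rightarrow> real" and v
  proof -
    have "l v = l (\<Sum>i\<in>UNIV. (v $ i) *\<^sub>R axis i 1)"
      by (metis (no_types) basis_expansion scalar_mult_eq_scaleR)
    then show ?thesis using that by (simp add: linear_sum linear_scale)
  qed
  have La: "linear (L a)" using L eventually_nhds_x_imp_x by blast
  have E: "\<forall>\<^sub>F x in nhds a. (\<Sum>i\<in>UNIV. u x $ i * L x (axis i 1)) = L x (u x)" for u
    using L by eventually_elim (rule ex[symmetric])
  have D: "((\<lambda>x. L x (u x)) has_derivative (\<lambda>h. \<Sum>i\<in>UNIV. u a $ i * DL (axis i 1) h + u' h $ i * L a (axis i 1))) (at a)"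
    if u: "(u has_derivative u') (at a)" for u u'
    by (rule has_derivative_cong_nhds[OF E])
      (intro has_derivative_sum has_derivative_mult DL bounded_linear.has_derivative[OF bounded_linear_vec_nth] u)
  \<comment> \<open>The formula for the constant vector \<open>w a\<close> must agree with the
    assumed derivative; this expresses \<open>DL\<close> through its values on basis
    vectors.\<close>
  have "DL (w a) = (\<lambda>h. \<Sum>i\<in>UNIV. w a $ i * DL (axis i 1) h)"
    using has_derivative_unique[OF DL D[OF has_derivative_const, of "w a"]] by simp
  then show ?thesis
    using D[OF w] by (simp add: sum.distrib ex[OF La, of "w' _"])
qed

section \<open>Charts and tangent spaces\<close>

lemma coord_simps [simp]:
  "coord 0 c = 0" "coord (v + w) c = coord v c + coord w c" "coord (v - w) c = coord v c - coord w c"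
  "coord (- v) c = - coord v c" "coord (r *\<^sub>R v) c = r *\<^sub>R coord v c"
  by (simp_all add: zero_tvec_def plus_tvec_def minus_tvec_def uminus_tvec_def scaleR_tvec_def)

lemma chart_inv_left: "is_chart c \<Longrightarrow> p \<in> fst c \<Longrightarrow> chart_inv c (snd c p) = p"
  unfolding is_chart_def homeomorphism_def by blast

lemma chart_inv_in: "is_chart c \<Longrightarrow> a \<in> snd c ` fst c \<Longrightarrow> chart_inv c a \<in> fst c"
  unfolding is_chart_def homeomorphism_def by blast

lemma open_chart_image:
  assumes "is_chart c" "open U"
  shows "open (snd c ` (fst c \<inter> U))"
proof -
  have "snd c ` (fst c \<inter> U) = chart_inv c -` U \<inter> snd c ` fst c"
    using assms(1) by (auto simp: chart_inv_left chart_inv_in)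
  moreover have "open (chart_inv c -` U \<inter> snd c ` fst c)"
    using assms unfolding is_chart_def homeomorphism_def
    by (metis continuous_on_open_vimage)
  ultimately show ?thesis by simp
qed

lemma filterlim_chart_inv:
  assumes "is_chart c" "p \<in> fst c"
  shows "filterlim (chart_inv c) (nhds p) (nhds (snd c p))"
proof -
  have "continuous_on (snd c ` fst c) (chart_inv c)" "open (snd c ` fst c)"
    using assms unfolding is_chart_def homeomorphism_def by auto
  then have "isCont (chart_inv c) (snd c p)"
    using assms continuous_on_eq_continuous_at by blast
  then show ?thesis
    using assms by (metis chart_inv_left isCont_def tendsto_at_iff_tendsto_nhds)
qed

lemma eventually_chart_inv:
  assumes "is_chart c" "p \<in> fst c" "\<forall>\<^sub>F p' in nhds p. Q p'"
  shows "\<forall>\<^sub>F a in nhds (snd c p). Q (chart_inv c a)"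
  using filterlim_chart_inv[OF assms(1,2)] assms(3) by (simp add: filterlim_iff)

lemma eventually_in_chart:
  assumes "is_chart c" "p \<in> fst c"
  shows "\<forall>\<^sub>F p' in nhds p. p' \<in> fst c"
  using assms unfolding is_chart_def by (auto intro: eventually_nhds_in_open)

lemma charts_atD:
  assumes "smooth_atlas A" "c \<in> charts_at A p"
  shows "c \<in> A" "p \<in> fst c" "is_chart c"
  using assms unfolding charts_at_def smooth_atlas_def by auto

lemma chart_of_in_charts_at:
  assumes "smooth_atlas A"
  shows "chart_of A p \<in> charts_at A p"
proof -
  have "\<exists>c. c \<in> charts_at A p" using assms unfolding smooth_atlas_def charts_at_def by blast
  then show ?thesis unfolding chart_of_def by (rule someI_ex)
qed

lemma transition_has_derivative:
  assumes A: "smooth_atlas A" and c: "c \<in> charts_at A p" and c': "c' \<in> charts_at A p"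
  shows "((snd c' \<circ> chart_inv c) has_derivative frechet_derivative (snd c' \<circ> chart_inv c) (at (snd c p))) (at (snd c p))"
proof (rule smooth_on_has_derivative)
  show "smooth_on (snd c ` (fst c \<inter> fst c')) (snd c' \<circ> chart_inv c)"
    using assms unfolding smooth_atlas_def charts_at_def by blast
  show "snd c p \<in> snd c ` (fst c \<inter> fst c')"
    using charts_atD[OF A c] charts_atD[OF A c'] by blast
qed

lemma has_derivative_change_chart:
  assumes A: "smooth_atlas A" and c: "c \<in> charts_at A p" and c': "c' \<in> charts_at A p"
    and F: "((F \<circ> chart_inv c') has_derivative D) (at (snd c' p))"
  shows "((F \<circ> chart_inv c) has_derivative
     D \<circ> frechet_derivative (snd c' \<circ> chart_inv c) (at (snd c p))) (at (snd c p))"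
proof -
  note C = charts_atD[OF A c] and C' = charts_atD[OF A c']
  have "(snd c' \<circ> chart_inv c) (snd c p) = snd c' p" using C by (simp add: chart_inv_left)
  then have "((F \<circ> chart_inv c') has_derivative D) (at ((snd c' \<circ> chart_inv c) (snd c p)))"
    using F by simp
  from diff_chain_at[OF transition_has_derivative[OF A c c'] this]
  have "((F \<circ> chart_inv c') \<circ> (snd c' \<circ> chart_inv c) has_derivative
     D \<circ> frechet_derivative (snd c' \<circ> chart_inv c) (at (snd c p))) (at (snd c p))" .
  moreover have "\<forall>\<^sub>F a in nhds (snd c p). ((F \<circ> chart_inv c') \<circ> (snd c' \<circ> chart_inv c)) a = (F \<circ> chart_inv c) a"
    using eventually_chart_inv[OF C(3,2) eventually_in_chart[OF C'(3,2)]]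
    by eventually_elim (simp add: chart_inv_left C')
  ultimately show ?thesis by (rule has_derivative_cong_nhds[rotated])
qed

lemma transition_cocycle:
  assumes A: "smooth_atlas A" and c: "c \<in> charts_at A p" "c' \<in> charts_at A p" "c'' \<in> charts_at A p"
  shows "frechet_derivative (snd c'' \<circ> chart_inv c) (at (snd c p)) u =
    frechet_derivative (snd c'' \<circ> chart_inv c') (at (snd c' p))
      (frechet_derivative (snd c' \<circ> chart_inv c) (at (snd c p)) u)"
  using frechet_derivative_at[OF has_derivative_change_chart[OF A c(1,2) transition_has_derivative[OF A c(2,3)]]]
  by (metis comp_apply)

lemma transition_self:
  assumes A: "smooth_atlas A" and c: "c \<in> charts_at A p"
  shows "frechet_derivative (snd c \<circ> chart_inv c) (at (snd c p)) u = u"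
proof -
  note C = charts_atD[OF A c]
  have "open (snd c ` fst c)" "snd c p \<in> snd c ` fst c" using C unfolding is_chart_def by auto
  then have "\<forall>\<^sub>F a in nhds (snd c p). a \<in> snd c ` fst c" by (rule eventually_nhds_in_open)
  then have "\<forall>\<^sub>F a in nhds (snd c p). (snd c \<circ> chart_inv c) a = id a"
    by eventually_elim (auto simp: C chart_inv_left)
  then have "frechet_derivative (snd c \<circ> chart_inv c) (at (snd c p)) = frechet_derivative id (at (snd c p))"
    by (rule frechet_derivative_cong_nhds)
  then show ?thesis by simp
qed

lemma transition_linear:
  assumes A: "smooth_atlas A" and c: "c \<in> charts_at A p" "c' \<in> charts_at A p"
  shows "linear (frechet_derivative (snd c' \<circ> chart_inv c) (at (snd c p)))"
  using transition_has_derivative[OF assms] has_derivative_linear by blast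

lemma coord_coord_field:
  assumes "c' \<in> charts_at A p"
  shows "coord (coord_field A c u p) c' = frechet_derivative (snd c' \<circ> chart_inv c) (at (snd c p)) u"
  using assms by (simp add: coord_field_def)

lemma coord_coord_field_same [simp]:
  assumes "smooth_atlas A" "c \<in> charts_at A p"
  shows "coord (coord_field A c u p) c = u"
  using assms by (simp add: coord_coord_field transition_self)

lemma coord_field_in_tangent_space:
  assumes A: "smooth_atlas A" and c: "c \<in> charts_at A p"
  shows "coord_field A c u p \<in> tangent_space A p"
  unfolding tangent_space_def
proof (intro CollectI conjI ballI allI impI)
  fix c1 c2 assume c1: "c1 \<in> charts_at A p" and c2: "c2 \<in> charts_at A p"
  show "coord (coord_field A c u p) c2
      = frechet_derivative (snd c2 \<circ> chart_inv c1) (at (snd c1 p)) (coord (coord_field A c u p) c1)"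
    unfolding coord_coord_field[OF c1] coord_coord_field[OF c2] by (rule transition_cocycle[OF A c c1 c2])
qed (simp add: coord_field_def)

lemma tangent_space_transition:
  assumes "x \<in> tangent_space A p" "c \<in> charts_at A p" "c' \<in> charts_at A p"
  shows "coord x c' = frechet_derivative (snd c' \<circ> chart_inv c) (at (snd c p)) (coord x c)"
  using assms unfolding tangent_space_def by blast

lemma tangent_space_outside:
  assumes "x \<in> tangent_space A p" "c \<notin> charts_at A p"
  shows "coord x c = 0"
  using assms unfolding tangent_space_def by blast

lemma tangent_spaceI:
  assumes "\<And>c c'. \<lbrakk>c \<in> charts_at A p; c' \<in> charts_at A p\<rbrakk> \<Longrightarrow>
      coord x c' = frechet_derivative (snd c' \<circ> chart_inv c) (at (snd c p)) (coord x c)"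
    and "\<And>c. c \<notin> charts_at A p \<Longrightarrow> coord x c = 0"
  shows "x \<in> tangent_space A p"
  using assms unfolding tangent_space_def by blast

text \<open>One chart determines a tangent vector: Jacobians give the components in the other charts
  at \<open>p\<close>, and all remaining components are zero.\<close>

lemma tangent_space_eqI:
  assumes "c \<in> charts_at A p" "v \<in> tangent_space A p" "w \<in> tangent_space A p" "coord v c = coord w c"
  shows "v = w"
  unfolding tvec_eq_iff
proof
  fix c'
  show "coord v c' = coord w c'"
    using assms(4) tangent_space_transition[OF assms(2,1), of c'] tangent_space_transition[OF assms(3,1), of c']
      tangent_space_outside[OF assms(2), of c'] tangent_space_outside[OF assms(3), of c']
    by (cases "c' \<in> charts_at A p") simp_all
qed

lemma coord_field_coord:
  assumes A: "smooth_atlas A" and c: "c \<in> charts_at A p" and v: "v \<in> tangent_space A p"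
  shows "coord_field A c (coord v c) p = v"
  using assms by (intro tangent_space_eqI[OF c]) (auto intro: coord_field_in_tangent_space)

lemma subspace_tangent_space:
  assumes A: "smooth_atlas A"
  shows "subspace (tangent_space A p)"
proof (rule subspaceI)
  note L = transition_linear[OF A] and t = tangent_space_transition and o = tangent_space_outside
  show "0 \<in> tangent_space A p"
    by (rule tangent_spaceI) (simp_all add: linear_0[OF L])
  show "x + y \<in> tangent_space A p" if x: "x \<in> tangent_space A p" and y: "y \<in> tangent_space A p" for x y
    by (rule tangent_spaceI) (simp_all only: coord_simps linear_add[OF L] t[OF x, symmetric] t[OF y, symmetric]
        o[OF x] o[OF y] add_0 not_False_eq_True)
  show "r *\<^sub>R x \<in> tangent_space A p" if x: "x \<in> tangent_space A p" for r x
    by (rule tangent_spaceI) (simp_all only: coord_simps linear_scale[OF L] t[OF x, symmetric]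
        o[OF x] scaleR_zero_right not_False_eq_True)
qed

lemma coord_field_add:
  assumes A: "smooth_atlas A" and c: "c \<in> charts_at A p"
  shows "coord_field A c (u + v) p = coord_field A c u p + coord_field A c v p"
  using assms by (intro tangent_space_eqI[OF c] subspace_add subspace_tangent_space coord_field_in_tangent_space) auto

lemma coord_field_scaleR:
  assumes A: "smooth_atlas A" and c: "c \<in> charts_at A p"
  shows "coord_field A c (r *\<^sub>R u) p = r *\<^sub>R coord_field A c u p"
  using assms by (intro tangent_space_eqI[OF c] subspace_scale subspace_tangent_space coord_field_in_tangent_space) auto

lemma linear_coord_field:
  assumes A: "smooth_atlas A" and c: "c \<in> charts_at A p"
  shows "linear (\<lambda>u. coord_field A c u p)"
  by (rule linearI) (simp_all add: coord_field_add[OF assms] coord_field_scaleR[OF assms])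

text \<open>The Jacobian from the chain rule cancels against the one in the transformation law of
  \<open>x\<close>, so any chart at \<open>p\<close> may replace the one chosen in the
  definition.\<close>

lemma dir_deriv_eq:
  assumes A: "smooth_atlas A" and c: "c \<in> charts_at A p" and x: "x \<in> tangent_space A p"
    and F: "((F \<circ> chart_inv c) has_derivative D) (at (snd c p))"
  shows "dir_deriv A p x F = D (coord x c)"
proof -
  let ?c = "chart_of A p"
  have c0: "?c \<in> charts_at A p" by (rule chart_of_in_charts_at[OF A])
  have "frechet_derivative (F \<circ> chart_inv ?c) (at (snd ?c p))
      = D \<circ> frechet_derivative (snd c \<circ> chart_inv ?c) (at (snd ?c p))"
    using frechet_derivative_at[OF has_derivative_change_chart[OF A c0 c F]] by simp
  moreover have "coord x c = frechet_derivative (snd c \<circ> chart_inv ?c) (at (snd ?c p)) (coord x ?c)"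
    by (rule tangent_space_transition[OF x c0 c])
  ultimately show ?thesis unfolding dir_deriv_def by simp
qed

lemma dir_deriv_cong:
  assumes A: "smooth_atlas A" and "\<forall>\<^sub>F p' in nhds p. F p' = G p'"
  shows "dir_deriv A p x F = dir_deriv A p x G"
proof -
  let ?c = "chart_of A p"
  note C = charts_atD[OF A chart_of_in_charts_at[OF A, of p]]
  have "\<forall>\<^sub>F a in nhds (snd ?c p). (F \<circ> chart_inv ?c) a = (G \<circ> chart_inv ?c) a"
    using eventually_chart_inv[OF C(3,2) assms(2)] by simp
  then show ?thesis unfolding dir_deriv_def by (simp only: frechet_derivative_cong_nhds)
qed

section \<open>Linear algebra of inner product spaces\<close>

lemma lin_on_add: "lin_on V f \<Longrightarrow> x \<in> V \<Longrightarrow> y \<in> V \<Longrightarrow> f (x + y) = f x + f y"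
  unfolding lin_on_def by (metis mult_1 scaleR_one)

lemma lin_on_scale: "lin_on V f \<Longrightarrow> x \<in> V \<Longrightarrow> f (r *\<^sub>R x) = r * f x"
  unfolding lin_on_def by (metis add.right_neutral mult_zero_left scaleR_zero_left)

lemma lin_on_zero: "lin_on V f \<Longrightarrow> subspace V \<Longrightarrow> f 0 = 0"
  using lin_on_scale[of V f 0 0] subspace_0 by fastforce

lemma lin_on_minus: "lin_on V f \<Longrightarrow> x \<in> V \<Longrightarrow> f (- x) = - f x"
  using lin_on_scale[of V f x "-1"] by simp

lemma lin_on_diff: "lin_on V f \<Longrightarrow> subspace V \<Longrightarrow> x \<in> V \<Longrightarrow> y \<in> V \<Longrightarrow> f (x - y) = f x - f y"
  using lin_on_add[of V f x "- y"] lin_on_minus[of V f y] subspace_neg by fastforce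

lemma lin_on_sum:
  assumes "lin_on V f" "subspace V" "\<And>i. i \<in> K \<Longrightarrow> v i \<in> V"
  shows "f (\<Sum>i\<in>K. v i) = (\<Sum>i\<in>K. f (v i))"
  using assms(3)
  by (induction K rule: infinite_finite_induct)
    (auto simp: lin_on_zero[OF assms(1,2)] lin_on_add[OF assms(1)] subspace_sum[OF assms(2)])

lemma lin_onI:
  assumes "\<And>x y. x \<in> V \<Longrightarrow> y \<in> V \<Longrightarrow> f (x + y) = f x + f y" "\<And>x r. x \<in> V \<Longrightarrow> f (r *\<^sub>R x) = r * f x"
    "subspace V"
  shows "lin_on V f"
  using assms unfolding lin_on_def by (auto simp: subspace_scale)

text \<open>Everything is relative to a subset \<open>V\<close> because each tangent space is a
  subspace of the one type \<open>tvec\<close>, and forms on it take arbitrary values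
  outside.\<close>

locale inner_on =
  fixes V :: "'v::real_vector set" and g :: "'v \<Rightarrow> 'v \<Rightarrow> real"
  assumes sub: "subspace V"
    and lin: "x \<in> V \<Longrightarrow> lin_on V (g x)"
    and sym: "x \<in> V \<Longrightarrow> y \<in> V \<Longrightarrow> g x y = g y x"
    and pos: "x \<in> V \<Longrightarrow> x \<noteq> 0 \<Longrightarrow> g x x > 0"
begin

lemmas in_add = subspace_add[OF sub] and in_scale = subspace_scale[OF sub]
  and in_diff = subspace_diff[OF sub] and in_neg = subspace_neg[OF sub]
  and in_zero = subspace_0[OF sub] and in_sum = subspace_sum[OF sub]

lemmas in_V = in_add in_scale in_diff in_neg in_zero

lemma lin_left: "y \<in> V \<Longrightarrow> lin_on V (\<lambda>x. g x y)"
  using lin[of y] unfolding lin_on_def by (auto simp: sym in_V)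

lemma g_right [simp]:
  assumes "x \<in> V"
  shows "y \<in> V \<Longrightarrow> z \<in> V \<Longrightarrow> g x (y + z) = g x y + g x z"
    "y \<in> V \<Longrightarrow> z \<in> V \<Longrightarrow> g x (y - z) = g x y - g x z"
    "y \<in> V \<Longrightarrow> g x (- y) = - g x y" "y \<in> V \<Longrightarrow> g x (r *\<^sub>R y) = r * g x y" "g x 0 = 0"
  using lin[OF assms] lin_on_add lin_on_diff[OF _ sub] lin_on_minus lin_on_scale lin_on_zero[OF _ sub]
  by blast+

lemma g_left [simp]:
  assumes "x \<in> V"
  shows "y \<in> V \<Longrightarrow> z \<in> V \<Longrightarrow> g (y + z) x = g y x + g z x"
    "y \<in> V \<Longrightarrow> z \<in> V \<Longrightarrow> g (y - z) x = g y x - g z x"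
    "y \<in> V \<Longrightarrow> g (- y) x = - g y x" "y \<in> V \<Longrightarrow> g (r *\<^sub>R y) x = r * g y x" "g 0 x = 0"
  using assms by (simp_all add: sym[of _ x] in_V)

lemma g_sum_left: "(\<And>i. i \<in> K \<Longrightarrow> v i \<in> V) \<Longrightarrow> x \<in> V \<Longrightarrow> g (\<Sum>i\<in>K. v i) x = (\<Sum>i\<in>K. g (v i) x)"
  using lin_on_sum[OF lin_left sub] .

lemma g_nonneg: "x \<in> V \<Longrightarrow> g x x \<ge> 0"
  using pos[of x] by (cases "x = 0") (auto simp: in_V)

lemma g_eq_0: "x \<in> V \<Longrightarrow> g x x = 0 \<Longrightarrow> x = 0"
  using pos[of x] by force

lemma eqI: "x \<in> V \<Longrightarrow> y \<in> V \<Longrightarrow> (\<And>z. z \<in> V \<Longrightarrow> g x z = g y z) \<Longrightarrow> x = y"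
  using g_eq_0[of "x - y"] by (auto simp: in_V)

lemma orthonormal_independent:
  assumes S: "finite S" "S \<subseteq> V" "\<And>x y. x \<in> S \<Longrightarrow> y \<in> S \<Longrightarrow> g x y = (if x = y then 1 else 0)"
  shows "independent S"
proof (rule independent_if_scalars_zero[OF S(1)])
  fix f x assume f: "(\<Sum>x\<in>S. f x *\<^sub>R x) = 0" and x: "x \<in> S"
  have "0 = g (\<Sum>y\<in>S. f y *\<^sub>R y) x" using f x S(2) by (auto simp: in_V)
  also have "\<dots> = (\<Sum>y\<in>S. g (f y *\<^sub>R y) x)"
    using S x by (intro g_sum_left) (auto simp: in_V)
  also have "\<dots> = (\<Sum>y\<in>S. if y = x then f y else 0)"
    using S x by (intro sum.cong) (auto simp: subset_iff)
  finally show "f x = 0" using x S by simp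
qed

text \<open>An orthonormal set of maximal size replaces the Gram-Schmidt recursion: sizes are
  bounded by \<open>card T\<close>, and a vector outside the span would supply a further unit
  vector.\<close>

lemma ex_orthonormal_basis:
  assumes T: "finite T" "independent T" "span T = V" "card T = CARD('n::finite)"
  shows "\<exists>e::'n::finite \<Rightarrow> 'v. orthonormal_basis V g e"
proof -
  define P where "P S \<longleftrightarrow> finite S \<and> S \<subseteq> V \<and> (\<forall>x\<in>S. \<forall>y\<in>S. g x y = (if x = y then 1 else 0))" for S
  have ind: "independent S" if "P S" for S
    using that orthonormal_independent unfolding P_def by blast
  have bound: "card S \<le> card T" if "P S" for S
    using independent_span_bound[OF T(1) ind[OF that]] that T(3) unfolding P_def by auto
  have "P {}" by (simp add: P_def)
  then obtain S where S: "P S" and mx: "\<And>S'. P S' \<Longrightarrow> card S' \<le> card S"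
    using ex_has_greatest_nat[of P "{}" card "Suc (card T)"] bound by (metis less_Suc_eq_le)
  have SV: "finite S" "S \<subseteq> V" and on: "\<And>x y. x \<in> S \<Longrightarrow> y \<in> S \<Longrightarrow> g x y = (if x = y then 1 else 0)"
    using S unfolding P_def by auto
  have "span S \<subseteq> V" using span_minimal[OF SV(2) sub] .
  moreover have "V \<subseteq> span S"
  proof (rule ccontr)
    assume "\<not> V \<subseteq> span S"
    then obtain v where v: "v \<in> V" "v \<notin> span S" by blast
    \<comment> \<open>Remainder of \<open>v\<close> after orthogonal projection to the span of
      \<open>S\<close>; it is nonzero since \<open>v\<close> lies outside that span.\<close>
    define w where "w = v - (\<Sum>s\<in>S. g v s *\<^sub>R s)"
    have sp: "(\<Sum>s\<in>S. g v s *\<^sub>R s) \<in> span S" by (intro span_sum span_scale span_base)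
    have w: "w \<in> V" unfolding w_def using v SV by (intro in_diff in_sum in_scale) auto
    have "w \<noteq> 0" using v(2) sp unfolding w_def by auto
    then have wp: "g w w > 0" using pos w by blast
    have ws: "g w s = 0" if s: "s \<in> S" for s
    proof -
      have "g (\<Sum>s\<in>S. g v s *\<^sub>R s) s = (\<Sum>y\<in>S. g (g v y *\<^sub>R y) s)"
        using SV s by (intro g_sum_left) (auto simp: in_V)
      also have "\<dots> = (\<Sum>y\<in>S. if y = s then g v y else 0)"
        using SV on s by (intro sum.cong) (auto simp: subset_iff)
      also have "\<dots> = g v s" using s SV by simp
      finally have "g (\<Sum>s\<in>S. g v s *\<^sub>R s) s = g v s" .
      then show ?thesis unfolding w_def using v SV s sp \<open>span S \<subseteq> V\<close>
        by (subst g_left(2)) auto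
    qed
    define u where "u = (1 / sqrt (g w w)) *\<^sub>R w"
    have u: "u \<in> V" "g u u = 1" "\<And>s. s \<in> S \<Longrightarrow> g u s = 0"
      using w wp ws SV(2) by (auto simp: u_def in_V subset_iff real_div_sqrt field_simps power2_eq_square
          simp flip: real_sqrt_mult)
    have "u \<notin> S" using u(2,3) by force
    have "g s u = 0" if "s \<in> S" for s using u(1) u(3)[OF that] SV(2) that by (metis subsetD sym)
    then have "g x y = (if x = y then 1 else 0)" if "x \<in> insert u S" "y \<in> insert u S" for x y
      using that u(2,3) on \<open>u \<notin> S\<close> by (metis insertE)
    then have "P (insert u S)" using u(1) SV unfolding P_def by blast
    from mx[OF this] show False using \<open>u \<notin> S\<close> SV by simp
  qed
  ultimately have span: "span S = V" by blast
  have "card T \<le> card S"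
    using independent_span_bound[OF SV(1) T(2)] T(3) span span_superset by blast
  then have "card S = CARD('n)" using bound[OF S] T(4) by simp
  then obtain e :: "'n \<Rightarrow> 'v" where e: "bij_betw e UNIV S"
    using SV(1) by (metis finite finite_same_card_bij)
  then have "orthonormal_basis V g e"
    unfolding orthonormal_basis_def using span SV on
    by (auto simp: bij_betw_def inj_on_eq_iff)
  then show ?thesis by blast
qed

end

locale onb_on = inner_on V g for V :: "'v::real_vector set" and g +
  fixes e :: "'i::finite \<Rightarrow> 'v"
  assumes onb: "orthonormal_basis V g e"
begin

lemma e_in [simp]: "e i \<in> V"
  using onb unfolding orthonormal_basis_def by blast

lemma g_e: "g (e i) (e j) = (if i = j then 1 else 0)"
  using onb unfolding orthonormal_basis_def by blast

lemma expand:
  assumes x: "x \<in> V"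
  shows "x = (\<Sum>i\<in>UNIV. g x (e i) *\<^sub>R e i)"
proof -
  define y where "y = x - (\<Sum>i\<in>UNIV. g x (e i) *\<^sub>R e i)"
  have s: "(\<Sum>i\<in>UNIV. g x (e i) *\<^sub>R e i) \<in> V" by (intro in_sum in_scale e_in)
  have y: "y \<in> V" unfolding y_def by (intro in_diff x s)
  have ye: "g y (e j) = 0" for j
  proof -
    have "g (\<Sum>i\<in>UNIV. g x (e i) *\<^sub>R e i) (e j) = (\<Sum>i\<in>UNIV. g (g x (e i) *\<^sub>R e i) (e j))"
      by (intro g_sum_left in_scale e_in)
    also have "\<dots> = g x (e j)" by (simp add: g_e if_distrib cong: if_cong)
    finally show ?thesis unfolding y_def using x s by simp
  qed
  \<comment> \<open>The vectors orthogonal to \<open>y\<close> form a subspace containing the basis,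
    hence all of \<open>V\<close>; in particular \<open>y\<close> is orthogonal to itself.\<close>
  have "subspace {v \<in> V. g y v = 0}"
    using y by (auto simp: subspace_def in_V)
  moreover have "range e \<subseteq> {v \<in> V. g y v = 0}" using ye by auto
  ultimately have "span (range e) \<subseteq> {v \<in> V. g y v = 0}" by (rule span_minimal[rotated])
  then have "g y y = 0" using onb y unfolding orthonormal_basis_def by blast
  then have "y = 0" using g_eq_0 y by blast
  then show ?thesis unfolding y_def by simp
qed

lemma lin_on_expand:
  assumes "lin_on V f" "x \<in> V"
  shows "f x = (\<Sum>i\<in>UNIV. g x (e i) * f (e i))"
proof -
  have "f x = f (\<Sum>i\<in>UNIV. g x (e i) *\<^sub>R e i)" using expand[OF assms(2)] by simp
  also have "\<dots> = (\<Sum>i\<in>UNIV. f (g x (e i) *\<^sub>R e i))"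
    by (intro lin_on_sum[OF assms(1) sub] in_scale e_in)
  finally show ?thesis by (simp add: lin_on_scale[OF assms(1)])
qed

lemma parseval: "x \<in> V \<Longrightarrow> y \<in> V \<Longrightarrow> g x y = (\<Sum>i\<in>UNIV. g x (e i) * g y (e i))"
  using lin_on_expand[OF lin[of y], of x] by (simp add: sym)

lemma g_eqI: "x \<in> V \<Longrightarrow> y \<in> V \<Longrightarrow> (\<And>i. g x (e i) = g y (e i)) \<Longrightarrow> x = y"
  using expand[of x] expand[of y] by simp

lemma riesz:
  assumes f: "lin_on V f"
  shows "\<exists>!v. v \<in> V \<and> (\<forall>z\<in>V. g v z = f z)"
proof
  let ?v = "\<Sum>i\<in>UNIV. f (e i) *\<^sub>R e i"
  have "g ?v z = f z" if z: "z \<in> V" for z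
  proof -
    have "g ?v z = (\<Sum>i\<in>UNIV. g (f (e i) *\<^sub>R e i) z)" by (intro g_sum_left in_scale e_in z)
    then show ?thesis using lin_on_expand[OF f z] z by (simp add: sym mult.commute)
  qed
  then show "?v \<in> V \<and> (\<forall>z\<in>V. g ?v z = f z)" by (intro conjI ballI in_sum in_scale e_in)
next
  fix w assume "w \<in> V \<and> (\<forall>z\<in>V. g w z = f z)"
  moreover have "g (\<Sum>i\<in>UNIV. f (e i) *\<^sub>R e i) (e j) = f (e j)" for j
    by (subst g_sum_left) (auto simp: in_V g_e if_distrib cong: if_cong)
  ultimately show "w = (\<Sum>i\<in>UNIV. f (e i) *\<^sub>R e i)"
    by (intro g_eqI in_sum in_scale) auto
qed

text \<open>Invariance of the trace of the bilinear form f(x) h(y). It allows a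
  \<open>G2_frame\<close> to be exchanged for a basis containing the unit normal, and one frame for
  another.\<close>

lemma contraction_basis_independent:
  fixes e' :: "'j::finite \<Rightarrow> 'v"
  assumes e': "orthonormal_basis V g e'" and f: "lin_on V f" and h: "lin_on V h"
  shows "(\<Sum>j\<in>UNIV. f (e' j) * h (e' j)) = (\<Sum>i\<in>UNIV. f (e i) * h (e i))"
proof -
  interpret e': onb_on V g e' by unfold_locales (rule e')
  have "(\<Sum>j\<in>UNIV. f (e' j) * h (e' j)) = (\<Sum>j\<in>UNIV. \<Sum>i\<in>UNIV. (g (e' j) (e i) * f (e i)) * h (e' j))"
    by (subst lin_on_expand[OF f e'.e_in]) (simp add: sum_distrib_right)
  also have "\<dots> = (\<Sum>i\<in>UNIV. \<Sum>j\<in>UNIV. (g (e' j) (e i) * f (e i)) * h (e' j))" by (rule sum.swap)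
  also have "\<dots> = (\<Sum>i\<in>UNIV. f (e i) * (\<Sum>j\<in>UNIV. g (e i) (e' j) * h (e' j)))"
    by (simp add: sum_distrib_left sym mult_ac)
  also have "\<dots> = (\<Sum>i\<in>UNIV. f (e i) * h (e i))"
    using e'.lin_on_expand[OF h e_in] by simp
  finally show ?thesis .
qed

text \<open>Equality in Bessel's inequality, summed over the known basis: by Parseval the squared
  lengths of the remainders \<open>r i\<close> add up to \<open>CARD('i)\<close> minus
  \<open>CARD('j)\<close>, so every remainder vanishes.\<close>

lemma orthonormal_basisI_card:
  fixes e' :: "'j::finite \<Rightarrow> 'v"
  assumes card: "CARD('j) = CARD('i)" and e': "\<And>j. e' j \<in> V"
    and on: "\<And>i j. g (e' i) (e' j) = (if i = j then 1 else 0)"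
  shows "orthonormal_basis V g e'"
proof -
  define r where "r i = e i - (\<Sum>j\<in>UNIV. g (e i) (e' j) *\<^sub>R e' j)" for i
  have s: "(\<Sum>j\<in>UNIV. g (e i) (e' j) *\<^sub>R e' j) \<in> V" for i by (intro in_sum in_scale e')
  have r: "r i \<in> V" for i unfolding r_def by (intro in_diff e_in s)
  have g1: "g (\<Sum>j\<in>UNIV. g (e i) (e' j) *\<^sub>R e' j) x = (\<Sum>j\<in>UNIV. g (e i) (e' j) * g (e' j) x)" if "x \<in> V" for i x
    using that e' by (subst g_sum_left) (auto simp: in_V)
  have "g (r i) (e' k) = 0" for i k
    unfolding r_def using s e' by (simp add: g1 on if_distrib cong: if_cong)
  then have rs: "g (\<Sum>j\<in>UNIV. g (e i) (e' j) *\<^sub>R e' j) (r i) = 0" for i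
    using e' r by (subst g1) (auto simp: sym)
  have rr: "g (r i) (r i) = 1 - (\<Sum>j\<in>UNIV. g (e i) (e' j) * g (e' j) (e i))" for i
  proof -
    have "g (r i) (r i) = g (e i) (r i)" using rs[of i] r s by (subst r_def) simp
    also have "\<dots> = g (e i) (e i) - g (e i) (\<Sum>j\<in>UNIV. g (e i) (e' j) *\<^sub>R e' j)"
      unfolding r_def using s by simp
    finally show ?thesis using s by (simp add: sym[OF e_in s] g1 g_e)
  qed
  have "(\<Sum>i\<in>UNIV. g (r i) (r i)) = real CARD('i) - (\<Sum>i\<in>UNIV. \<Sum>j\<in>UNIV. g (e i) (e' j) * g (e' j) (e i))"
    by (simp add: rr sum_subtractf)
  also have "(\<Sum>i\<in>UNIV. \<Sum>j\<in>UNIV. g (e i) (e' j) * g (e' j) (e i)) = (\<Sum>j\<in>UNIV. \<Sum>i\<in>UNIV. g (e' j) (e i) * g (e' j) (e i))"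
    using e' by (subst sum.swap) (simp add: sym)
  also have "\<dots> = real CARD('j)" using e' by (simp add: parseval[symmetric] on)
  finally have "(\<Sum>i\<in>UNIV. g (r i) (r i)) = 0" using card by simp
  then have "g (r i) (r i) = 0" for i
    using g_nonneg[OF r] by (simp add: sum_nonneg_eq_0_iff)
  then have "r i = 0" for i using g_eq_0 r by blast
  then have "e i = (\<Sum>j\<in>UNIV. g (e i) (e' j) *\<^sub>R e' j)" for i unfolding r_def by (metis right_minus_eq)
  moreover have "(\<Sum>j\<in>UNIV. g (e i) (e' j) *\<^sub>R e' j) \<in> span (range e')" for i
    by (intro span_sum span_scale span_base rangeI)
  ultimately have "range e \<subseteq> span (range e')" by (metis image_subsetI)
  then have "V \<subseteq> span (range e')"
    using onb unfolding orthonormal_basis_def by (metis span_minimal subspace_span)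
  moreover have "span (range e') \<subseteq> V" using e' by (intro span_minimal sub) auto
  ultimately show ?thesis using e' on unfolding orthonormal_basis_def by blast
qed

end

section \<open>Linear algebra of \<open>SU(3)\<close>-structures\<close>

lemma trilin_onD:
  assumes "trilin_on V f" "x \<in> V" "y \<in> V"
  shows "lin_on V (\<lambda>z. f z x y)" "lin_on V (\<lambda>z. f x z y)" "lin_on V (\<lambda>z. f x y z)"
  using assms unfolding trilin_on_def by auto

text \<open>The axioms describe an SU(3)-structure without a unitary frame. With skewness,
  \<open>\<phi>_I12\<close> makes \<phi> the real part of a form of type (3,0);
  \<open>\<phi>_norm\<close> normalizes it: for a unit vector a, the map sending b to \<phi>(a, b,
  .) kills the complex line of a and is isometric on its orthogonal complement.\<close>

locale su3_space = onb_on V g e for V :: "'v::real_vector set" and g and e :: "'i::finite \<Rightarrow> 'v" +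
  fixes I :: "'v \<Rightarrow> 'v" and \<phi> :: "'v \<Rightarrow> 'v \<Rightarrow> 'v \<Rightarrow> real"
  assumes card: "CARD('i) = 6"
    and I_in [simp]: "x \<in> V \<Longrightarrow> I x \<in> V"
    and I_I [simp]: "x \<in> V \<Longrightarrow> I (I x) = - x"
    and g_I_left: "x \<in> V \<Longrightarrow> y \<in> V \<Longrightarrow> g (I x) y = - g x (I y)"
    and tri: "trilin_on V \<phi>"
    and skew12: "x \<in> V \<Longrightarrow> y \<in> V \<Longrightarrow> z \<in> V \<Longrightarrow> \<phi> x y z = - \<phi> y x z"
    and skew23: "x \<in> V \<Longrightarrow> y \<in> V \<Longrightarrow> z \<in> V \<Longrightarrow> \<phi> x y z = - \<phi> x z y"
    and \<phi>_I12: "x \<in> V \<Longrightarrow> y \<in> V \<Longrightarrow> z \<in> V \<Longrightarrow> \<phi> (I x) y z = \<phi> x (I y) z"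
    and \<phi>_norm: "a \<in> V \<Longrightarrow> b \<in> V \<Longrightarrow> d \<in> V \<Longrightarrow>
      (\<Sum>k\<in>UNIV. \<phi> a b (e k) * \<phi> a d (e k)) = g a a * g b d - g a b * g a d - g (I a) b * g (I a) d"
begin

lemma g_I_I [simp]: "x \<in> V \<Longrightarrow> y \<in> V \<Longrightarrow> g (I x) (I y) = g x y"
  by (subst g_I_left) (auto simp: in_V)

lemma \<phi>_I23: "x \<in> V \<Longrightarrow> y \<in> V \<Longrightarrow> z \<in> V \<Longrightarrow> \<phi> x (I y) z = \<phi> x y (I z)"
  by (metis I_in \<phi>_I12 skew12 skew23)

lemma \<phi>_1:
  assumes "y \<in> V" "z \<in> V"
  shows "x \<in> V \<Longrightarrow> x' \<in> V \<Longrightarrow> \<phi> (x + x') y z = \<phi> x y z + \<phi> x' y z"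
    "x \<in> V \<Longrightarrow> x' \<in> V \<Longrightarrow> \<phi> (x - x') y z = \<phi> x y z - \<phi> x' y z"
    "x \<in> V \<Longrightarrow> \<phi> (- x) y z = - \<phi> x y z" "x \<in> V \<Longrightarrow> \<phi> (r *\<^sub>R x) y z = r * \<phi> x y z" "\<phi> 0 y z = 0"
  using trilin_onD(1)[OF tri assms] lin_on_add lin_on_diff[OF _ sub] lin_on_minus lin_on_scale lin_on_zero[OF _ sub]
  by fastforce+

lemma \<phi>_2:
  assumes "y \<in> V" "z \<in> V"
  shows "x \<in> V \<Longrightarrow> x' \<in> V \<Longrightarrow> \<phi> y (x + x') z = \<phi> y x z + \<phi> y x' z"
    "x \<in> V \<Longrightarrow> x' \<in> V \<Longrightarrow> \<phi> y (x - x') z = \<phi> y x z - \<phi> y x' z"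
    "x \<in> V \<Longrightarrow> \<phi> y (- x) z = - \<phi> y x z" "x \<in> V \<Longrightarrow> \<phi> y (r *\<^sub>R x) z = r * \<phi> y x z" "\<phi> y 0 z = 0"
  using trilin_onD(2)[OF tri assms] lin_on_add lin_on_diff[OF _ sub] lin_on_minus lin_on_scale lin_on_zero[OF _ sub]
  by fastforce+

lemma \<phi>_norm_polarized:
  assumes V: "a \<in> V" "b \<in> V" "c \<in> V" "d \<in> V"
  shows "(\<Sum>k\<in>UNIV. \<phi> a b (e k) * \<phi> c d (e k)) + (\<Sum>k\<in>UNIV. \<phi> c b (e k) * \<phi> a d (e k)) =
    2 * g a c * g b d - g a b * g c d - g c b * g a d - g (I a) b * g (I c) d - g (I c) b * g (I a) d"
proof -
  have "(\<Sum>k\<in>UNIV. \<phi> (a + c) b (e k) * \<phi> (a + c) d (e k)) =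
     (\<Sum>k\<in>UNIV. \<phi> a b (e k) * \<phi> a d (e k)) + (\<Sum>k\<in>UNIV. \<phi> c b (e k) * \<phi> c d (e k))
   + ((\<Sum>k\<in>UNIV. \<phi> a b (e k) * \<phi> c d (e k)) + (\<Sum>k\<in>UNIV. \<phi> c b (e k) * \<phi> a d (e k)))"
    using V by (simp add: \<phi>_1 algebra_simps sum.distrib)
  then show ?thesis
    using V by (simp add: \<phi>_norm in_V g_I_left sym[of c a] algebra_simps)
qed

text \<open>Origin of the 4: putting b = d = \<open>e j\<close> in the polarized norm identity and
  summing over j gives twice the contraction on the left and (2 * 6 - 2 - 2) g(a, c) on the
  right.\<close>

lemma \<phi>_contraction:
  assumes V: "a \<in> V" "c \<in> V"
  shows "(\<Sum>j\<in>UNIV. \<Sum>k\<in>UNIV. \<phi> a (e j) (e k) * \<phi> c (e j) (e k)) = 4 * g a c"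
proof -
  have "2 * (\<Sum>j\<in>UNIV. \<Sum>k\<in>UNIV. \<phi> a (e j) (e k) * \<phi> c (e j) (e k)) =
    (\<Sum>j\<in>UNIV. (\<Sum>k\<in>UNIV. \<phi> a (e j) (e k) * \<phi> c (e j) (e k)) + (\<Sum>k\<in>UNIV. \<phi> c (e j) (e k) * \<phi> a (e j) (e k)))"
    by (simp add: sum.distrib mult.commute flip: sum_distrib_left)
  also have "\<dots> = (\<Sum>j\<in>UNIV. 2 * g a c - 2 * (g a (e j) * g c (e j)) - 2 * (g (I a) (e j) * g (I c) (e j)))"
    using V by (subst \<phi>_norm_polarized) (simp_all add: g_e mult_ac)
  also have "\<dots> = 6 * (2 * g a c) - 2 * g a c - 2 * g (I a) (I c)"
    using V by (simp add: sum_subtractf sum_distrib_left[symmetric] parseval[symmetric] card del: g_I_I)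
  finally show ?thesis using V by simp
qed

lemma \<phi>_nondegenerate:
  assumes "x \<in> V" "\<And>y z. y \<in> V \<Longrightarrow> z \<in> V \<Longrightarrow> \<phi> x y z = 0"
  shows "x = 0"
  using \<phi>_contraction[of x x] assms g_eq_0 by simp

text \<open>Symmetry with respect to \<open>g\<close> already forces linearity on \<open>V\<close>,
  which is why it is not a separate clause.\<close>

definition selfadjoint :: "('v \<Rightarrow> 'v) \<Rightarrow> bool" where
  "selfadjoint S \<longleftrightarrow> (\<forall>x\<in>V. S x \<in> V) \<and> (\<forall>x\<in>V. \<forall>y\<in>V. g (S x) y = g x (S y))"

definition trace_op :: "('v \<Rightarrow> 'v) \<Rightarrow> real" where
  "trace_op S = (\<Sum>i\<in>UNIV. g (S (e i)) (e i))"

lemma selfadjoint_in [simp]: "selfadjoint S \<Longrightarrow> x \<in> V \<Longrightarrow> S x \<in> V"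
  by (simp add: selfadjoint_def)

lemma selfadjointD: "selfadjoint S \<Longrightarrow> x \<in> V \<Longrightarrow> y \<in> V \<Longrightarrow> g (S x) y = g x (S y)"
  by (simp add: selfadjoint_def)

lemma selfadjoint_sym: "selfadjoint S \<Longrightarrow> x \<in> V \<Longrightarrow> y \<in> V \<Longrightarrow> g (S x) y = g (S y) x"
  by (metis selfadjointD selfadjoint_in sym)

lemma selfadjoint_linear:
  assumes S: "selfadjoint S" and V: "x \<in> V" "y \<in> V"
  shows "S (a *\<^sub>R x + b *\<^sub>R y) = a *\<^sub>R S x + b *\<^sub>R S y"
  using assms by (intro eqI) (auto simp: in_V selfadjointD)

lemma I_linear: "x \<in> V \<Longrightarrow> y \<in> V \<Longrightarrow> I (a *\<^sub>R x + b *\<^sub>R y) = a *\<^sub>R I x + b *\<^sub>R I y"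
  by (intro eqI) (auto simp: in_V g_I_left)

lemma I_simps:
  "x \<in> V \<Longrightarrow> y \<in> V \<Longrightarrow> I (x + y) = I x + I y" "x \<in> V \<Longrightarrow> y \<in> V \<Longrightarrow> I (x - y) = I x - I y"
  "x \<in> V \<Longrightarrow> I (- x) = - I x" "x \<in> V \<Longrightarrow> I (r *\<^sub>R x) = r *\<^sub>R I x"
  using I_linear[of x y 1 1] I_linear[of x y 1 "-1"] I_linear[of x x "-1" 0] I_linear[of x x r 0] by auto

lemma selfadjoint_neg: "selfadjoint S \<Longrightarrow> x \<in> V \<Longrightarrow> S (- x) = - S x"
  using selfadjoint_linear[of S x x "-1" 0] by simp

lemma I_basis: "orthonormal_basis V g (\<lambda>i. I (e i))"
  by (rule orthonormal_basisI_card) (simp_all add: g_e)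

lemma trace_op_conj:
  assumes S: "selfadjoint S"
  shows "(\<Sum>i\<in>UNIV. g (S (I (e i))) (I (e i))) = trace_op S"
proof -
  interpret Ie: onb_on V g "\<lambda>i. I (e i)" by unfold_locales (rule I_basis)
  \<comment> \<open>The trace over a frame f, written as a double sum against \<open>e\<close>. For
    f = e and for f = I e, Parseval in f then yields the same value.\<close>
  have c: "(\<Sum>i\<in>UNIV. g (S (f i)) (f i)) = (\<Sum>k\<in>UNIV. \<Sum>i\<in>UNIV. g (e k) (f i) * g (S (e k)) (f i))"
    if f: "\<And>i. f i \<in> V" for f :: "'i \<Rightarrow> 'v"
  proof -
    have "(\<Sum>i\<in>UNIV. g (S (f i)) (f i)) = (\<Sum>i\<in>UNIV. \<Sum>k\<in>UNIV. g (f i) (e k) * g (S (f i)) (e k))"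
      using f S by (simp add: parseval[of "S _"] mult.commute)
    also have "\<dots> = (\<Sum>i\<in>UNIV. \<Sum>k\<in>UNIV. g (e k) (f i) * g (S (e k)) (f i))"
      by (intro sum.cong refl arg_cong2[where f = "(*)"] sym[OF f e_in] selfadjoint_sym[OF S f e_in])
    finally show ?thesis by (subst sum.swap) simp
  qed
  show ?thesis unfolding trace_op_def
    unfolding c[of "\<lambda>i. I (e i)", simplified] c[of e, simplified]
    using S by (simp add: Ie.parseval[symmetric] parseval[symmetric])
qed

text \<open>Symmetric coefficients \<open>g (S (e i)) (e j)\<close> meet a form that is skew in the
  two summed slots. This is the trace condition in \<open>W3\<close>.\<close>

lemma selfadjoint_trace_\<phi>:
  assumes S: "selfadjoint S" and z: "z \<in> V"
  shows "(\<Sum>i\<in>UNIV. \<phi> (S (e i)) (e i) z) = 0"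
proof -
  have *: "\<phi> (S (e i)) (e i) z = (\<Sum>j\<in>UNIV. g (S (e i)) (e j) * \<phi> (e j) (e i) z)" for i
    using lin_on_expand[OF trilin_onD(1)[OF tri e_in z]] S by simp
  have "(\<Sum>i\<in>UNIV. \<phi> (S (e i)) (e i) z) = (\<Sum>i\<in>UNIV. \<Sum>j\<in>UNIV. g (S (e i)) (e j) * \<phi> (e j) (e i) z)"
    by (simp add: *)
  also have "\<dots> = (\<Sum>i\<in>UNIV. \<Sum>j\<in>UNIV. g (S (e j)) (e i) * \<phi> (e i) (e j) z)"
    by (rule sum.swap)
  also have "\<dots> = (\<Sum>i\<in>UNIV. \<Sum>j\<in>UNIV. - (g (S (e i)) (e j) * \<phi> (e j) (e i) z))"
    using S z by (intro sum.cong refl) (subst skew12, simp_all add: selfadjoint_sym[OF S e_in e_in])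
  also have "\<dots> = - (\<Sum>i\<in>UNIV. \<Sum>j\<in>UNIV. g (S (e i)) (e j) * \<phi> (e j) (e i) z)"
    by (simp add: sum_negf)
  finally show ?thesis unfolding * by simp
qed

end

section \<open>The cyclic sum of the three-form with an operator inserted\<close>

lemma cyclic_sum_square:
  fixes p :: "'i::finite \<Rightarrow> 'i \<Rightarrow> 'i \<Rightarrow> real"
  assumes skew: "\<And>i j k. p i j k = - p i k j"
  shows "(\<Sum>i\<in>UNIV. \<Sum>j\<in>UNIV. \<Sum>k\<in>UNIV. (p i j k - p j i k + p k i j)\<^sup>2)
    = 3 * (\<Sum>i\<in>UNIV. \<Sum>j\<in>UNIV. \<Sum>k\<in>UNIV. (p i j k)\<^sup>2) - 6 * (\<Sum>i\<in>UNIV. \<Sum>j\<in>UNIV. \<Sum>k\<in>UNIV. p i j k * p j i k)"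
proof -
  let ?S = "\<lambda>f :: 'i \<Rightarrow> 'i \<Rightarrow> 'i \<Rightarrow> real. \<Sum>i\<in>UNIV. \<Sum>j\<in>UNIV. \<Sum>k\<in>UNIV. f i j k"
  have s12: "?S f = ?S (\<lambda>i j k. f j i k)" for f by (rule sum.swap)
  have s23: "?S f = ?S (\<lambda>i j k. f i k j)" for f by (intro sum.cong refl sum.swap)
  \<comment> \<open>By skewness the expression squared is the cyclic sum
    \<open>p i j k + p j k i + p k i j\<close>. Its cross terms are written so that each is a
    relabelling of \<open>p i j k * p j i k\<close>.\<close>
  have e: "(p i j k - p j i k + p k i j)\<^sup>2 = (p i j k)\<^sup>2 + (p j i k)\<^sup>2 + (p k i j)\<^sup>2
     - 2 * (p i j k * p j i k) - 2 * (p i k j * p k i j) - 2 * (p j k i * p k j i)" for i j k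
    using skew[of i k j] skew[of j k i] skew[of k j i] by (simp add: power2_eq_square algebra_simps)
  have a: "?S (\<lambda>i j k. (p j i k)\<^sup>2) = ?S (\<lambda>i j k. (p i j k)\<^sup>2)"
    by (subst s12) simp
  have b: "?S (\<lambda>i j k. (p k i j)\<^sup>2) = ?S (\<lambda>i j k. (p i j k)\<^sup>2)"
    by (subst s23, subst s12) simp
  have c: "?S (\<lambda>i j k. p i k j * p k i j) = ?S (\<lambda>i j k. p i j k * p j i k)"
    by (subst s23) simp
  have d: "?S (\<lambda>i j k. p j k i * p k j i) = ?S (\<lambda>i j k. p i j k * p j i k)"
    by (subst s12, subst s23) simp
  show ?thesis
    unfolding e sum.distrib sum_subtractf sum_distrib_left[symmetric] a b c d by simp
qed

context su3_space
begin

text \<open>This vanishing of the cyclic sum for trace-free \<open>S\<close> is a complex trace identity in an adapted basis;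
  computing the norm avoids constructing such a basis.\<close>

lemma cyclic_sum_norm:
  assumes S: "selfadjoint S" and comm: "\<And>x. x \<in> V \<Longrightarrow> S (I x) = I (S x)"
  shows "(\<Sum>i\<in>UNIV. \<Sum>j\<in>UNIV. \<Sum>k\<in>UNIV. (\<phi> (S (e i)) (e j) (e k) - \<phi> (S (e j)) (e i) (e k)
      + \<phi> (S (e k)) (e i) (e j))\<^sup>2) = 6 * (trace_op S)\<^sup>2"
proof -
  define N where "N = (\<Sum>i\<in>UNIV. g (S (e i)) (S (e i)))"
  \<comment> \<open>\<open>I\<close> after \<open>S\<close> is skew, because \<open>S\<close> is
    self-adjoint and commutes with the skew map \<open>I\<close>.\<close>
  have IS: "g (I (S x)) y = - g (I (S y)) x" if "x \<in> V" "y \<in> V" for x y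
    using that S by (simp add: g_I_left selfadjointD comm sym[of x "I (S y)"])
  have IS0: "g (I (S x)) x = 0" if "x \<in> V" for x
    using IS[OF that that] by simp
  have p2: "(\<Sum>i\<in>UNIV. \<Sum>j\<in>UNIV. \<Sum>k\<in>UNIV. (\<phi> (S (e i)) (e j) (e k))\<^sup>2) = 4 * N"
    using S by (simp add: power2_eq_square \<phi>_contraction N_def sum_distrib_left)
  \<comment> \<open>The polarized identity controls only a symmetrized sum. The summand added to
    symmetrize contracts the symmetric \<open>S\<close> with the skew \<phi> and contributes
    nothing.\<close>
  have z: "(\<Sum>i\<in>UNIV. \<Sum>j\<in>UNIV. \<Sum>k\<in>UNIV. \<phi> (S (e j)) (e j) (e k) * \<phi> (S (e i)) (e i) (e k)) = 0"
  proof -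
    have "(\<Sum>i\<in>UNIV. \<Sum>j\<in>UNIV. \<Sum>k\<in>UNIV. \<phi> (S (e j)) (e j) (e k) * \<phi> (S (e i)) (e i) (e k))
      = (\<Sum>i\<in>UNIV. \<Sum>k\<in>UNIV. \<Sum>j\<in>UNIV. \<phi> (S (e j)) (e j) (e k) * \<phi> (S (e i)) (e i) (e k))"
      by (intro sum.cong refl sum.swap)
    then show ?thesis using S by (simp add: sum_distrib_right[symmetric] selfadjoint_trace_\<phi>)
  qed
  have n1: "(\<Sum>j\<in>UNIV. g (S (e i)) (e j) * g (S (e j)) (e i)) = g (S (e i)) (S (e i))" for i
    unfolding parseval[OF selfadjoint_in[OF S e_in] selfadjoint_in[OF S e_in], of i i]
    by (intro sum.cong refl arg_cong2[where f = "(*)"] selfadjoint_sym S e_in)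
  have n2: "(\<Sum>j\<in>UNIV. g (I (S (e i))) (e j) * g (I (S (e j))) (e i)) = - g (S (e i)) (S (e i))" for i
  proof -
    have "(\<Sum>j\<in>UNIV. g (I (S (e i))) (e j) * g (I (S (e j))) (e i)) = - (\<Sum>j\<in>UNIV. g (I (S (e i))) (e j) * g (I (S (e i))) (e j))"
      using IS[of "e _" "e i"] by (simp add: sum_negf)
    also have "\<dots> = - g (I (S (e i))) (I (S (e i)))" using S by (simp only: parseval[symmetric] I_in selfadjoint_in e_in)
    finally show ?thesis using S by simp
  qed
  have "(\<Sum>i\<in>UNIV. \<Sum>j\<in>UNIV. \<Sum>k\<in>UNIV. \<phi> (S (e i)) (e j) (e k) * \<phi> (S (e j)) (e i) (e k))
    = (\<Sum>i\<in>UNIV. \<Sum>j\<in>UNIV. (\<Sum>k\<in>UNIV. \<phi> (S (e i)) (e j) (e k) * \<phi> (S (e j)) (e i) (e k))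
        + (\<Sum>k\<in>UNIV. \<phi> (S (e j)) (e j) (e k) * \<phi> (S (e i)) (e i) (e k)))"
    using z by (simp add: sum.distrib)
  also have "\<dots> = (\<Sum>i\<in>UNIV. \<Sum>j\<in>UNIV. 2 * (if i = j then g (S (e i)) (S (e i)) else 0)
      - g (S (e i)) (e j) * g (S (e j)) (e i) - g (S (e j)) (e j) * g (S (e i)) (e i)
      - g (I (S (e i))) (e j) * g (I (S (e j))) (e i))"
    using S by (subst \<phi>_norm_polarized) (auto simp: g_e IS0 intro!: sum.cong)
  \<comment> \<open>With this value the norms cancel in the end: 3 * 4 N - 6 * (2 N - (trace)^2)
    leaves six times the squared trace.\<close>
  also have "\<dots> = 2 * N - N - (trace_op S)\<^sup>2 + N"
    by (simp add: sum_subtractf sum.distrib n1 n2 sum_negf sum_distrib_left[symmetric] sum_distrib_right[symmetric]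
        N_def[symmetric] trace_op_def[symmetric] power2_eq_square)
  finally show ?thesis
    by (subst cyclic_sum_square) (use S in \<open>auto simp: p2 intro: skew23\<close>)
qed

text \<open>The squared norm of the cyclic sum is six times the squared trace, hence zero; a
  trilinear form vanishing on all basis triples vanishes.\<close>

lemma cyclic_sum_zero:
  assumes S: "selfadjoint S" and comm: "\<And>x. x \<in> V \<Longrightarrow> S (I x) = I (S x)" and tr: "trace_op S = 0"
    and V: "x \<in> V" "y \<in> V" "z \<in> V"
  shows "\<phi> (S x) y z + \<phi> (S y) z x + \<phi> (S z) x y = 0"
proof -
  define T where "T x y z = \<phi> (S x) y z - \<phi> (S y) x z + \<phi> (S z) x y" for x y z
  have Sl: "lin_on V (\<lambda>x. \<phi> (S x) y z)" if "y \<in> V" "z \<in> V" for y z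
    unfolding lin_on_def using that S by (auto simp: selfadjoint_linear \<phi>_1 in_V)
  have lc: "lin_on V f \<Longrightarrow> lin_on V f' \<Longrightarrow> lin_on V f'' \<Longrightarrow> lin_on V (\<lambda>x. f x - f' x + f'' x)" for f f' f''
    unfolding lin_on_def by (simp add: algebra_simps)
  have T: "trilin_on V T"
    unfolding trilin_on_def T_def using Sl S
    by (intro ballI conjI lc) (auto intro: trilin_onD[OF tri])
  have "(\<Sum>i\<in>UNIV. \<Sum>j\<in>UNIV. \<Sum>k\<in>UNIV. (T (e i) (e j) (e k))\<^sup>2) = 0"
    using cyclic_sum_norm[OF S] comm tr unfolding T_def by simp
  then have "T (e i) (e j) (e k) = 0" for i j k
    by (simp add: sum_nonneg_eq_0_iff sum_nonneg)
  then have "T (e i) (e j) z = 0" for i j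
    by (subst lin_on_expand[OF trilin_onD(3)[OF T]]) (simp_all add: V)
  then have "T (e i) y z = 0" for i
    by (subst lin_on_expand[OF trilin_onD(2)[OF T]]) (simp_all add: V)
  then have "T x y z = 0"
    by (subst lin_on_expand[OF trilin_onD(1)[OF T]]) (simp_all add: V)
  then show ?thesis unfolding T_def using skew23[of "S y" x z] S V by simp
qed

section \<open>Splitting a self-adjoint operator by its behaviour under \<open>I\<close>, and
  recovering the parts from torsion components\<close>

definition complex_part :: "('v \<Rightarrow> 'v) \<Rightarrow> 'v \<Rightarrow> 'v" where
  "complex_part A x = (1 / 2) *\<^sub>R (A x - I (A (I x)))"

definition antilinear_part :: "('v \<Rightarrow> 'v) \<Rightarrow> 'v \<Rightarrow> 'v" where
  "antilinear_part A x = (1 / 2) *\<^sub>R (A x + I (A (I x)))"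

definition tracefree_part :: "('v \<Rightarrow> 'v) \<Rightarrow> 'v \<Rightarrow> 'v" where
  "tracefree_part A x = complex_part A x - (trace_op A / 6) *\<^sub>R x"

lemma g_complex_part:
  "selfadjoint A \<Longrightarrow> x \<in> V \<Longrightarrow> y \<in> V \<Longrightarrow> g (complex_part A x) y = (g (A x) y + g (A (I x)) (I y)) / 2"
  by (simp add: complex_part_def in_V g_I_left)

lemma g_antilinear_part:
  "selfadjoint A \<Longrightarrow> x \<in> V \<Longrightarrow> y \<in> V \<Longrightarrow> g (antilinear_part A x) y = (g (A x) y - g (A (I x)) (I y)) / 2"
  by (simp add: antilinear_part_def in_V g_I_left)

lemma parts_in [simp]:
  assumes "selfadjoint A" "x \<in> V"
  shows "complex_part A x \<in> V" "antilinear_part A x \<in> V" "tracefree_part A x \<in> V"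
  using assms by (simp_all add: complex_part_def antilinear_part_def tracefree_part_def in_V)

lemma selfadjoint_parts:
  assumes A: "selfadjoint A"
  shows "selfadjoint (complex_part A)" "selfadjoint (antilinear_part A)" "selfadjoint (tracefree_part A)"
proof -
  have s: "g (A (I x)) (I y) = g (A (I y)) (I x)" "g (A x) y = g (A y) x" if "x \<in> V" "y \<in> V" for x y
    using that A selfadjoint_sym by auto
  have c: "g (complex_part A x) y = g x (complex_part A y)" if "x \<in> V" "y \<in> V" for x y
    using that A s[OF that] by (simp add: sym[of x "complex_part A y"] g_complex_part)
  have a: "g (antilinear_part A x) y = g x (antilinear_part A y)" if "x \<in> V" "y \<in> V" for x y
    using that A s[OF that] by (simp add: sym[of x "antilinear_part A y"] g_antilinear_part)
  show "selfadjoint (complex_part A)" "selfadjoint (antilinear_part A)" "selfadjoint (tracefree_part A)"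
    unfolding selfadjoint_def using A c a by (simp_all add: tracefree_part_def in_V)
qed

lemma complex_part_I: "selfadjoint A \<Longrightarrow> x \<in> V \<Longrightarrow> complex_part A (I x) = I (complex_part A x)"
  by (simp add: complex_part_def I_simps in_V selfadjoint_neg algebra_simps)

lemma tracefree_part_I: "selfadjoint A \<Longrightarrow> x \<in> V \<Longrightarrow> tracefree_part A (I x) = I (tracefree_part A x)"
  by (simp add: tracefree_part_def complex_part_I I_simps in_V)

lemma antilinear_part_I: "selfadjoint A \<Longrightarrow> x \<in> V \<Longrightarrow> antilinear_part A (I x) = - I (antilinear_part A x)"
  by (simp add: antilinear_part_def I_simps in_V selfadjoint_neg algebra_simps)

text \<open>Conjugation by \<open>I\<close> preserves the trace, so \<open>complex_part A\<close>
  has the trace of \<open>A\<close>; in dimension 6 so does \<open>trace_op A / 6\<close> times the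
  identity.\<close>

lemma trace_tracefree_part:
  assumes A: "selfadjoint A"
  shows "trace_op (tracefree_part A) = 0"
proof -
  have "trace_op (tracefree_part A) = (\<Sum>i\<in>UNIV. (g (A (e i)) (e i) + g (A (I (e i))) (I (e i))) / 2 - trace_op A / 6)"
    unfolding trace_op_def[of "tracefree_part A"] tracefree_part_def
    using A by (simp add: g_complex_part in_V g_e)
  also have "\<dots> = 0"
    using trace_op_conj[OF A]
    by (simp add: sum_subtractf sum.distrib card trace_op_def flip: sum_divide_distrib)
  finally show ?thesis .
qed

lemma parts_sum: "selfadjoint A \<Longrightarrow> x \<in> V \<Longrightarrow>
    A x = (trace_op A / 6) *\<^sub>R x + tracefree_part A x + antilinear_part A x"
  by (simp add: tracefree_part_def complex_part_def antilinear_part_def flip: scaleR_add_right)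

lemma trilin_on_\<phi>_op:
  assumes S: "selfadjoint S"
  shows "trilin_on V (\<lambda>x y z. \<phi> (S x) y z)"
  using S unfolding trilin_on_def
  by (intro ballI conjI) (auto simp: selfadjoint_linear \<phi>_1 in_V lin_on_def[of V "\<lambda>z. \<phi> (S z) _ _"]
      intro: trilin_onD[OF tri])

lemma \<phi>_type:
  assumes "x \<in> V" "y \<in> V" "z \<in> V"
  shows "\<phi> x y z = - \<phi> x (I y) (I z)"
  using \<phi>_I23[of x y "I z"] lin_on_minus[OF trilin_onD(3)[OF tri assms(1,2)] assms(3)] assms by simp

lemma \<phi>_tracefree_cyclic:
  assumes A: "selfadjoint A" and V: "x \<in> V" "y \<in> V" "z \<in> V"
  shows "\<phi> (tracefree_part A x) y z + \<phi> (tracefree_part A y) z x + \<phi> (tracefree_part A z) x y = 0"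
  using selfadjoint_parts(3)[OF A] tracefree_part_I[OF A] trace_tracefree_part[OF A] V
  by (rule cyclic_sum_zero)

lemma \<phi>_antilinear_I:
  assumes A: "selfadjoint A" and V: "x \<in> V" "y \<in> V" "z \<in> V"
  shows "\<phi> (antilinear_part A (I x)) (I y) z = \<phi> (antilinear_part A x) y z"
  using assms by (simp add: antilinear_part_I \<phi>_1 \<phi>_I12 \<phi>_2)

text \<open>The part \<open>\<beta>\<close> of \<open>\<alpha>\<close> that is invariant under (Ix,
  Iy, z) inherits skewness in the last two slots, and the cyclic condition makes it symmetric in the
  first two. Such a form is zero.\<close>

lemma type_of_cyclic:
  assumes tri: "trilin_on V \<alpha>"
    and skew: "\<And>x y z. x \<in> V \<Longrightarrow> y \<in> V \<Longrightarrow> z \<in> V \<Longrightarrow> \<alpha> x y z = - \<alpha> x z y"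
    and type: "\<And>x y z. x \<in> V \<Longrightarrow> y \<in> V \<Longrightarrow> z \<in> V \<Longrightarrow> \<alpha> x y z = - \<alpha> x (I y) (I z)"
    and cyc: "\<And>x y z. x \<in> V \<Longrightarrow> y \<in> V \<Longrightarrow> z \<in> V \<Longrightarrow> \<alpha> x y z + \<alpha> y z x + \<alpha> z x y = 0"
    and V: "x \<in> V" "y \<in> V" "z \<in> V"
  shows "\<alpha> (I x) (I y) z = - \<alpha> x y z"
proof -
  define \<beta> where "\<beta> x y z = \<alpha> x y z + \<alpha> (I x) (I y) z" for x y z
  have move: "\<alpha> x (I y) z = \<alpha> x y (I z)" if "x \<in> V" "y \<in> V" "z \<in> V" for x y z
    using type[of x y "I z"] that lin_on_minus[OF trilin_onD(3)[OF tri, of x "I y"]] by simp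
  have skew\<beta>: "\<beta> x y z = - \<beta> x z y" if "x \<in> V" "y \<in> V" "z \<in> V" for x y z
    unfolding \<beta>_def using that skew[of x y z] skew[of "I x" "I y" z] move[of "I x" z y] by simp
  \<comment> \<open>The cyclic identities at (x, y, z) and at (x, Iy, Iz) are added; the type
    condition cancels the two terms with x in front.\<close>
  have s: "\<beta> y z x + \<beta> z x y = 0" if "x \<in> V" "y \<in> V" "z \<in> V" for x y z
    unfolding \<beta>_def using that cyc[of x y z] cyc[of x "I y" "I z"] type[of x y z] move[of "I z" x y] by simp
  have sym\<beta>: "\<beta> x y z = \<beta> y x z" if "x \<in> V" "y \<in> V" "z \<in> V" for x y z
    using s[of z x y] skew\<beta>[of y x z] that by simp
  have "\<beta> x y z = - \<beta> x z y" using skew\<beta> V by blast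
  also have "\<dots> = - \<beta> z x y" using sym\<beta> V by simp
  also have "\<dots> = \<beta> z y x" using skew\<beta>[of z y x] V by simp
  also have "\<dots> = \<beta> y z x" using sym\<beta> V by simp
  also have "\<dots> = - \<beta> y x z" using skew\<beta>[of y z x] V by simp
  also have "\<dots> = - \<beta> x y z" using sym\<beta> V by simp
  finally show ?thesis unfolding \<beta>_def by simp
qed

text \<open>The same sign rule for \<open>W1\<close>: total skewness carries the type condition from
  the last two slots to the first two.\<close>

lemma type_of_skew:
  fixes \<alpha> :: "'v \<Rightarrow> 'v \<Rightarrow> 'v \<Rightarrow> real"
  assumes skew: "\<And>x y z. x \<in> V \<Longrightarrow> y \<in> V \<Longrightarrow> z \<in> V \<Longrightarrow> \<alpha> x y z = - \<alpha> y x z \<and> \<alpha> x y z = - \<alpha> x z y"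
    and type: "\<And>x y z. x \<in> V \<Longrightarrow> y \<in> V \<Longrightarrow> z \<in> V \<Longrightarrow> \<alpha> x y z = - \<alpha> x (I y) (I z)"
    and V: "x \<in> V" "y \<in> V" "z \<in> V"
  shows "\<alpha> (I x) (I y) z = - \<alpha> x y z"
proof -
  have s: "\<alpha> x y z = - \<alpha> y x z" "\<alpha> x y z = - \<alpha> x z y" if "x \<in> V" "y \<in> V" "z \<in> V" for x y z
    using skew that by blast+
  have "\<alpha> z x y = \<alpha> x y z" "\<alpha> z (I x) (I y) = \<alpha> (I x) (I y) z"
    using s(1)[of z x y] s(2)[of x z y] s(1)[of z "I x" "I y"] s(2)[of "I x" z "I y"] V by simp_all
  then show ?thesis using type[of z x y] V by simp
qed

lemma \<phi>_parts:
  assumes A: "selfadjoint A" and V: "x \<in> V" "y \<in> V" "z \<in> V"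
  shows "\<phi> (complex_part A x) y z = (\<phi> (A x) y z - \<phi> (A (I x)) (I y) z) / 2"
    "\<phi> (antilinear_part A x) y z = (\<phi> (A x) y z + \<phi> (A (I x)) (I y) z) / 2"
  using assms by (simp_all add: complex_part_def antilinear_part_def \<phi>_1 in_V \<phi>_I12)

text \<open>The homothety part is skew by itself, so the trace-free part S gives a totally skew form
  \<phi>(Sx, y, z). Its cyclic sum is then three times the form, yet it is zero; nondegeneracy of
  \<phi> gives S = 0.\<close>

lemma complex_part_of_skew:
  assumes A: "selfadjoint A"
    and skew: "\<And>x y z. x \<in> V \<Longrightarrow> y \<in> V \<Longrightarrow> z \<in> V \<Longrightarrow> \<phi> (complex_part A x) y z = - \<phi> (complex_part A y) x z"
    and x: "x \<in> V"
  shows "complex_part A x = (trace_op A / 6) *\<^sub>R x"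
proof -
  let ?S = "tracefree_part A"
  have skewS: "\<phi> (?S x) y z = - \<phi> (?S y) x z" if "x \<in> V" "y \<in> V" "z \<in> V" for x y z
    using that A skew[OF that] skew12[OF that] by (simp add: tracefree_part_def \<phi>_1 in_V)
  have "\<phi> (?S x) y z = 0" if "y \<in> V" "z \<in> V" for y z
    using \<phi>_tracefree_cyclic[OF A x that] skewS[of y x z] skewS[of z x y] skew23[of "?S y" z x] skew23[of "?S x" z y]
      A x that by simp
  then have "?S x = 0" using A x \<phi>_nondegenerate by simp
  then show ?thesis by (simp add: tracefree_part_def)
qed

text \<open>The trace-free part has zero cyclic sum anyway, so the hypothesis says that the
  homothety part, whose cyclic sum is half the trace times \<phi>, has zero cyclic sum too.\<close>

lemma trace_of_cyclic:
  assumes A: "selfadjoint A"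
    and cyc: "\<And>x y z. x \<in> V \<Longrightarrow> y \<in> V \<Longrightarrow> z \<in> V \<Longrightarrow>
      \<phi> (complex_part A x) y z + \<phi> (complex_part A y) z x + \<phi> (complex_part A z) x y = 0"
  shows "trace_op A = 0"
proof (rule ccontr)
  assume nz: "trace_op A \<noteq> 0"
  \<comment> \<open>Any index serves: a nonzero trace would put the unit vector \<open>e i\<close>
    into the kernel of \<phi>.\<close>
  fix i :: 'i
  have "\<phi> (e i) y z = 0" if V: "y \<in> V" "z \<in> V" for y z
  proof -
    have c: "\<phi> (complex_part A x) y z = trace_op A / 6 * \<phi> x y z + \<phi> (tracefree_part A x) y z"
      if "x \<in> V" "y \<in> V" "z \<in> V" for x y z
      using that A by (simp add: tracefree_part_def \<phi>_1 in_V)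
    have p: "\<phi> y z (e i) = \<phi> (e i) y z" "\<phi> z (e i) y = \<phi> (e i) y z"
      using V skew12[of y "e i" z] skew23[of y "e i" z] skew23[of "e i" z y] skew12[of z "e i" y] by simp_all
    show ?thesis
      using cyc[OF e_in V, of i] \<phi>_tracefree_cyclic[OF A e_in V, of i] V nz
      by (simp add: c p add.assoc)
  qed
  then have "e i = 0" by (rule \<phi>_nondegenerate[OF e_in])
  then show False using g_e[of i i] by (simp add: in_V)
qed

text \<open>Under (Ix, Iy, z) the first two components change sign and the third is invariant, so
  they are the eigenparts of the given form; \<open>\<phi>_parts\<close> identifies the same
  eigenparts with those of \<open>A\<close>.\<close>

lemma parts_of_components:
  assumes A: "selfadjoint A"
    and tri: "trilin_on V \<beta>\<^sub>2"
    and type: "\<And>\<beta> x y z. \<beta> \<in> {\<beta>\<^sub>1, \<beta>\<^sub>2} \<Longrightarrow> x \<in> V \<Longrightarrow> y \<in> V \<Longrightarrow> z \<in> V \<Longrightarrow>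
      \<beta> x y z = - \<beta> x z y \<and> \<beta> x y z = - \<beta> x (I y) (I z)"
    and \<beta>\<^sub>1: "\<And>x y z. x \<in> V \<Longrightarrow> y \<in> V \<Longrightarrow> z \<in> V \<Longrightarrow> \<beta>\<^sub>1 x y z = - \<beta>\<^sub>1 y x z \<and> \<beta>\<^sub>1 x y z = - \<beta>\<^sub>1 x z y"
    and \<beta>\<^sub>2: "\<And>x y z. x \<in> V \<Longrightarrow> y \<in> V \<Longrightarrow> z \<in> V \<Longrightarrow> \<beta>\<^sub>2 x y z + \<beta>\<^sub>2 y z x + \<beta>\<^sub>2 z x y = 0"
    and \<beta>\<^sub>3: "\<And>x y z. x \<in> V \<Longrightarrow> y \<in> V \<Longrightarrow> z \<in> V \<Longrightarrow> \<beta>\<^sub>3 (I x) (I y) z = \<beta>\<^sub>3 x y z"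
    and eq: "\<And>x y z. x \<in> V \<Longrightarrow> y \<in> V \<Longrightarrow> z \<in> V \<Longrightarrow> \<phi> (A x) y z = \<beta>\<^sub>1 x y z + \<beta>\<^sub>2 x y z + \<beta>\<^sub>3 x y z"
    and V: "x \<in> V" "y \<in> V" "z \<in> V"
  shows "\<phi> (complex_part A x) y z = \<beta>\<^sub>1 x y z + \<beta>\<^sub>2 x y z" "\<phi> (antilinear_part A x) y z = \<beta>\<^sub>3 x y z"
proof -
  have "\<beta>\<^sub>1 (I x) (I y) z = - \<beta>\<^sub>1 x y z"
    using V type[of \<beta>\<^sub>1] by (intro type_of_skew \<beta>\<^sub>1) blast+
  moreover have "\<beta>\<^sub>2 (I x) (I y) z = - \<beta>\<^sub>2 x y z"
    using V type[of \<beta>\<^sub>2] by (intro type_of_cyclic tri \<beta>\<^sub>2) blast+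
  ultimately show "\<phi> (complex_part A x) y z = \<beta>\<^sub>1 x y z + \<beta>\<^sub>2 x y z" "\<phi> (antilinear_part A x) y z = \<beta>\<^sub>3 x y z"
    using V by (simp_all add: \<phi>_parts[OF A] eq \<beta>\<^sub>3)
qed

end

section \<open>Linear algebra of \<open>G\<^sub>2\<close>-structures\<close>

lemma exhaust_7: "x = 0 \<or> x = 1 \<or> x = 2 \<or> x = 3 \<or> x = 4 \<or> x = 5 \<or> x = 6" for x :: 7
proof (induct x)
  case (of_int z)
  then have "0 \<le> z" "z < 7" by simp_all
  then have "z = 0 \<or> z = 1 \<or> z = 2 \<or> z = 3 \<or> z = 4 \<or> z = 5 \<or> z = 6" by arith
  then show ?case by auto
qed

lemma UNIV_7: "(UNIV :: 7 set) = {0, 1, 2, 3, 4, 5, 6}"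
  using exhaust_7 by auto

lemma sum_7: "sum f (UNIV :: 7 set) = f 0 + f 1 + f 2 + f 3 + f 4 + f 5 + f 6"
  unfolding UNIV_7 by (simp add: add.assoc)

lemma mod_7: "(7::7) = 0" "(8::7) = 1" "(9::7) = 2" "(10::7) = 3" "(11::7) = 4" "(12::7) = 5"
  by simp_all

lemma wedge_3: "wedge [a, b, c] [x, y, z] =
    a x * b y * c z - a x * b z * c y - a y * b x * c z + a y * b z * c x + a z * b x * c y - a z * b y * c x"
proof -
  have 1: "{..<length [a, b, c]} = insert 0 (insert 1 {2})" by auto
  have f: "finite {1, 2::nat}" "0 \<notin> {1, 2::nat}" "finite {2::nat}" "1 \<notin> {2::nat}" by auto
  have p: "(\<Prod>i<length [a, b, c]. ([a, b, c] ! i) ([x, y, z] ! \<pi> i)) =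
      a ([x, y, z] ! \<pi> 0) * b ([x, y, z] ! \<pi> 1) * c ([x, y, z] ! \<pi> 2)" for \<pi>
    by (simp add: eval_nat_numeral)
  show ?thesis
    unfolding wedge_def p unfolding 1 sum_over_permutations_insert[OF f(1,2)]
      sum_over_permutations_insert[OF f(3,4)] permutes_sing
    by (simp add: sign_swap_id permutation_swap_id sign_compose sign_id transpose_def)
qed

lemma wedge_4: "wedge [a, b, c, d] [x, y, z, w] =
    a x * wedge [b, c, d] [y, z, w] - a y * wedge [b, c, d] [x, z, w]
    + a z * wedge [b, c, d] [x, y, w] - a w * wedge [b, c, d] [x, y, z]"
proof -
  have 1: "{..<length [a, b, c, d]} = insert 0 (insert 1 (insert 2 {3}))" by auto
  have f: "finite {1, 2, 3::nat}" "0 \<notin> {1, 2, 3::nat}" "finite {2, 3::nat}" "1 \<notin> {2, 3::nat}"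
    "finite {3::nat}" "2 \<notin> {3::nat}" by auto
  have p: "(\<Prod>i<length [a, b, c, d]. ([a, b, c, d] ! i) ([x, y, z, w] ! \<pi> i)) =
      a ([x, y, z, w] ! \<pi> 0) * b ([x, y, z, w] ! \<pi> 1) * c ([x, y, z, w] ! \<pi> 2) * d ([x, y, z, w] ! \<pi> 3)" for \<pi>
    by (simp add: eval_nat_numeral)
  show ?thesis
    unfolding wedge_def[of "[a, b, c, d]"] p unfolding 1 sum_over_permutations_insert[OF f(1,2)]
      sum_over_permutations_insert[OF f(3,4)] sum_over_permutations_insert[OF f(5,6)] permutes_sing wedge_3
    by (simp add: sign_swap_id permutation_swap_id permutation_compose sign_compose sign_id transpose_def algebra_simps)
qed

locale g2_space = onb_on V g e for V :: "'v::real_vector set" and g and e :: "7 \<Rightarrow> 'v" +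
  fixes \<phi> :: "'v \<Rightarrow> 'v \<Rightarrow> 'v \<Rightarrow> real"
  assumes tri: "trilin_on V \<phi>"
    and skew12: "x \<in> V \<Longrightarrow> y \<in> V \<Longrightarrow> z \<in> V \<Longrightarrow> \<phi> x y z = - \<phi> y x z"
    and skew23: "x \<in> V \<Longrightarrow> y \<in> V \<Longrightarrow> z \<in> V \<Longrightarrow> \<phi> x y z = - \<phi> x z y"
    and frame: "x \<in> V \<Longrightarrow> y \<in> V \<Longrightarrow> z \<in> V \<Longrightarrow>
      \<phi> x y z = (\<Sum>i\<in>UNIV. wedge [g (e i), g (e (i + 1)), g (e (i + 3))] [x, y, z])"
begin

text \<open>The triples {i, i+1, i+3} are the lines of the Fano plane. Three of them pass through k,
  and removing k leaves the pairs (k+1, k+3), (k+2, k+6), (k+4, k+5).\<close>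

lemma \<phi>_e:
  assumes "a \<in> V" "b \<in> V"
  shows "\<phi> a b (e k) = g (e (k + 1)) a * g (e (k + 3)) b - g (e (k + 3)) a * g (e (k + 1)) b
    + g (e (k + 2)) a * g (e (k + 6)) b - g (e (k + 6)) a * g (e (k + 2)) b
    + g (e (k + 4)) a * g (e (k + 5)) b - g (e (k + 5)) a * g (e (k + 4)) b"
  using exhaust_7[of k] assms
  by (elim disjE) (simp_all add: frame sum_7 wedge_3 g_e mod_7)

lemma lin_on_contraction:
  assumes V: "a \<in> V" "b \<in> V" "c \<in> V"
  shows "lin_on V (\<lambda>d. \<Sum>k\<in>UNIV. \<phi> a b (e k) * \<phi> c d (e k))"
proof (rule lin_onI[OF _ _ sub])
  have l: "lin_on V (\<lambda>d. \<phi> c d (e k))" for k using trilin_onD(2)[OF tri V(3) e_in] .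
  show "(\<Sum>k\<in>UNIV. \<phi> a b (e k) * \<phi> c (x + y) (e k)) =
      (\<Sum>k\<in>UNIV. \<phi> a b (e k) * \<phi> c x (e k)) + (\<Sum>k\<in>UNIV. \<phi> a b (e k) * \<phi> c y (e k))"
    if "x \<in> V" "y \<in> V" for x y
    using that by (simp add: lin_on_add[OF l] distrib_left sum.distrib)
  show "(\<Sum>k\<in>UNIV. \<phi> a b (e k) * \<phi> c (r *\<^sub>R x) (e k)) = r * (\<Sum>k\<in>UNIV. \<phi> a b (e k) * \<phi> c x (e k))"
    if "x \<in> V" for x r
    using that by (simp add: lin_on_scale[OF l] sum_distrib_left mult_ac)
qed

text \<open>Polarized form of |P(a, b)|^2 = |a|^2 |b|^2 - <a, b>^2. Both sides are linear in d, so d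
  runs through the frame and only a and b keep general coordinates.\<close>

lemma \<phi>_norm:
  assumes V: "a \<in> V" "b \<in> V" "d \<in> V"
  shows "(\<Sum>k\<in>UNIV. \<phi> a b (e k) * \<phi> a d (e k)) = g a a * g b d - g a b * g a d"
proof -
  define f where "f d = g a a * g b d - g a b * g a d" for d
  have f: "lin_on V f" unfolding f_def by (rule lin_onI[OF _ _ sub]) (use V in \<open>auto simp: algebra_simps\<close>)
  have "(\<Sum>k\<in>UNIV. \<phi> a b (e k) * \<phi> a (e m) (e k)) = f (e m)" for m
    unfolding f_def parseval[OF V(1,1)] parseval[OF V(1,2)] sym[OF V(1) e_in] sym[OF V(2) e_in]
    using exhaust_7[of m] V
    by (elim disjE) (simp_all add: sum_7 \<phi>_e g_e mod_7 algebra_simps)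
  then show ?thesis
    using lin_on_expand[OF lin_on_contraction[OF V(1,2,1)] V(3)] lin_on_expand[OF f V(3)] unfolding f_def by simp
qed

lemma \<phi>_norm_polarized:
  assumes V: "a \<in> V" "b \<in> V" "c \<in> V" "d \<in> V"
  shows "(\<Sum>k\<in>UNIV. \<phi> a b (e k) * \<phi> c d (e k)) + (\<Sum>k\<in>UNIV. \<phi> c b (e k) * \<phi> a d (e k)) =
    2 * g a c * g b d - g a b * g c d - g c b * g a d"
proof -
  have l: "\<phi> (a + c) x y = \<phi> a x y + \<phi> c x y" if "x \<in> V" "y \<in> V" for x y
    using that V lin_on_add[OF trilin_onD(1)[OF tri that]] by simp
  have "(\<Sum>k\<in>UNIV. \<phi> (a + c) b (e k) * \<phi> (a + c) d (e k)) =
     (\<Sum>k\<in>UNIV. \<phi> a b (e k) * \<phi> a d (e k)) + (\<Sum>k\<in>UNIV. \<phi> c b (e k) * \<phi> c d (e k))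
   + ((\<Sum>k\<in>UNIV. \<phi> a b (e k) * \<phi> c d (e k)) + (\<Sum>k\<in>UNIV. \<phi> c b (e k) * \<phi> a d (e k)))"
    using V by (simp add: l algebra_simps sum.distrib)
  then show ?thesis
    using V by (simp add: \<phi>_norm in_V sym[of c a] algebra_simps)
qed

text \<open>The classical identity by which a single contraction of \<phi> with itself equals metric
  terms minus *\<phi>. It makes *\<phi> accessible to differentiation. The metric terms are moved
  into \<open>f\<close> so that a linear function of d is compared on the frame.\<close>

lemma star_eq:
  assumes V: "a \<in> V" "b \<in> V" "c \<in> V" "d \<in> V"
  shows "- (\<Sum>i\<in>UNIV. wedge [g (e (i + 2)), g (e (i + 4)), g (e (i + 5)), g (e (i + 6))] [a, b, c, d]) =
    g a c * g b d - g a d * g b c - (\<Sum>k\<in>UNIV. \<phi> a b (e k) * \<phi> c d (e k))"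
proof -
  define f where "f d = - (\<Sum>i\<in>UNIV. wedge [g (e (i + 2)), g (e (i + 4)), g (e (i + 5)), g (e (i + 6))] [a, b, c, d])
    + g a d * g b c - g a c * g b d" for d
  have f: "lin_on V f" unfolding f_def
    by (rule lin_onI[OF _ _ sub]) (use V in \<open>auto simp: sum_7 wedge_4 wedge_3 algebra_simps\<close>)
  have *: "- (\<Sum>k\<in>UNIV. \<phi> a b (e k) * \<phi> c (e m) (e k)) = f (e m)" for m
    unfolding f_def parseval[OF V(1,3)] parseval[OF V(2,3)] sym[OF V(1) e_in] sym[OF V(2) e_in] sym[OF V(3) e_in]
    using exhaust_7[of m] V
    by (elim disjE) (simp_all add: sum_7 wedge_4 wedge_3 \<phi>_e g_e mod_7 algebra_simps)
  have "f d = - (\<Sum>m\<in>UNIV. g d (e m) * (\<Sum>k\<in>UNIV. \<phi> a b (e k) * \<phi> c (e m) (e k)))"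
    unfolding lin_on_expand[OF f V(4)] *[symmetric] by (simp add: sum_negf)
  then show ?thesis
    using lin_on_expand[OF lin_on_contraction[OF V(1,2,3)] V(4)] unfolding f_def by simp
qed

definition cross :: "'v \<Rightarrow> 'v \<Rightarrow> 'v" where
  "cross x y = (THE v. v \<in> V \<and> (\<forall>z\<in>V. g v z = \<phi> x y z))"

lemma cross:
  assumes "x \<in> V" "y \<in> V"
  shows "cross x y \<in> V" and "z \<in> V \<Longrightarrow> g (cross x y) z = \<phi> x y z"
  using theI'[OF riesz[OF trilin_onD(3)[OF tri assms]]] unfolding cross_def by auto

lemma \<phi>_same: "x \<in> V \<Longrightarrow> y \<in> V \<Longrightarrow> \<phi> x x y = 0"
  using skew12[of x x y] by simp

end

text \<open>\<open>V\<close> is a separate space with an injection \<open>J\<close> into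
  \<open>T\<close>, since tangent vectors of the hypersurface and of the ambient manifold have
  different types. The index type of \<open>e\<close> is abstract with six elements, so that adding
  the normal gives the option type.\<close>

locale g2_hyperplane = g2_space T G E \<Phi> for T :: "'v::real_vector set" and G E \<Phi> +
  fixes V :: "'w::real_vector set" and J :: "'w \<Rightarrow> 'v" and n :: 'v and e :: "'i::finite \<Rightarrow> 'w"
  assumes card_e: "CARD('i) = 6"
    and subV: "subspace V"
    and J_in [simp]: "x \<in> V \<Longrightarrow> J x \<in> T"
    and J_lin: "x \<in> V \<Longrightarrow> y \<in> V \<Longrightarrow> J (a *\<^sub>R x + b *\<^sub>R y) = a *\<^sub>R J x + b *\<^sub>R J y"
    and J_inj: "inj_on J V"
    and n_in [simp]: "n \<in> T"
    and n_unit: "G n n = 1"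
    and n_normal [simp]: "x \<in> V \<Longrightarrow> G n (J x) = 0"
    and e_basis: "orthonormal_basis V (\<lambda>x y. G (J x) (J y)) e"
begin

definition gV :: "'w \<Rightarrow> 'w \<Rightarrow> real" where "gV x y = G (J x) (J y)"

lemma J_0: "J 0 = 0"
  using J_lin[of 0 0 0 0] subspace_0[OF subV] by simp

sublocale V: onb_on V gV e
proof
  fix x assume x: "x \<in> V"
  show "lin_on V (gV x)" unfolding lin_on_def gV_def using x by (simp add: J_lin in_V)
  show "gV x y = gV y x" if "y \<in> V" for y unfolding gV_def using x that by (simp add: sym)
  show "gV x x > 0" if "x \<noteq> 0"
    unfolding gV_def using x that inj_onD[OF J_inj, of x 0] by (intro pos) (auto simp: J_0 subspace_0[OF subV])
qed (use subV e_basis in \<open>simp_all add: gV_def[abs_def]\<close>)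

lemma n_normal' [simp]: "x \<in> V \<Longrightarrow> G (J x) n = 0"
  by (simp add: sym[of "J x" n])

lemma J_sum: "(\<And>i. i \<in> K \<Longrightarrow> v i \<in> V) \<Longrightarrow> J (\<Sum>i\<in>K. v i) = (\<Sum>i\<in>K. J (v i))"
proof (induction K rule: infinite_finite_induct)
  case (insert i K)
  then show ?case using J_lin[of "v i" "\<Sum>i\<in>K. v i" 1 1] by (simp add: V.in_sum)
qed (simp_all add: J_0)

lemma adapted_basis: "orthonormal_basis T G (case_option n (J \<circ> e) :: 'i option \<Rightarrow> 'v)"
proof (rule orthonormal_basisI_card)
  fix i j :: "'i option"
  show "G (case_option n (J \<circ> e) i) (case_option n (J \<circ> e) j) = (if i = j then 1 else 0)"
    using V.g_e by (auto simp: n_unit gV_def split: option.splits)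
qed (auto simp: card_e split: option.splits)

lemma sum_adapted: "(\<Sum>i\<in>UNIV. f (case_option n (J \<circ> e) (i :: 'i option))) = f n + (\<Sum>i\<in>UNIV. f (J (e i)))"
  unfolding UNIV_option_conv by (subst sum.insert) (auto simp: sum.reindex)

lemma contraction_adapted:
  assumes "lin_on T f" "lin_on T h"
  shows "(\<Sum>k\<in>UNIV. f (E k) * h (E k)) = f n * h n + (\<Sum>i\<in>UNIV. f (J (e i)) * h (J (e i)))"
  using contraction_basis_independent[OF adapted_basis assms] sum_adapted[of "\<lambda>v. f v * h v"] by simp

text \<open>The normal and the six vectors \<open>J (e i)\<close> form a basis of \<open>T\<close>;
  a vector without normal component is a combination of the six.\<close>

lemma normal_complement:
  assumes v: "v \<in> T" "G n v = 0"
  obtains x where "x \<in> V" "J x = v"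
proof
  interpret A: onb_on T G "case_option n (J \<circ> e) :: 'i option \<Rightarrow> 'v"
    by unfold_locales (rule adapted_basis)
  let ?x = "\<Sum>i\<in>UNIV. G v (J (e i)) *\<^sub>R e i"
  show "?x \<in> V" by (intro V.in_sum V.in_scale V.e_in)
  have "J (r *\<^sub>R e i) = r *\<^sub>R J (e i)" for r i using J_lin[of "e i" "e i" r 0] by simp
  then have "J ?x = (\<Sum>i\<in>UNIV. G v (J (e i)) *\<^sub>R J (e i))"
    by (subst J_sum) (simp_all add: V.in_scale)
  also have "\<dots> = v"
    using A.expand[OF v(1)] sum_adapted[of "\<lambda>w. G v w *\<^sub>R w"] v by (simp add: sym)
  finally show "J ?x = v" .
qed

definition cx :: "'w \<Rightarrow> 'w" where
  "cx x = (THE y. y \<in> V \<and> J y = cross n (J x))"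

lemma cx:
  assumes x: "x \<in> V"
  shows "cx x \<in> V" "J (cx x) = cross n (J x)"
proof -
  have "G n (cross n (J x)) = 0"
    using x cross[of n "J x"] sym[of n "cross n (J x)"] skew23[of n "J x" n] \<phi>_same[of n "J x"] by simp
  then obtain y where y: "y \<in> V" "J y = cross n (J x)"
    using normal_complement[of "cross n (J x)"] cross x by auto
  then have "\<exists>!y. y \<in> V \<and> J y = cross n (J x)"
    using inj_onD[OF J_inj] by metis
  from theI'[OF this] show "cx x \<in> V" "J (cx x) = cross n (J x)"
    unfolding cx_def by auto
qed

lemma g_cx: "x \<in> V \<Longrightarrow> y \<in> V \<Longrightarrow> gV (cx x) y = \<Phi> n (J x) (J y)"
  unfolding gV_def by (simp add: cx cross)

text \<open>Turns \<open>cx\<close> into a contraction of \<open>\<Phi>\<close> with itself, so that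
  its compatibility with the three-form can be read off from
  \<open>\<phi>_norm_polarized\<close>.\<close>

lemma \<Phi>_cx:
  assumes "x \<in> V" "y \<in> V" "z \<in> V"
  shows "\<Phi> (J (cx x)) (J y) (J z) = (\<Sum>k\<in>UNIV. \<Phi> n (J x) (E k) * \<Phi> (J y) (J z) (E k))"
proof -
  have "\<Phi> (J (cx x)) (J y) (J z) = \<Phi> (J y) (J z) (J (cx x))"
    using assms cx(1)[of x] skew12[of "J (cx x)" "J y" "J z"] skew23[of "J y" "J (cx x)" "J z"] by simp
  then have "\<Phi> (J (cx x)) (J y) (J z) = (\<Sum>k\<in>UNIV. G (J (cx x)) (E k) * \<Phi> (J y) (J z) (E k))"
    using lin_on_expand[OF trilin_onD(3)[OF tri J_in J_in], of y z "J (cx x)"] assms cx(1) by simp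
  then show ?thesis using assms by (simp add: cx cross)
qed

lemma contraction_V:
  assumes "a \<in> T" "b \<in> T" "c \<in> T" "d \<in> T"
  shows "(\<Sum>i\<in>UNIV. \<Phi> a b (J (e i)) * \<Phi> c d (J (e i)))
    = (\<Sum>k\<in>UNIV. \<Phi> a b (E k) * \<Phi> c d (E k)) - \<Phi> a b n * \<Phi> c d n"
  using contraction_adapted[OF trilin_onD(3)[OF tri assms(1,2)] trilin_onD(3)[OF tri assms(3,4)]] by simp

sublocale su3: su3_space V gV e cx "\<lambda>x y z. \<Phi> (J x) (J y) (J z)"
proof
  show "CARD('i) = 6" by (rule card_e)
  fix x assume x: "x \<in> V"
  show "cx x \<in> V" using cx x by blast
  fix y assume y: "y \<in> V"
  show "gV (cx x) y = - gV x (cx y)"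
    using x y g_cx[of y x] skew23[of n "J x" "J y"] by (simp add: g_cx V.sym[of x] cx)
next
  fix x assume x: "x \<in> V"
  show "cx (cx x) = - x"
  proof (rule V.eqI)
    fix z assume z: "z \<in> V"
    have "gV (cx (cx x)) z = - \<Phi> n (J z) (J (cx x))"
      using x z skew23[of n "J (cx x)" "J z"] by (simp add: g_cx cx(1))
    also have "\<dots> = - gV (cx z) (cx x)" using x z cx by (simp add: g_cx)
    \<comment> \<open>The square of P(n, .) is reduced to the norm identity with a = n, where the
      mixed terms vanish because tangent vectors are orthogonal to n.\<close>
    also have "\<dots> = - (\<Sum>i\<in>UNIV. \<Phi> n (J z) (J (e i)) * \<Phi> n (J x) (J (e i)))"
      using x z cx by (subst V.parseval) (simp_all add: g_cx)
    also have "\<dots> = - gV z x"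
      using x z by (simp add: contraction_V \<phi>_norm n_unit gV_def skew23[of n _ n] \<phi>_same)
    finally show "gV (cx (cx x)) z = gV (- x) z" using x z by (simp add: V.sym)
  qed (use x cx in \<open>simp_all add: V.in_neg\<close>)
next
  show "trilin_on V (\<lambda>x y z. \<Phi> (J x) (J y) (J z))"
    unfolding trilin_on_def lin_on_def
    using tri unfolding trilin_on_def lin_on_def by (simp add: J_lin)
  fix x y z assume V: "x \<in> V" "y \<in> V" "z \<in> V"
  show "\<Phi> (J x) (J y) (J z) = - \<Phi> (J y) (J x) (J z)" "\<Phi> (J x) (J y) (J z) = - \<Phi> (J x) (J z) (J y)"
    by (rule skew12[OF J_in J_in J_in, OF V]) (rule skew23[OF J_in J_in J_in, OF V])
  let ?K = "\<lambda>a b c d. \<Sum>k\<in>UNIV. \<Phi> a b (E k) * \<Phi> c d (E k)"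
  \<comment> \<open>Polarization with n in the first slot: every metric term contains a product of n
    with a tangent vector, so the contraction is invariant under cyclic exchange of its tangent
    arguments.\<close>
  have K: "?K n (J a) (J b) (J c) = ?K n (J c) (J a) (J b)" if "a \<in> V" "b \<in> V" "c \<in> V" for a b c
  proof -
    have "?K n (J a) (J b) (J c) = - ?K (J b) (J a) n (J c)"
      using \<phi>_norm_polarized[of n "J a" "J b" "J c"] that by simp
    also have "?K (J b) (J a) n (J c) = - ?K n (J c) (J a) (J b)"
      using that by (subst skew12[of "J b" "J a"]) (simp_all add: sum_negf mult.commute)
    finally show ?thesis by simp
  qed
  have "\<Phi> (J x) (J (cx y)) (J z) = - \<Phi> (J (cx y)) (J x) (J z)"
    by (rule skew12[OF J_in J_in J_in, OF V(1) cx(1)[OF V(2)] V(3)])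
  also have "\<dots> = - ?K n (J y) (J x) (J z)" using V by (simp add: \<Phi>_cx)
  also have "\<dots> = ?K n (J y) (J z) (J x)"
    using V by (subst skew12[of "J x" "J z"]) (simp_all add: sum_negf)
  also have "\<dots> = ?K n (J x) (J y) (J z)" using K V by blast
  finally show "\<Phi> (J (cx x)) (J y) (J z) = \<Phi> (J x) (J (cx y)) (J z)" using V by (simp add: \<Phi>_cx)
next
  fix a b d assume V: "a \<in> V" "b \<in> V" "d \<in> V"
  \<comment> \<open>The contraction over \<open>V\<close> lacks the normal direction of the ambient
    one; the missing product is exactly the term with \<open>cx\<close>.\<close>
  have "\<Phi> (J a) (J c) n = \<Phi> n (J a) (J c)" if "c \<in> V" for c
    using V that skew23[of "J a" "J c" n] skew12[of "J a" n "J c"] by simp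
  then show "(\<Sum>k\<in>UNIV. \<Phi> (J a) (J b) (J (e k)) * \<Phi> (J a) (J d) (J (e k))) =
      gV a a * gV b d - gV a b * gV a d - gV (cx a) b * gV (cx a) d"
    using V by (simp add: contraction_V \<phi>_norm g_cx) (simp add: gV_def)
qed

end

section \<open>Inner products on tangent spaces\<close>

lemma tangent_space_basis:
  fixes A :: "('m::topological_space, 'n::finite) chart set"
  assumes A: "smooth_atlas A" and c: "c \<in> charts_at A p"
  shows "inj (\<lambda>u. coord_field A c u p)" "range (\<lambda>u. coord_field A c u p) = tangent_space A p"
    "\<exists>T. finite T \<and> independent T \<and> span T = tangent_space A p \<and> card T = CARD('n)"
proof -
  let ?l = "\<lambda>u. coord_field A c u p"
  show inj: "inj ?l" using assms by (metis coord_coord_field_same injI)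
  show r: "range ?l = tangent_space A p"
    using coord_field_in_tangent_space[OF A c] coord_field_coord[OF A c] by (auto intro!: rangeI) (metis rangeI)
  have l: "linear ?l" by (rule linear_coord_field[OF A c])
  have "independent (?l ` (Basis :: (real ^ 'n) set))"
    by (rule linear_independent_injective_image[OF l independent_Basis inj_on_subset[OF inj subset_UNIV]])
  moreover have "span (?l ` (Basis :: (real ^ 'n) set)) = tangent_space A p"
    using linear_span_image[OF l] r by simp
  moreover have "card (?l ` (Basis :: (real ^ 'n) set)) = CARD('n)"
    using card_image[OF inj_on_subset[OF inj subset_UNIV]] by simp
  ultimately show "\<exists>T. finite T \<and> independent T \<and> span T = tangent_space A p \<and> card T = CARD('n)"
    by (metis finite_Basis finite_imageI)
qed

lemma orthonormal_basis_onb: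
  fixes A :: "('m::topological_space, 'n::finite) chart set"
  assumes A: "smooth_atlas A" and g: "inner_on (tangent_space A p) g"
  shows "orthonormal_basis (tangent_space A p) g (onb (tangent_space A p) g)"
proof -
  obtain T :: "('m, 'n) tvec set" where "finite T" "independent T" "span T = tangent_space A p" "card T = CARD('n)"
    using tangent_space_basis(3)[OF A chart_of_in_charts_at[OF A]] by blast
  then have "\<exists>e::'n \<Rightarrow> ('m, 'n) tvec. orthonormal_basis (tangent_space A p) g e"
    by (rule inner_on.ex_orthonormal_basis[OF g])
  then show ?thesis unfolding onb_def by (rule someI_ex)
qed

lemma inner_on_riemannian:
  assumes "smooth_atlas A" "riemannian_metric A g"
  shows "inner_on (tangent_space A p) (g p)"
  using assms unfolding riemannian_metric_def inner_on_def
  by (auto simp: subspace_tangent_space)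

section \<open>The Levi-Civita connection in a chart\<close>

text \<open>Alternating the two exchanges returns to the start with the opposite sign. In the
  application \<open>S\<close> is the difference of two candidate Christoffel maps, paired with a
  third vector.\<close>

lemma bilinear_eq_0_of_sym_skew:
  fixes S :: "'a \<Rightarrow> 'a \<Rightarrow> 'a \<Rightarrow> real"
  assumes "\<And>u v w. S u v w = S v u w" "\<And>u v w. S u v w = - S u w v"
  shows "S u v w = 0"
  using assms(1)[of u v w] assms(2)[of v u w] assms(1)[of v w u] assms(2)[of w v u] assms(1)[of w u v] assms(2)[of u w v]
  by linarith

text \<open>Symmetry of two solutions and their compatibility with the metric leave no room for a
  difference. It resolves the description in the definition twice: in the existence proof, and to
  recognize the connection of the induced metric.\<close>

lemma christoffel_eqI:
  fixes A :: "('m::topological_space, 'n::finite) chart set"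
  assumes A: "smooth_atlas A" and c: "c \<in> charts_at A p" and g: "inner_on (tangent_space A p) (g p)"
    and \<Gamma>: "bilinear \<Gamma>" "\<And>u v. \<Gamma> u v = \<Gamma> v u"
    "\<And>u v w. frechet_derivative ((\<lambda>p. g p (coord_field A c v p) (coord_field A c w p)) \<circ> chart_inv c) (at (snd c p)) u
       = g p (coord_field A c (\<Gamma> u v) p) (coord_field A c w p) + g p (coord_field A c v p) (coord_field A c (\<Gamma> u w) p)"
  shows "christoffel A g c p = \<Gamma>"
  unfolding christoffel_def Let_def
proof (rule the_equality)
  show "bilinear \<Gamma> \<and> (\<forall>u v. \<Gamma> u v = \<Gamma> v u) \<and> (\<forall>u v w.
       frechet_derivative ((\<lambda>p. g p (coord_field A c v p) (coord_field A c w p)) \<circ> chart_inv c) (at (snd c p)) u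
       = g p (coord_field A c (\<Gamma> u v) p) (coord_field A c w p) + g p (coord_field A c v p) (coord_field A c (\<Gamma> u w) p))"
    using \<Gamma> by blast
next
  fix \<Gamma>' :: "real ^ 'n \<Rightarrow> real ^ 'n \<Rightarrow> real ^ 'n"
  assume h: "bilinear \<Gamma>' \<and> (\<forall>u v. \<Gamma>' u v = \<Gamma>' v u) \<and> (\<forall>u v w.
       frechet_derivative ((\<lambda>p. g p (coord_field A c v p) (coord_field A c w p)) \<circ> chart_inv c) (at (snd c p)) u
       = g p (coord_field A c (\<Gamma>' u v) p) (coord_field A c w p) + g p (coord_field A c v p) (coord_field A c (\<Gamma>' u w) p))"
  interpret inner_on "tangent_space A p" "g p" by (rule g)
  let ?f = "\<lambda>u. coord_field A c u p"
  have i [simp]: "?f u \<in> tangent_space A p" for u by (rule coord_field_in_tangent_space[OF A c])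
  have "g p (?f (\<Gamma>' u v)) (?f w) - g p (?f (\<Gamma> u v)) (?f w) = 0" for u v w
  proof (rule bilinear_eq_0_of_sym_skew[where S = "\<lambda>u v w. g p (?f (\<Gamma>' u v)) (?f w) - g p (?f (\<Gamma> u v)) (?f w)"])
    fix u v w
    show "g p (?f (\<Gamma>' u v)) (?f w) - g p (?f (\<Gamma> u v)) (?f w) = g p (?f (\<Gamma>' v u)) (?f w) - g p (?f (\<Gamma> v u)) (?f w)"
      using h \<Gamma>(2)[of u v] by metis
    have "g p (?f (\<Gamma>' u v)) (?f w) + g p (?f v) (?f (\<Gamma>' u w)) = g p (?f (\<Gamma> u v)) (?f w) + g p (?f v) (?f (\<Gamma> u w))"
      using h \<Gamma>(3)[of v w u] by metis
    then show "g p (?f (\<Gamma>' u v)) (?f w) - g p (?f (\<Gamma> u v)) (?f w) = - (g p (?f (\<Gamma>' u w)) (?f v) - g p (?f (\<Gamma> u w)) (?f v))"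
      using sym[OF i i] by (simp add: algebra_simps)
  qed
  then have "g p (?f (\<Gamma>' u v)) z = g p (?f (\<Gamma> u v)) z" if "z \<in> tangent_space A p" for u v z
    using coord_field_coord[OF A c that] by (metis right_minus_eq)
  then have "?f (\<Gamma>' u v) = ?f (\<Gamma> u v)" for u v by (intro eqI i)
  then show "\<Gamma>' = \<Gamma>" using tangent_space_basis(1)[OF A c] by (intro ext) (auto dest: injD)
qed

lemma christoffel_works:
  fixes A :: "('m::topological_space, 'n::finite) chart set"
  assumes A: "smooth_atlas A" and c: "c \<in> charts_at A p" and R: "riemannian_metric A g"
  defines "\<Gamma> \<equiv> christoffel A g c p"
  shows "bilinear \<Gamma>" "\<Gamma> u v = \<Gamma> v u"
    "((\<lambda>y. g (chart_inv c y) (coord_field A c v (chart_inv c y)) (coord_field A c w (chart_inv c y))) has_derivative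
       (\<lambda>u. g p (coord_field A c (\<Gamma> u v) p) (coord_field A c w p) + g p (coord_field A c v p) (coord_field A c (\<Gamma> u w) p)))
     (at (snd c p))"
proof -
  interpret inner_on "tangent_space A p" "g p" by (rule inner_on_riemannian[OF A R])
  interpret onb_on "tangent_space A p" "g p" "onb (tangent_space A p) (g p)"
    by unfold_locales (rule orthonormal_basis_onb[OF A inner_on_axioms])
  note C = charts_atD[OF A c]
  let ?f = "\<lambda>u. coord_field A c u p"
  let ?G = "\<lambda>v w. (\<lambda>p. g p (coord_field A c v p) (coord_field A c w p)) \<circ> chart_inv c"
  define D where "D v w = frechet_derivative (?G v w) (at (snd c p))" for v w
  have i [simp]: "?f u \<in> tangent_space A p" for u by (rule coord_field_in_tangent_space[OF A c])
  have D: "(?G v w has_derivative D v w) (at (snd c p))" for v w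
    unfolding D_def using R C
    by (intro smooth_on_has_derivative[of "snd c ` fst c"]) (auto simp: riemannian_metric_def)
  \<comment> \<open>Coordinate fields are tangent only on the chart domain, so the metric is
    bilinear in them only there; symmetry and linearity of \<open>D\<close> follow by uniqueness of
    derivatives.\<close>
  have near: "\<forall>\<^sub>F y in nhds (snd c p). c \<in> charts_at A (chart_inv c y)"
    using eventually_chart_inv[OF C(3,2) eventually_in_chart[OF C(3,2)]] C(1) by (simp add: charts_at_def)
  have cf: "coord_field A c u p' \<in> tangent_space A p'" if "c \<in> charts_at A p'" for u p'
    using coord_field_in_tangent_space[OF A that] .
  have Dsym: "D v w = D w v" for v w
    unfolding D_def
  proof (rule frechet_derivative_cong_nhds)
    show "\<forall>\<^sub>F y in nhds (snd c p). ?G v w y = ?G w v y"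
      using near by eventually_elim (simp add: inner_on.sym[OF inner_on_riemannian[OF A R]] cf)
  qed
  have Dlin: "linear (D v w)" for v w using D has_derivative_linear by blast
  have Dadd: "D v (w + w') u = D v w u + D v w' u" for v w w' u
  proof -
    have "(?G v (w + w') has_derivative (\<lambda>u. D v w u + D v w' u)) (at (snd c p))"
    proof (rule has_derivative_cong_nhds)
      show "((\<lambda>y. ?G v w y + ?G v w' y) has_derivative (\<lambda>u. D v w u + D v w' u)) (at (snd c p))"
        by (intro has_derivative_add D)
      show "\<forall>\<^sub>F y in nhds (snd c p). ?G v w y + ?G v w' y = ?G v (w + w') y"
        using near by eventually_elim
          (simp add: inner_on.g_right[OF inner_on_riemannian[OF A R]] cf coord_field_add[OF A])
    qed
    from has_derivative_unique[OF D this] show ?thesis by (rule fun_cong)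
  qed
  have Dscale: "D v (r *\<^sub>R w) u = r * D v w u" for v w r u
  proof -
    have "(?G v (r *\<^sub>R w) has_derivative (\<lambda>u. r * D v w u)) (at (snd c p))"
    proof (rule has_derivative_cong_nhds)
      show "((\<lambda>y. r * ?G v w y) has_derivative (\<lambda>u. r * D v w u)) (at (snd c p))"
        by (intro has_derivative_mult_right D)
      show "\<forall>\<^sub>F y in nhds (snd c p). r * ?G v w y = ?G v (r *\<^sub>R w) y"
        using near by eventually_elim
          (simp add: inner_on.g_right[OF inner_on_riemannian[OF A R]] cf coord_field_scaleR[OF A])
    qed
    from has_derivative_unique[OF D this] show ?thesis by (rule fun_cong)
  qed
  have Dadd': "D (w + w') v u = D w v u + D w' v u" for v w w' u
    unfolding Dsym[of "w + w'" v] Dsym[of w v] Dsym[of w' v] by (rule Dadd)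
  have Dscale': "D (r *\<^sub>R w) v u = r * D w v u" for v w r u
    unfolding Dsym[of "r *\<^sub>R w" v] Dsym[of w v] by (rule Dscale)
  \<comment> \<open>Koszul formula for coordinate fields, whose brackets vanish; the Riesz vector of
    \<open>k u v\<close> provides the Christoffel value.\<close>
  define k where "k u v z = (D v (coord z c) u + D u (coord z c) v - D u v (coord z c)) / 2" for u v z
  note Dr = Dadd Dscale Dadd' Dscale' linear_add[OF Dlin] linear_scale[OF Dlin]
  have k: "lin_on (tangent_space A p) (k u v)" for u v
    by (rule lin_onI[OF _ _ sub]) (simp_all add: k_def Dr field_simps)
  define K where "K u v = (THE x. x \<in> tangent_space A p \<and> (\<forall>z\<in>tangent_space A p. g p x z = k u v z))" for u v
  have K: "K u v \<in> tangent_space A p" "z \<in> tangent_space A p \<Longrightarrow> g p (K u v) z = k u v z" for u v z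
    using theI'[OF riesz[OF k]] unfolding K_def by auto
  define \<Gamma>' where "\<Gamma>' u v = coord (K u v) c" for u v
  have f\<Gamma>: "?f (\<Gamma>' u v) = K u v" for u v
    unfolding \<Gamma>'_def by (rule coord_field_coord[OF A c K(1)])
  have Ksym: "K u v = K v u" for u v
    by (rule eqI) (auto simp: K k_def Dsym[of u v])
  have Kadd: "K u (v + w) = K u v + K u w" for u v w
    by (rule eqI) (auto simp: K k_def Dr in_add field_simps)
  have Kscale: "K u (r *\<^sub>R v) = r *\<^sub>R K u v" for u v r
    by (rule eqI) (auto simp: K k_def Dr in_scale field_simps)
  have lin: "linear (\<Gamma>' u)" for u
    by (rule linearI) (simp_all add: \<Gamma>'_def Kadd Kscale)
  have sym': "\<Gamma>' u v = \<Gamma>' v u" for u v unfolding \<Gamma>'_def by (simp add: Ksym[of u v])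
  have "linear (\<lambda>u. \<Gamma>' u v)" for v using lin[of v] sym'[of _ v] by simp
  then have bil: "bilinear \<Gamma>'" unfolding bilinear_def using lin by simp
  have cK: "coord (coord_field A c u p) c = u" for u by (rule coord_coord_field_same[OF A c])
  have comp: "D v w u = g p (?f (\<Gamma>' u v)) (?f w) + g p (?f v) (?f (\<Gamma>' u w))" for u v w
    unfolding f\<Gamma> using K(1) by (simp add: sym[of "?f v"] K cK k_def Dsym[of w v] field_simps)
  have "christoffel A g c p = \<Gamma>'"
    by (rule christoffel_eqI[OF A c, of g]) (use inner_on_axioms bil sym' comp in \<open>simp_all add: D_def\<close>)
  then have eq: "\<Gamma> = \<Gamma>'" unfolding \<Gamma>_def .
  show "bilinear \<Gamma>" "\<Gamma> u v = \<Gamma> v u" unfolding eq using bil sym' by blast+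
  have "D v w = (\<lambda>u. g p (?f (\<Gamma> u v)) (?f w) + g p (?f v) (?f (\<Gamma> u w)))"
    unfolding eq using comp by blast
  then show "((\<lambda>y. g (chart_inv c y) (coord_field A c v (chart_inv c y)) (coord_field A c w (chart_inv c y))) has_derivative
       (\<lambda>u. g p (coord_field A c (\<Gamma> u v) p) (coord_field A c w p) + g p (coord_field A c v p) (coord_field A c (\<Gamma> u w) p)))
     (at (snd c p))"
    using D[of v w] by (simp add: o_def)
qed

text \<open>The extension has constant components in the computing chart, so only the Christoffel
  term survives.\<close>

lemma levi_civita_const_ext:
  fixes A :: "('m::topological_space, 'n::finite) chart set"
  assumes A: "smooth_atlas A" and x: "x \<in> tangent_space A p"
  defines "c \<equiv> chart_of A p"
  shows "levi_civita A g p x (const_ext A p y) = coord_field A c (christoffel A g c p (coord x c) (coord y c)) p"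
proof -
  have c: "c \<in> charts_at A p" unfolding c_def by (rule chart_of_in_charts_at[OF A])
  note C = charts_atD[OF A c]
  have id: "frechet_derivative (snd c \<circ> chart_inv c) (at (snd c p)) = (\<lambda>u. u)"
    by (intro ext transition_self[OF A c])
  have "dir_deriv A p x (\<lambda>p'. coord (const_ext A p y p') c) = dir_deriv A p x (\<lambda>p'. coord y c)"
  proof (rule dir_deriv_cong[OF A])
    show "\<forall>\<^sub>F p' in nhds p. coord (const_ext A p y p') c = coord y c"
      using eventually_in_chart[OF C(3,2)]
      by eventually_elim (simp add: const_ext_def c_def[symmetric] charts_at_def C coord_coord_field_same[OF A])
  qed
  also have "\<dots> = 0" by (simp add: dir_deriv_def o_def)
  finally have 1: "dir_deriv A p x (\<lambda>p'. coord (const_ext A p y p') c) = 0" .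
  have 2: "coord (differential A A (\<lambda>p. p) p x) c = coord x c"
    using c by (simp add: differential_def dir_deriv_def c_def[symmetric] o_def) (simp add: id[unfolded o_def])
  have 3: "coord (const_ext A p y p) c = coord y c"
    by (simp add: const_ext_def c_def[symmetric] coord_coord_field_same[OF A c])
  show ?thesis
    unfolding levi_civita_def cov_deriv_along_def Let_def c_def[symmetric] 1 2 3 by simp
qed

section \<open>The differential of a smooth map\<close>

lemma open_smooth_map_domain:
  fixes A :: "('q::topological_space, 'k::finite) chart set" and A' :: "('m::topological_space, 'n::finite) chart set"
  assumes "smooth_atlas A'" "smooth_map A A' f" "d \<in> A'"
  shows "open (f -` fst d)"
  using assms unfolding smooth_map_def smooth_atlas_def is_chart_def
  by (auto simp: continuous_on_open_vimage)

lemma smooth_map_smooth_on: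
  assumes "smooth_map A A' f" "c \<in> charts_at A q" "d \<in> charts_at A' (f q)"
  shows "smooth_on (snd c ` (fst c \<inter> f -` fst d)) (snd d \<circ> f \<circ> chart_inv c)"
    "snd c q \<in> snd c ` (fst c \<inter> f -` fst d)"
  using assms unfolding smooth_map_def charts_at_def by auto

lemma smooth_map_has_derivative:
  assumes "smooth_map A A' f" "c \<in> charts_at A q" "d \<in> charts_at A' (f q)"
  shows "((snd d \<circ> f \<circ> chart_inv c) has_derivative frechet_derivative (snd d \<circ> f \<circ> chart_inv c) (at (snd c q))) (at (snd c q))"
  using smooth_on_has_derivative[OF smooth_map_smooth_on[OF assms]] .

lemma coord_differential:
  assumes A: "smooth_atlas A" and f: "smooth_map A A' f" and c: "c \<in> charts_at A q" and d: "d \<in> charts_at A' (f q)"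
    and x: "x \<in> tangent_space A q"
  shows "coord (differential A A' f q x) d = frechet_derivative (snd d \<circ> f \<circ> chart_inv c) (at (snd c q)) (coord x c)"
  using d dir_deriv_eq[OF A c x smooth_map_has_derivative[OF f c d]] by (simp add: differential_def)

lemma differential_in_tangent_space:
  assumes A: "smooth_atlas A" and A': "smooth_atlas A'" and f: "smooth_map A A' f" and x: "x \<in> tangent_space A q"
  shows "differential A A' f q x \<in> tangent_space A' (f q)"
proof (rule tangent_spaceI)
  let ?c = "chart_of A q"
  note c = chart_of_in_charts_at[OF A, of q]
  note C = charts_atD[OF A c]
  fix d d' assume d: "d \<in> charts_at A' (f q)" and d': "d' \<in> charts_at A' (f q)"
  note D = charts_atD[OF A' d]
  have *: "(snd d \<circ> f \<circ> chart_inv ?c) (snd ?c q) = snd d (f q)" by (simp add: chart_inv_left C)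
  have "((snd d' \<circ> chart_inv d) \<circ> (snd d \<circ> f \<circ> chart_inv ?c) has_derivative
      frechet_derivative (snd d' \<circ> chart_inv d) (at (snd d (f q))) \<circ> frechet_derivative (snd d \<circ> f \<circ> chart_inv ?c) (at (snd ?c q))) (at (snd ?c q))"
    by (rule diff_chain_at[OF smooth_map_has_derivative[OF f c d]])
      (use transition_has_derivative[OF A' d d'] * in simp)
  moreover have "\<forall>\<^sub>F a in nhds (snd ?c q). ((snd d' \<circ> chart_inv d) \<circ> (snd d \<circ> f \<circ> chart_inv ?c)) a = (snd d' \<circ> f \<circ> chart_inv ?c) a"
  proof -
    have "\<forall>\<^sub>F q' in nhds q. q' \<in> f -` fst d"
      using open_smooth_map_domain[OF A' f D(1)] D(2) by (intro eventually_nhds_in_open) auto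
    from eventually_chart_inv[OF C(3,2) this] show ?thesis
      by eventually_elim (simp add: chart_inv_left D)
  qed
  ultimately have "((snd d' \<circ> f \<circ> chart_inv ?c) has_derivative
      frechet_derivative (snd d' \<circ> chart_inv d) (at (snd d (f q))) \<circ> frechet_derivative (snd d \<circ> f \<circ> chart_inv ?c) (at (snd ?c q))) (at (snd ?c q))"
    by (rule has_derivative_cong_nhds[rotated])
  from frechet_derivative_at[OF this]
  show "coord (differential A A' f q x) d' =
    frechet_derivative (snd d' \<circ> chart_inv d) (at (snd d (f q))) (coord (differential A A' f q x) d)"
    unfolding coord_differential[OF A f c d x] coord_differential[OF A f c d' x] by (metis comp_apply)
qed (simp add: differential_def)

lemma differential_linear:
  assumes A: "smooth_atlas A" and A': "smooth_atlas A'" and f: "smooth_map A A' f"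
    and x: "x \<in> tangent_space A q" and y: "y \<in> tangent_space A q"
  shows "differential A A' f q (a *\<^sub>R x + b *\<^sub>R y) = a *\<^sub>R differential A A' f q x + b *\<^sub>R differential A A' f q y"
proof -
  note T = subspace_tangent_space[OF A, of q] and T' = subspace_tangent_space[OF A', of "f q"]
  note c = chart_of_in_charts_at[OF A, of q] and d = chart_of_in_charts_at[OF A', of "f q"]
  have xy: "a *\<^sub>R x + b *\<^sub>R y \<in> tangent_space A q" using x y by (intro subspace_add subspace_scale T)
  have l: "linear (frechet_derivative (snd (chart_of A' (f q)) \<circ> f \<circ> chart_inv (chart_of A q)) (at (snd (chart_of A q) q)))"
    using smooth_map_has_derivative[OF f c d] has_derivative_linear by blast
  show ?thesis
    by (intro tangent_space_eqI[OF d] subspace_add subspace_scale T' differential_in_tangent_space[OF A A' f] x y xy)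
      (simp add: coord_differential[OF A f c d] x y xy linear_add[OF l] linear_scale[OF l])
qed

text \<open>With coordinate fields as extensions, the vanishing of \<open>nabla3\<close> is a
  formula for the ordinary derivative of the components of \<phi>. In this form it can be composed
  with a map into the manifold.\<close>

lemma parallel_form_derivative:
  fixes A :: "('m::topological_space, 'n::finite) chart set"
  assumes A: "smooth_atlas A" and \<phi>: "three_form A \<phi>"
    and par: "\<forall>x\<in>tangent_space A p. \<forall>y\<in>tangent_space A p. \<forall>z\<in>tangent_space A p. \<forall>w\<in>tangent_space A p.
      nabla3 A g \<phi> p x y z w = 0"
  defines "c \<equiv> chart_of A p"
  defines "\<Gamma> \<equiv> christoffel A g c p"
  shows "((\<lambda>y. \<phi> (chart_inv c y) (coord_field A c u (chart_inv c y)) (coord_field A c v (chart_inv c y))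
        (coord_field A c w (chart_inv c y))) has_derivative
     (\<lambda>x. \<phi> p (coord_field A c (\<Gamma> x u) p) (coord_field A c v p) (coord_field A c w p)
        + \<phi> p (coord_field A c u p) (coord_field A c (\<Gamma> x v) p) (coord_field A c w p)
        + \<phi> p (coord_field A c u p) (coord_field A c v p) (coord_field A c (\<Gamma> x w) p))) (at (snd c p))"
proof -
  have c: "c \<in> charts_at A p" unfolding c_def by (rule chart_of_in_charts_at[OF A])
  note C = charts_atD[OF A c]
  let ?F = "(\<lambda>p. \<phi> p (coord_field A c u p) (coord_field A c v p) (coord_field A c w p)) \<circ> chart_inv c"
  have D: "(?F has_derivative frechet_derivative ?F (at (snd c p))) (at (snd c p))"
    using \<phi> C by (intro smooth_on_has_derivative[of "snd c ` fst c"]) (auto simp: three_form_def)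
  have T: "coord_field A c x p \<in> tangent_space A p" for x by (rule coord_field_in_tangent_space[OF A c])
  have cc: "coord (coord_field A c x p) c = x" for x by (rule coord_coord_field_same[OF A c])
  have ce: "const_ext A p (coord_field A c x p) = coord_field A c x" for x
    unfolding const_ext_def c_def[symmetric] cc ..
  have lc: "levi_civita A g p (coord_field A c x p) (coord_field A c y) = coord_field A c (\<Gamma> x y) p" for x y
    using levi_civita_const_ext[OF A T, of g x "coord_field A c y p"] unfolding ce
    unfolding c_def[symmetric] cc \<Gamma>_def .
  have "frechet_derivative ?F (at (snd c p)) = (\<lambda>x. \<phi> p (coord_field A c (\<Gamma> x u) p) (coord_field A c v p) (coord_field A c w p)
        + \<phi> p (coord_field A c u p) (coord_field A c (\<Gamma> x v) p) (coord_field A c w p)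
        + \<phi> p (coord_field A c u p) (coord_field A c v p) (coord_field A c (\<Gamma> x w) p))"
  proof
    fix x
    have "nabla3 A g \<phi> p (coord_field A c x p) (coord_field A c u p) (coord_field A c v p) (coord_field A c w p) = 0"
      using par T by blast
    then show "frechet_derivative ?F (at (snd c p)) x = \<phi> p (coord_field A c (\<Gamma> x u) p) (coord_field A c v p) (coord_field A c w p)
        + \<phi> p (coord_field A c u p) (coord_field A c (\<Gamma> x v) p) (coord_field A c w p)
        + \<phi> p (coord_field A c u p) (coord_field A c v p) (coord_field A c (\<Gamma> x w) p)"
      unfolding nabla3_def ce lc by (simp add: dir_deriv_def c_def[symmetric] cc)
  qed
  then show ?thesis using D by (simp add: o_def)
qed

section \<open>Covariant derivatives of vector fields along a map\<close>

locale map_at_point =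
  fixes A :: "('q::topological_space, 'k::finite) chart set" and A' :: "('m::topological_space, 'n::finite) chart set"
    and g :: "'m \<Rightarrow> ('m, 'n) tvec \<Rightarrow> ('m, 'n) tvec \<Rightarrow> real" and f :: "'q \<Rightarrow> 'm" and q :: 'q
  assumes A: "smooth_atlas A" and A': "smooth_atlas A'" and R: "riemannian_metric A' g" and f: "smooth_map A A' f"
begin

definition "c = chart_of A q"
definition "d = chart_of A' (f q)"
definition "F = snd d \<circ> f \<circ> chart_inv c"
definition "F' = frechet_derivative F (at (snd c q))"
definition "\<Gamma> = christoffel A' g d (f q)"

definition comps :: "('q \<Rightarrow> ('m, 'n) tvec) \<Rightarrow> real ^ 'k \<Rightarrow> real ^ 'n" where
  "comps W a = coord (W (chart_inv c a)) d"

text \<open>Differentiability at \<open>q\<close> and tangency near \<open>q\<close> are what the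
  product rules at \<open>q\<close> use; the normal field, pushed coordinate fields and pulled back
  frames all satisfy them.\<close>

definition diff_field :: "('q \<Rightarrow> ('m, 'n) tvec) \<Rightarrow> bool" where
  "diff_field W \<longleftrightarrow> (\<forall>\<^sub>F q' in nhds q. W q' \<in> tangent_space A' (f q')) \<and> comps W differentiable (at (snd c q))"

text \<open>The direction is a coordinate vector, so that expressions in \<open>D W u\<close> can
  serve directly as Frechet derivatives in \<open>u\<close>.\<close>

definition D :: "('q \<Rightarrow> ('m, 'n) tvec) \<Rightarrow> real ^ 'k \<Rightarrow> ('m, 'n) tvec" where
  "D W u = cov_deriv_along A A' g f q (coord_field A c u q) W"

lemma c: "c \<in> charts_at A q" unfolding c_def by (rule chart_of_in_charts_at[OF A])
lemma d: "d \<in> charts_at A' (f q)" unfolding d_def by (rule chart_of_in_charts_at[OF A'])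

lemmas C = charts_atD[OF A c] and Dd = charts_atD[OF A' d]

lemma chart_inv_base [simp]: "chart_inv c (snd c q) = q" using C by (simp add: chart_inv_left)

lemma F_base [simp]: "F (snd c q) = snd d (f q)" by (simp add: F_def)

lemma F_derivative: "(F has_derivative F') (at (snd c q))"
  unfolding F'_def F_def by (rule smooth_map_has_derivative[OF f c d])

lemma near:
  "\<forall>\<^sub>F a in nhds (snd c q). c \<in> charts_at A (chart_inv c a) \<and> d \<in> charts_at A' (f (chart_inv c a)) \<and>
     chart_inv d (F a) = f (chart_inv c a) \<and> snd c (chart_inv c a) = a"
proof -
  have "\<forall>\<^sub>F q' in nhds q. q' \<in> f -` fst d"
    using open_smooth_map_domain[OF A' f Dd(1)] Dd(2) by (intro eventually_nhds_in_open) auto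
  note e = eventually_chart_inv[OF C(3,2) this] eventually_chart_inv[OF C(3,2) eventually_in_chart[OF C(3,2)]]
  have "\<forall>\<^sub>F a in nhds (snd c q). a \<in> snd c ` fst c"
    using C unfolding is_chart_def by (intro eventually_nhds_in_open) auto
  with e show ?thesis
    by eventually_elim (auto simp: charts_at_def C Dd F_def chart_inv_left)
qed

lemma diff_field_near:
  assumes "diff_field W"
  shows "\<forall>\<^sub>F a in nhds (snd c q). W (chart_inv c a) = coord_field A' d (comps W a) (f (chart_inv c a))"
proof -
  have "\<forall>\<^sub>F a in nhds (snd c q). W (chart_inv c a) \<in> tangent_space A' (f (chart_inv c a))"
    using assms eventually_chart_inv[OF C(3,2)] unfolding diff_field_def by blast
  with near show ?thesis
    by eventually_elim (simp add: comps_def coord_field_coord[OF A'])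
qed

lemma diff_field_base: "diff_field W \<Longrightarrow> W q \<in> tangent_space A' (f q)"
  unfolding diff_field_def using eventually_nhds_x_imp_x by fast

lemma diff_field_base_eq: "diff_field W \<Longrightarrow> W q = coord_field A' d (comps W (snd c q)) (f q)"
  using coord_field_coord[OF A' d diff_field_base] by (simp add: comps_def)

lemma comps_derivative:
  "diff_field W \<Longrightarrow> (comps W has_derivative frechet_derivative (comps W) (at (snd c q))) (at (snd c q))"
  unfolding diff_field_def by (simp add: frechet_derivative_works)

lemma D_eq: "D W u = coord_field A' d (frechet_derivative (comps W) (at (snd c q)) u + \<Gamma> (F' u) (comps W (snd c q))) (f q)"
proof -
  have cc: "coord (coord_field A c u q) c = u" by (rule coord_coord_field_same[OF A c])
  have "coord (differential A A' f q (coord_field A c u q)) d = F' u"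
    using coord_differential[OF A f c d coord_field_in_tangent_space[OF A c]] by (simp add: cc F'_def F_def)
  then show ?thesis
    unfolding D_def cov_deriv_along_def Let_def d_def[symmetric]
    by (simp add: dir_deriv_def c_def[symmetric] cc \<Gamma>_def comps_def[abs_def] o_def)
qed

lemma D_in [simp]: "D W u \<in> tangent_space A' (f q)"
  unfolding D_eq by (rule coord_field_in_tangent_space[OF A' d])

text \<open>Metric compatibility along the map. The components of the fields are frozen, the
  Christoffel identity is composed with \<open>F\<close>, and the moving components are then
  released one at a time by \<open>has_derivative_linear_family\<close>.\<close>

lemma g_derivative:
  assumes W: "diff_field W\<^sub>1" "diff_field W\<^sub>2"
  shows "((\<lambda>a. g (f (chart_inv c a)) (W\<^sub>1 (chart_inv c a)) (W\<^sub>2 (chart_inv c a))) has_derivative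
    (\<lambda>u. g (f q) (D W\<^sub>1 u) (W\<^sub>2 q) + g (f q) (W\<^sub>1 q) (D W\<^sub>2 u))) (at (snd c q))"
proof -
  let ?cf = "\<lambda>v p. coord_field A' d v p"
  define G where "G a v w = g (chart_inv d (F a)) (?cf v (chart_inv d (F a))) (?cf w (chart_inv d (F a)))" for a v w
  let ?w1 = "comps W\<^sub>1" and ?w2 = "comps W\<^sub>2" and ?a = "snd c q"
  let ?D1 = "frechet_derivative ?w1 (at ?a)" and ?D2 = "frechet_derivative ?w2 (at ?a)"
  have lin: "linear (\<lambda>v. G a v w)" "linear (\<lambda>w. G a v w)"
    if "d \<in> charts_at A' (f (chart_inv c a))" "chart_inv d (F a) = f (chart_inv c a)" for a v w
  proof -
    interpret inner_on "tangent_space A' (f (chart_inv c a))" "g (f (chart_inv c a))"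
      by (rule inner_on_riemannian[OF A' R])
    note i = coord_field_in_tangent_space[OF A' that(1)]
    show "linear (\<lambda>v. G a v w)" "linear (\<lambda>w. G a v w)"
      unfolding G_def that(2)
      by (rule linearI; simp add: coord_field_add[OF A' that(1)] coord_field_scaleR[OF A' that(1)] i)+
  qed
  have G: "((\<lambda>a. G a v w) has_derivative (\<lambda>u. g (f q) (?cf (\<Gamma> (F' u) v) (f q)) (?cf w (f q))
       + g (f q) (?cf v (f q)) (?cf (\<Gamma> (F' u) w) (f q)))) (at ?a)" for v w
    using has_derivative_compose[OF F_derivative, OF christoffel_works(3)[OF A' d R, of v w, folded F_base]]
    unfolding G_def \<Gamma>_def .
  have 1: "((\<lambda>a. G a (?w1 a) w) has_derivative (\<lambda>u. g (f q) (?cf (\<Gamma> (F' u) (?w1 ?a)) (f q)) (?cf w (f q))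
       + g (f q) (?cf (?w1 ?a) (f q)) (?cf (\<Gamma> (F' u) w) (f q)) + G ?a (?D1 u) w)) (at ?a)" for w
    by (rule has_derivative_linear_family[OF _ G comps_derivative[OF W(1)]])
      (use near in eventually_elim, simp add: lin)
  have 2: "((\<lambda>a. G a (?w1 a) (?w2 a)) has_derivative (\<lambda>u. g (f q) (?cf (\<Gamma> (F' u) (?w1 ?a)) (f q)) (?cf (?w2 ?a) (f q))
       + g (f q) (?cf (?w1 ?a) (f q)) (?cf (\<Gamma> (F' u) (?w2 ?a)) (f q)) + G ?a (?D1 u) (?w2 ?a) + G ?a (?w1 ?a) (?D2 u))) (at ?a)"
    by (rule has_derivative_linear_family[OF _ 1 comps_derivative[OF W(2)]])
      (use near in eventually_elim, simp add: lin)
  interpret inner_on "tangent_space A' (f q)" "g (f q)" by (rule inner_on_riemannian[OF A' R])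
  have G0: "G ?a v w = g (f q) (?cf v (f q)) (?cf w (f q))" for v w
    unfolding G_def by (simp add: chart_inv_left[OF Dd(3,2)])
  have e: "\<forall>\<^sub>F a in nhds ?a. G a (?w1 a) (?w2 a) = g (f (chart_inv c a)) (W\<^sub>1 (chart_inv c a)) (W\<^sub>2 (chart_inv c a))"
    using near diff_field_near[OF W(1)] diff_field_near[OF W(2)]
    by eventually_elim (simp add: G_def)
  have "(\<lambda>u. g (f q) (?cf (\<Gamma> (F' u) (?w1 ?a)) (f q)) (?cf (?w2 ?a) (f q))
       + g (f q) (?cf (?w1 ?a) (f q)) (?cf (\<Gamma> (F' u) (?w2 ?a)) (f q)) + G ?a (?D1 u) (?w2 ?a) + G ?a (?w1 ?a) (?D2 u))
    = (\<lambda>u. g (f q) (D W\<^sub>1 u) (W\<^sub>2 q) + g (f q) (W\<^sub>1 q) (D W\<^sub>2 u))"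
    unfolding D_eq diff_field_base_eq[OF W(1)] diff_field_base_eq[OF W(2)] G0
    by (simp add: coord_field_add[OF A' d] coord_field_in_tangent_space[OF A' d] algebra_simps)
  then show ?thesis using has_derivative_cong_nhds[OF e 2] by simp
qed

text \<open>Same scheme with three slots: parallelism of the form supplies the derivative for frozen
  components.\<close>

lemma parallel_form_derivative_along:
  assumes \<phi>: "three_form A' \<phi>"
    and par: "\<forall>x\<in>tangent_space A' (f q). \<forall>y\<in>tangent_space A' (f q). \<forall>z\<in>tangent_space A' (f q). \<forall>w\<in>tangent_space A' (f q).
      nabla3 A' g \<phi> (f q) x y z w = 0"
    and W: "diff_field W\<^sub>1" "diff_field W\<^sub>2" "diff_field W\<^sub>3"
  shows "((\<lambda>a. \<phi> (f (chart_inv c a)) (W\<^sub>1 (chart_inv c a)) (W\<^sub>2 (chart_inv c a)) (W\<^sub>3 (chart_inv c a))) has_derivative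
    (\<lambda>u. \<phi> (f q) (D W\<^sub>1 u) (W\<^sub>2 q) (W\<^sub>3 q) + \<phi> (f q) (W\<^sub>1 q) (D W\<^sub>2 u) (W\<^sub>3 q) + \<phi> (f q) (W\<^sub>1 q) (W\<^sub>2 q) (D W\<^sub>3 u)))
    (at (snd c q))"
proof -
  let ?cf = "\<lambda>v p. coord_field A' d v p" and ?p = "f q"
  define G where "G a v w z = \<phi> (chart_inv d (F a)) (?cf v (chart_inv d (F a))) (?cf w (chart_inv d (F a))) (?cf z (chart_inv d (F a)))" for a v w z
  let ?w1 = "comps W\<^sub>1" and ?w2 = "comps W\<^sub>2" and ?w3 = "comps W\<^sub>3" and ?a = "snd c q"
  let ?D1 = "frechet_derivative ?w1 (at ?a)" and ?D2 = "frechet_derivative ?w2 (at ?a)" and ?D3 = "frechet_derivative ?w3 (at ?a)"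
  have lin: "linear (\<lambda>v. G a v w z)" "linear (\<lambda>v. G a w v z)" "linear (\<lambda>v. G a w z v)"
    if "d \<in> charts_at A' (f (chart_inv c a))" "chart_inv d (F a) = f (chart_inv c a)" for a w z
  proof -
    note i = coord_field_in_tangent_space[OF A' that(1)]
    have t: "trilin_on (tangent_space A' (f (chart_inv c a))) (\<phi> (f (chart_inv c a)))"
      using \<phi> unfolding three_form_def by blast
    note s = coord_field_add[OF A' that(1)] coord_field_scaleR[OF A' that(1)] i
    show "linear (\<lambda>v. G a v w z)" "linear (\<lambda>v. G a w v z)" "linear (\<lambda>v. G a w z v)"
      unfolding G_def that(2)
      by (rule linearI; simp add: s lin_on_add[OF trilin_onD(1)[OF t i i]] lin_on_scale[OF trilin_onD(1)[OF t i i]]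
        lin_on_add[OF trilin_onD(2)[OF t i i]] lin_on_scale[OF trilin_onD(2)[OF t i i]]
        lin_on_add[OF trilin_onD(3)[OF t i i]] lin_on_scale[OF trilin_onD(3)[OF t i i]])+
  qed
  define P where "P v w z u = \<phi> ?p (?cf (\<Gamma> (F' u) v) ?p) (?cf w ?p) (?cf z ?p) + \<phi> ?p (?cf v ?p) (?cf (\<Gamma> (F' u) w) ?p) (?cf z ?p)
      + \<phi> ?p (?cf v ?p) (?cf w ?p) (?cf (\<Gamma> (F' u) z) ?p)" for v w z u
  have G: "((\<lambda>a. G a v w z) has_derivative P v w z) (at ?a)" for v w z
    using has_derivative_compose[OF F_derivative, OF parallel_form_derivative[OF A' \<phi> par, of v w z, folded d_def, folded F_base]]
    unfolding G_def \<Gamma>_def P_def by simp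
  have 1: "((\<lambda>a. G a (?w1 a) w z) has_derivative (\<lambda>u. P (?w1 ?a) w z u + G ?a (?D1 u) w z)) (at ?a)" for w z
    by (rule has_derivative_linear_family[OF _ G comps_derivative[OF W(1)]])
      (use near in eventually_elim, simp add: lin)
  have 2: "((\<lambda>a. G a (?w1 a) (?w2 a) z) has_derivative (\<lambda>u. P (?w1 ?a) (?w2 ?a) z u + G ?a (?D1 u) (?w2 ?a) z + G ?a (?w1 ?a) (?D2 u) z)) (at ?a)" for z
    by (rule has_derivative_linear_family[OF _ 1 comps_derivative[OF W(2)]])
      (use near in eventually_elim, simp add: lin)
  have 3: "((\<lambda>a. G a (?w1 a) (?w2 a) (?w3 a)) has_derivative (\<lambda>u. P (?w1 ?a) (?w2 ?a) (?w3 ?a) u + G ?a (?D1 u) (?w2 ?a) (?w3 ?a)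
      + G ?a (?w1 ?a) (?D2 u) (?w3 ?a) + G ?a (?w1 ?a) (?w2 ?a) (?D3 u))) (at ?a)"
    by (rule has_derivative_linear_family[OF _ 2 comps_derivative[OF W(3)]])
      (use near in eventually_elim, simp add: lin)
  have G0: "G ?a v w z = \<phi> ?p (?cf v ?p) (?cf w ?p) (?cf z ?p)" for v w z
    unfolding G_def by (simp add: chart_inv_left[OF Dd(3,2)])
  have e: "\<forall>\<^sub>F a in nhds ?a. G a (?w1 a) (?w2 a) (?w3 a) = \<phi> (f (chart_inv c a)) (W\<^sub>1 (chart_inv c a)) (W\<^sub>2 (chart_inv c a)) (W\<^sub>3 (chart_inv c a))"
    using near diff_field_near[OF W(1)] diff_field_near[OF W(2)] diff_field_near[OF W(3)]
    by eventually_elim (simp add: G_def)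
  note i = coord_field_in_tangent_space[OF A' d]
  have t: "trilin_on (tangent_space A' ?p) (\<phi> ?p)" using \<phi> unfolding three_form_def by blast
  have "(\<lambda>u. P (?w1 ?a) (?w2 ?a) (?w3 ?a) u + G ?a (?D1 u) (?w2 ?a) (?w3 ?a)
      + G ?a (?w1 ?a) (?D2 u) (?w3 ?a) + G ?a (?w1 ?a) (?w2 ?a) (?D3 u))
    = (\<lambda>u. \<phi> (f q) (D W\<^sub>1 u) (W\<^sub>2 q) (W\<^sub>3 q) + \<phi> (f q) (W\<^sub>1 q) (D W\<^sub>2 u) (W\<^sub>3 q) + \<phi> (f q) (W\<^sub>1 q) (W\<^sub>2 q) (D W\<^sub>3 u))"
    unfolding D_eq diff_field_base_eq[OF W(1)] diff_field_base_eq[OF W(2)] diff_field_base_eq[OF W(3)] G0 P_def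
    by (simp add: coord_field_add[OF A' d] i lin_on_add[OF trilin_onD(1)[OF t i i]]
        lin_on_add[OF trilin_onD(2)[OF t i i]] lin_on_add[OF trilin_onD(3)[OF t i i]] algebra_simps)
  then show ?thesis using has_derivative_cong_nhds[OF e 3] by simp
qed

definition push :: "real ^ 'k \<Rightarrow> 'q \<Rightarrow> ('m, 'n) tvec" where
  "push v q' = differential A A' f q' (coord_field A c v q')"

lemma comps_push: "\<forall>\<^sub>F a in nhds (snd c q). comps (push v) a = frechet_derivative F (at a) v"
  using near
proof eventually_elim
  case (elim a)
  let ?q = "chart_inv c a"
  have "coord (differential A A' f ?q (coord_field A c v ?q)) d
      = frechet_derivative F (at (snd c ?q)) (coord (coord_field A c v ?q) c)"
    unfolding F_def using elim by (intro coord_differential[OF A f] coord_field_in_tangent_space[OF A]) auto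
  then show ?case using elim by (simp add: comps_def push_def coord_coord_field_same[OF A])
qed

lemma frechet_comps_push:
  "frechet_derivative (comps (push v)) (at (snd c q)) u = frechet_derivative (\<lambda>a. frechet_derivative F (at a) v) (at (snd c q)) u"
  unfolding frechet_derivative_cong_nhds[OF comps_push] ..

lemma smooth_F: "smooth_on (snd c ` (fst c \<inter> f -` fst d)) F" "snd c q \<in> snd c ` (fst c \<inter> f -` fst d)"
  "open (snd c ` (fst c \<inter> f -` fst d))"
  using smooth_map_smooth_on[OF f c d] open_chart_image[OF C(3) open_smooth_map_domain[OF A' f Dd(1)]]
  unfolding F_def by auto

lemma diff_field_push: "diff_field (push v)"
proof -
  have "\<forall>\<^sub>F a in nhds (snd c q). frechet_derivative F (at a) v = comps (push v) a"
    using comps_push by (simp add: eq_commute)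
  from has_derivative_cong_nhds[OF this smooth_on_has_derivative[OF smooth_on_frechet_derivative[OF smooth_F(1)] smooth_F(2)]]
  have "comps (push v) differentiable (at (snd c q))" unfolding differentiable_def by blast
  moreover have "\<forall>\<^sub>F q' in nhds q. push v q' \<in> tangent_space A' (f q')"
    using eventually_in_chart[OF C(3,2)]
    by eventually_elim (auto simp: push_def charts_at_def C
        intro!: differential_in_tangent_space[OF A A' f] coord_field_in_tangent_space[OF A])
  ultimately show ?thesis unfolding diff_field_def by blast
qed

lemma comps_push_base: "comps (push v) (snd c q) = F' v"
  using eventually_nhds_x_imp_x[OF comps_push] unfolding F'_def .

lemma push_base: "x \<in> tangent_space A q \<Longrightarrow> push (coord x c) q = differential A A' f q x"
  unfolding push_def by (simp add: coord_field_coord[OF A c])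

text \<open>The components of a pushed field are partial derivatives of \<open>F\<close>; second
  derivatives of \<open>F\<close> commute and the Christoffel map is symmetric. This yields both the
  symmetry of the second fundamental form and the absence of torsion of the induced
  connection.\<close>

lemma D_push_sym: "D (push v) u = D (push u) v"
  unfolding D_eq frechet_comps_push comps_push_base
  using smooth_on_second_derivative_symmetric[OF smooth_F(3,1,2)] christoffel_works(2)[OF A' d R]
  unfolding \<Gamma>_def by metis

lemma D_linear:
  assumes W: "diff_field W"
  shows "D W (r *\<^sub>R u + s *\<^sub>R v) = r *\<^sub>R D W u + s *\<^sub>R D W v"
proof -
  have b: "bilinear \<Gamma>" unfolding \<Gamma>_def by (rule christoffel_works(1)[OF A' d R])
  have l: "linear F'" using F_derivative has_derivative_linear by blast
  have l': "linear (frechet_derivative (comps W) (at (snd c q)))"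
    using comps_derivative[OF W] has_derivative_linear by blast
  show ?thesis unfolding D_eq
    by (simp add: linear_add[OF l] linear_scale[OF l] linear_add[OF l'] linear_scale[OF l'] bilinear_ladd[OF b]
        bilinear_lmul[OF b] coord_field_add[OF A' d] coord_field_scaleR[OF A' d] scaleR_add_right)
qed

lemma dir_deriv_eq_base:
  assumes "x \<in> tangent_space A q" "((\<lambda>a. h (chart_inv c a)) has_derivative h') (at (snd c q))"
  shows "dir_deriv A q x h = h' (coord x c)"
  using dir_deriv_eq[OF A c assms(1), of h h'] assms(2) by (simp add: o_def)

lemma D_cov_deriv: "x \<in> tangent_space A q \<Longrightarrow> cov_deriv_along A A' g f q x W = D W (coord x c)"
  unfolding D_def by (simp add: coord_field_coord[OF A c])

end

section \<open>Hypersurfaces in manifolds with a parallel \<open>G\<^sub>2\<close>-structure\<close>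

locale g2_hypersurface =
  fixes H :: "('m::topological_space, 'q::topological_space) hypersurface"
  assumes A': "smooth_atlas (amb_atlas H)"
    and R: "riemannian_metric (amb_atlas H) (amb_metric H)"
    and G2: "G2_structure (amb_atlas H) (amb_metric H) (amb_form H)"
    and par: "type_P (amb_atlas H) (amb_metric H) (amb_form H)"
    and A: "smooth_atlas (atlas H)"
    and imm: "immersion (atlas H) (amb_atlas H) (incl H)"
    and normal: "unit_normal H"
begin

abbreviation "T q \<equiv> tangent_space (amb_atlas H) (incl H q)"
abbreviation "G q \<equiv> amb_metric H (incl H q)"
abbreviation "\<Phi> q \<equiv> amb_form H (incl H q)"
abbreviation "J q \<equiv> dincl H q"
abbreviation "n \<equiv> normal_field H"
abbreviation "V q \<equiv> TM H q"

text \<open>The same choice term as in \<open>star_form\<close>, so that \<open>star_form\<close>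
  unfolds to a sum over \<open>E q\<close>.\<close>

definition E :: "'q \<Rightarrow> 7 \<Rightarrow> ('m, 7) tvec" where
  "E q = (SOME e. G2_frame (amb_atlas H) (amb_metric H) (amb_form H) (incl H q) e)"

lemma smooth_incl: "smooth_map (atlas H) (amb_atlas H) (incl H)"
  using imm unfolding immersion_def by blast

lemma frame_E: "G2_frame (amb_atlas H) (amb_metric H) (amb_form H) (incl H q) (E q)"
proof -
  have "\<exists>e. G2_frame (amb_atlas H) (amb_metric H) (amb_form H) (incl H q) e"
    using G2 unfolding G2_structure_def by blast
  then show ?thesis unfolding E_def by (rule someI_ex)
qed

lemma three_form: "three_form (amb_atlas H) (amb_form H)"
  using G2 unfolding G2_structure_def by blast

lemma inner_on_T: "inner_on (T q) (G q)"
  by (rule inner_on_riemannian[OF A' R])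

lemma g2_space_frame:
  assumes "G2_frame (amb_atlas H) (amb_metric H) (amb_form H) (incl H q) e"
  shows "g2_space (T q) (G q) e (\<Phi> q)"
proof -
  interpret inner_on "T q" "G q" by (rule inner_on_T)
  show ?thesis
    using assms three_form unfolding G2_frame_def three_form_def
    by unfold_locales blast+
qed

lemma normal_in: "n q \<in> T q" and normal_unit: "G q (n q) (n q) = 1"
  and normal_orth: "x \<in> V q \<Longrightarrow> G q (n q) (J q x) = 0"
  using normal unfolding unit_normal_def smooth_field_along_def by blast+

lemma J_in: "x \<in> V q \<Longrightarrow> J q x \<in> T q"
  unfolding TM_def dincl_def by (rule differential_in_tangent_space[OF A A' smooth_incl])

lemma J_linear: "x \<in> V q \<Longrightarrow> y \<in> V q \<Longrightarrow> J q (a *\<^sub>R x + b *\<^sub>R y) = a *\<^sub>R J q x + b *\<^sub>R J q y"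
  unfolding TM_def dincl_def by (rule differential_linear[OF A A' smooth_incl])

lemma J_inj: "inj_on (J q) (V q)"
  using imm unfolding immersion_def TM_def dincl_def by blast

lemma subspace_V: "subspace (V q)"
  unfolding TM_def by (rule subspace_tangent_space[OF A])

lemma inner_on_V: "inner_on (V q) (ind_metric H q)"
proof -
  interpret T: inner_on "T q" "G q" by (rule inner_on_T)
  have J0: "J q 0 = 0" using J_linear[of 0 q 0 0 0] subspace_0[OF subspace_V] by simp
  show ?thesis
  proof
    show "subspace (V q)" by (rule subspace_V)
    fix x assume x: "x \<in> V q"
    show "lin_on (V q) (ind_metric H q x)"
      unfolding lin_on_def ind_metric_def using x by (simp add: J_linear J_in T.in_V)
    show "ind_metric H q x y = ind_metric H q y x" if "y \<in> V q" for y
      unfolding ind_metric_def using x that by (simp add: T.sym J_in)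
    show "0 < ind_metric H q x x" if "x \<noteq> 0"
      unfolding ind_metric_def using x that inj_onD[OF J_inj, of q x 0] subspace_0[OF subspace_V] J0
      by (intro T.pos J_in) auto
  qed
qed

sublocale hyp: g2_hyperplane "T q" "G q" "E q" "\<Phi> q" "V q" "J q" "n q" "onb (V q) (ind_metric H q)" for q
proof -
  interpret g2_space "T q" "G q" "E q" "\<Phi> q" by (rule g2_space_frame[OF frame_E])
  have o: "orthonormal_basis (V q) (ind_metric H q) (onb (V q) (ind_metric H q))"
    using orthonormal_basis_onb[OF A inner_on_V[unfolded TM_def]] unfolding TM_def .
  show "g2_hyperplane (T q) (G q) (E q) (\<Phi> q) (V q) (J q) (n q) (onb (V q) (ind_metric H q))"
    by unfold_locales
      (use o in \<open>simp_all add: subspace_V J_in J_linear J_inj normal_in normal_unit normal_orth ind_metric_def[abs_def]\<close>)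
qed

lemma gV_eq: "hyp.gV q = ind_metric H q"
  by (intro ext) (simp add: hyp.gV_def ind_metric_def)

lemma cx_eq: "hyp.cx q = cplx H q"
  by (intro ext) (simp add: hyp.cx_def cplx_def hyp.cross_def cross_P_def)

sublocale su3: su3_space "V q" "ind_metric H q" "onb (V q) (ind_metric H q)" "cplx H q" "pull_form H q" for q
  using hyp.su3.su3_space_axioms unfolding gV_eq cx_eq pull_form_def[abs_def] .

section \<open>Shape operator, induced connection and the derivative of \<open>omega\<close>\<close>

sublocale along: map_at_point "atlas H" "amb_atlas H" "amb_metric H" "incl H" q for q
  by unfold_locales (rule A A' R smooth_incl)+

abbreviation "push q x \<equiv> along.push q (coord x (along.c q))"

lemma push_at: "x \<in> V q \<Longrightarrow> push q x q = J q x"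
  using along.push_base[of x q] unfolding TM_def dincl_def .

lemma push_J: "along.push q v q' = J q' (coord_field (atlas H) (along.c q) v q')"
  unfolding along.push_def dincl_def ..

lemma dincl_const_ext: "(\<lambda>q'. J q' (const_ext (atlas H) q y q')) = push q y"
  by (intro ext) (simp add: push_J const_ext_def along.c_def)

lemma coord_field_V: "coord_field (atlas H) (along.c q) v q \<in> V q"
  unfolding TM_def by (rule coord_field_in_tangent_space[OF A along.c])

lemma coord_field_V_near:
  "\<forall>\<^sub>F a in nhds (snd (along.c q) q). coord_field (atlas H) (along.c q) v (chart_inv (along.c q) a) \<in> V (chart_inv (along.c q) a)"
  using along.near by eventually_elim (simp add: TM_def coord_field_in_tangent_space[OF A])

lemma diff_field_normal: "along.diff_field q n"
proof -
  have "smooth_on (snd (along.c q) ` (fst (along.c q) \<inter> incl H -` fst (along.d q))) (along.comps q n)"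
    using normal along.C(1) along.Dd(1) unfolding unit_normal_def smooth_field_along_def along.comps_def[abs_def] by blast
  from smooth_on_has_derivative[OF this along.smooth_F(2)]
  show ?thesis unfolding along.diff_field_def differentiable_def using normal_in by auto
qed

text \<open>Derivative of the constant <n, n> = 1.\<close>

lemma D_normal_normal: "G q (along.D q n u) (n q) = 0"
proof -
  have "(\<lambda>u. G q (along.D q n u) (n q) + G q (n q) (along.D q n u)) = (\<lambda>u. 0)"
    using along.g_derivative[OF diff_field_normal diff_field_normal, of q]
    by (intro has_derivative_unique[of "\<lambda>a. 1"]) (simp_all add: normal_unit)
  from fun_cong[OF this, of u] show ?thesis using hyp.sym[OF normal_in, of "along.D q n u"] by simp
qed

text \<open>Weingarten relation: derivative of <n, W> = 0 for a tangent field W.\<close>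

lemma D_normal_push: "G q (along.D q n u) (along.push q v q) = - G q (along.D q (along.push q v) u) (n q)"
proof -
  let ?c = "along.c q"
  have e: "\<forall>\<^sub>F a in nhds (snd ?c q). G (chart_inv ?c a) (n (chart_inv ?c a)) (along.push q v (chart_inv ?c a)) = 0"
    using coord_field_V_near[of q v] by eventually_elim (simp add: push_J normal_orth)
  have "(\<lambda>u. G q (along.D q n u) (along.push q v q) + G q (n q) (along.D q (along.push q v) u)) = (\<lambda>u. 0)"
    by (rule has_derivative_unique[OF has_derivative_cong_nhds[OF e
          along.g_derivative[OF diff_field_normal along.diff_field_push]]]) simp
  from fun_cong[OF this, of u] show ?thesis using hyp.sym[OF normal_in, of "along.D q (along.push q v) u"] by simp
qed

lemma second_ff_eq: "x \<in> V q \<Longrightarrow> second_ff H q x y = G q (along.D q (push q y) (coord x (along.c q))) (n q)"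
  unfolding second_ff_def dincl_const_ext TM_def by (simp add: along.D_cov_deriv)

lemma second_ff_sym: "x \<in> V q \<Longrightarrow> y \<in> V q \<Longrightarrow> second_ff H q x y = second_ff H q y x"
  by (simp add: second_ff_eq along.D_push_sym)

text \<open>The sign is chosen so that <shape x, y> is the second fundamental form; a preimage
  exists because the derivative of n is orthogonal to n.\<close>

definition shape :: "'q \<Rightarrow> ('q, 6) tvec \<Rightarrow> ('q, 6) tvec" where
  "shape q x = (SOME y. y \<in> V q \<and> J q y = - along.D q n (coord x (along.c q)))"

lemma shape: "shape q x \<in> V q" "J q (shape q x) = - along.D q n (coord x (along.c q))"
proof -
  have "\<exists>y. y \<in> V q \<and> J q y = - along.D q n (coord x (along.c q))"
    using hyp.normal_complement[of "- along.D q n (coord x (along.c q))" q]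
      D_normal_normal[of q "coord x (along.c q)"] hyp.sym[OF normal_in, of "along.D q n _" q]
    by (metis along.D_in hyp.g_right(3) hyp.in_neg neg_equal_0_iff_equal normal_in)
  from someI_ex[OF this] show "shape q x \<in> V q" "J q (shape q x) = - along.D q n (coord x (along.c q))"
    unfolding shape_def by auto
qed

lemma ind_metric_shape:
  assumes "x \<in> V q" "y \<in> V q"
  shows "ind_metric H q (shape q x) y = second_ff H q x y"
  using D_normal_push[of q "coord x (along.c q)" "coord y (along.c q)"] assms
  by (simp add: ind_metric_def shape second_ff_eq push_at J_in)

lemma selfadjoint_shape: "su3.selfadjoint q (shape q)"
  unfolding su3.selfadjoint_def
proof (intro conjI ballI shape)
  fix x y assume "x \<in> V q" "y \<in> V q"
  then show "ind_metric H q (shape q x) y = ind_metric H q x (shape q y)"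
    by (simp add: su3.sym[of x] shape ind_metric_shape second_ff_sym)
qed

text \<open>Candidate for the induced Levi-Civita connection on the coordinate fields of the chart:
  the ambient derivative with its normal component removed.\<close>

definition tangential :: "'q \<Rightarrow> real ^ 6 \<Rightarrow> real ^ 6 \<Rightarrow> ('q, 6) tvec" where
  "tangential q u v = (SOME z. z \<in> V q \<and>
     J q z = along.D q (along.push q v) u - G q (along.D q (along.push q v) u) (n q) *\<^sub>R n q)"

lemma tangential: "tangential q u v \<in> V q"
  "J q (tangential q u v) = along.D q (along.push q v) u - G q (along.D q (along.push q v) u) (n q) *\<^sub>R n q"
proof -
  let ?w = "along.D q (along.push q v) u - G q (along.D q (along.push q v) u) (n q) *\<^sub>R n q"
  have "?w \<in> T q" by (intro hyp.in_diff hyp.in_scale along.D_in normal_in)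
  moreover have "G q (n q) ?w = 0"
    by (simp add: normal_in normal_unit hyp.in_V hyp.sym[of "n q"])
  ultimately obtain z where "z \<in> V q \<and> J q z = ?w" using hyp.normal_complement by metis
  then have "\<exists>z. z \<in> V q \<and> J q z = ?w" by blast
  from someI_ex[OF this] show "tangential q u v \<in> V q" "J q (tangential q u v) = ?w"
    unfolding tangential_def by auto
qed

lemma tangential_sym: "tangential q u v = tangential q v u"
  by (rule inj_onD[OF J_inj[of q]]) (simp_all add: tangential along.D_push_sym[of q u])

lemma tangential_linear: "tangential q (r *\<^sub>R u + s *\<^sub>R u') v = r *\<^sub>R tangential q u v + s *\<^sub>R tangential q u' v"
proof (rule inj_onD[OF J_inj[of q]])
  show "J q (tangential q (r *\<^sub>R u + s *\<^sub>R u') v) = J q (r *\<^sub>R tangential q u v + s *\<^sub>R tangential q u' v)"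
    by (simp add: J_linear tangential along.D_linear[OF along.diff_field_push] normal_in hyp.in_V algebra_simps)
qed (simp_all add: tangential su3.in_V)

lemma christoffel_ind_metric:
  "christoffel (atlas H) (ind_metric H) (along.c q) q = (\<lambda>u v. coord (tangential q u v) (along.c q))"
proof (rule christoffel_eqI[where g = "ind_metric H", OF A along.c])
  let ?c = "along.c q" and ?cf = "\<lambda>v. coord_field (atlas H) (along.c q) v"
  show "inner_on (tangent_space (atlas H) q) (ind_metric H q)" using inner_on_V unfolding TM_def .
  show sym: "coord (tangential q u v) ?c = coord (tangential q v u) ?c" for u v
    by (simp add: tangential_sym)
  have "linear (\<lambda>u. coord (tangential q u v) ?c)" for v
    using tangential_linear[of q 1 _ 1 _ v] tangential_linear[of q _ _ 0 0 v] by (intro linearI) simp_all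
  then show "bilinear (\<lambda>u v. coord (tangential q u v) ?c)"
    unfolding bilinear_def using sym by simp
  have cf: "?cf (coord (tangential q u v) ?c) q = tangential q u v" for u v
    using coord_field_coord[OF A along.c] tangential unfolding TM_def by blast
  fix u v w
  have "((\<lambda>a. ind_metric H (chart_inv ?c a) (?cf v (chart_inv ?c a)) (?cf w (chart_inv ?c a))) has_derivative
      (\<lambda>u. G q (along.D q (along.push q v) u) (along.push q w q) + G q (along.push q v q) (along.D q (along.push q w) u)))
      (at (snd ?c q))"
    using along.g_derivative[OF along.diff_field_push along.diff_field_push, of q v w]
    by (simp add: ind_metric_def push_J)
  from frechet_derivative_at[OF this]
  have "frechet_derivative ((\<lambda>p. ind_metric H p (?cf v p) (?cf w p)) \<circ> chart_inv ?c) (at (snd ?c q)) u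
    = G q (along.D q (along.push q v) u) (along.push q w q) + G q (along.push q v q) (along.D q (along.push q w) u)"
    by (simp add: o_def fun_eq_iff)
  \<comment> \<open>The normal components may be removed because they are paired with tangent
    vectors.\<close>
  also have "\<dots> = ind_metric H q (tangential q u v) (?cf w q) + ind_metric H q (?cf v q) (tangential q u w)"
    using hyp.sym[OF normal_in J_in[OF coord_field_V]]
    by (simp add: ind_metric_def tangential push_J normal_in normal_orth J_in coord_field_V hyp.in_V)
  finally show "frechet_derivative ((\<lambda>p. ind_metric H p (?cf v p) (?cf w p)) \<circ> chart_inv ?c) (at (snd ?c q)) u
    = ind_metric H q (?cf (coord (tangential q u v) ?c) q) (?cf w q)
      + ind_metric H q (?cf v q) (?cf (coord (tangential q u w) ?c) q)"
    unfolding cf .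
qed

lemma gauss_formula:
  fixes y :: "('q, 6) tvec"
  assumes x: "x \<in> V q"
  defines "z \<equiv> levi_civita (atlas H) (ind_metric H) q x (const_ext (atlas H) q y)"
  shows "z \<in> V q" "J q z = along.D q (push q y) (coord x (along.c q)) - second_ff H q x y *\<^sub>R n q"
proof -
  have "z = coord_field (atlas H) (along.c q) (christoffel (atlas H) (ind_metric H) (along.c q) q (coord x (along.c q)) (coord y (along.c q))) q"
    using levi_civita_const_ext[OF A x[unfolded TM_def], of "ind_metric H" y] unfolding z_def along.c_def .
  then have "z = tangential q (coord x (along.c q)) (coord y (along.c q))"
    unfolding christoffel_ind_metric
    using coord_field_coord[OF A along.c] tangential unfolding TM_def by metis
  then show "z \<in> V q" "J q z = along.D q (push q y) (coord x (along.c q)) - second_ff H q x y *\<^sub>R n q"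
    using tangential x by (simp_all add: second_ff_eq)
qed

lemma omega_eq:
  assumes "x \<in> V q" "y \<in> V q"
  shows "omega H q x y = \<Phi> q (n q) (J q y) (J q x)"
  using hyp.g_cx[of y q x] assms unfolding omega_def gV_eq cx_eq by (simp add: su3.sym[of x])

lemma form_derivative:
  assumes "along.diff_field q W\<^sub>1" "along.diff_field q W\<^sub>2" "along.diff_field q W\<^sub>3"
  shows "((\<lambda>a. \<Phi> (chart_inv (along.c q) a) (W\<^sub>1 (chart_inv (along.c q) a)) (W\<^sub>2 (chart_inv (along.c q) a)) (W\<^sub>3 (chart_inv (along.c q) a))) has_derivative
    (\<lambda>u. \<Phi> q (along.D q W\<^sub>1 u) (W\<^sub>2 q) (W\<^sub>3 q) + \<Phi> q (W\<^sub>1 q) (along.D q W\<^sub>2 u) (W\<^sub>3 q) + \<Phi> q (W\<^sub>1 q) (W\<^sub>2 q) (along.D q W\<^sub>3 u)))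
    (at (snd (along.c q) q))"
  using par assms unfolding type_P_def by (intro along.parallel_form_derivative_along three_form) auto

lemmas \<Phi>_lin = lin_on_diff[OF trilin_onD(1)[OF hyp.tri] hyp.sub] lin_on_scale[OF trilin_onD(1)[OF hyp.tri]]
  lin_on_diff[OF trilin_onD(2)[OF hyp.tri] hyp.sub] lin_on_scale[OF trilin_onD(2)[OF hyp.tri]]
  lin_on_diff[OF trilin_onD(3)[OF hyp.tri] hyp.sub] lin_on_scale[OF trilin_onD(3)[OF hyp.tri]]
  lin_on_minus[OF trilin_onD(1)[OF hyp.tri]]

lemma \<Phi>_13: "x \<in> T q \<Longrightarrow> y \<in> T q \<Longrightarrow> \<Phi> q x y x = 0"
  using hyp.skew23[of x q y x] hyp.\<phi>_same[of x q y] by simp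

text \<open>Here \<omega>(y, z) is \<open>\<Phi>\<close> on n, Jz, Jy, so its derivative has three
  terms. The two that differentiate tangent fields cancel against the connection terms: by the Gauss
  formula they differ by a multiple of n, which \<open>\<Phi>\<close> kills next to n. The
  derivative of n remains.\<close>

lemma nabla_omega_eq:
  assumes V: "x \<in> V q" "y \<in> V q" "z \<in> V q"
  shows "nabla_omega H q x y z = pull_form H q (shape q x) y z"
proof -
  let ?c = "along.c q" and ?u = "coord x (along.c q)" and ?N = "\<lambda>y. levi_civita (atlas H) (ind_metric H) q x (const_ext (atlas H) q y)"
  have ce: "const_ext (atlas H) q y = coord_field (atlas H) ?c (coord y ?c)" for y
    unfolding const_ext_def along.c_def ..
  have "\<forall>\<^sub>F a in nhds (snd ?c q). \<Phi> (chart_inv ?c a) (n (chart_inv ?c a)) (push q z (chart_inv ?c a)) (push q y (chart_inv ?c a))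
      = omega H (chart_inv ?c a) (const_ext (atlas H) q y (chart_inv ?c a)) (const_ext (atlas H) q z (chart_inv ?c a))"
    using coord_field_V_near[of q "coord y ?c"] coord_field_V_near[of q "coord z ?c"]
    by eventually_elim (simp add: ce push_J omega_eq)
  from along.dir_deriv_eq_base[OF V(1)[unfolded TM_def] has_derivative_cong_nhds[OF this
      form_derivative[OF diff_field_normal along.diff_field_push along.diff_field_push]]]
  have "dir_deriv (atlas H) q x (\<lambda>p'. omega H p' (const_ext (atlas H) q y p') (const_ext (atlas H) q z p'))
    = \<Phi> q (along.D q n ?u) (J q z) (J q y) + \<Phi> q (n q) (along.D q (push q z) ?u) (J q y)
      + \<Phi> q (n q) (J q z) (along.D q (push q y) ?u)"
    using V by (simp add: push_at)
  moreover have "omega H q (?N y) z = \<Phi> q (n q) (J q z) (along.D q (push q y) ?u)"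
    using V gauss_formula[OF V(1)] by (simp add: omega_eq \<Phi>_lin J_in normal_in hyp.in_V \<Phi>_13)
  moreover have "omega H q y (?N z) = \<Phi> q (n q) (along.D q (push q z) ?u) (J q y)"
    using V gauss_formula[OF V(1)] by (simp add: omega_eq \<Phi>_lin J_in normal_in hyp.in_V hyp.\<phi>_same)
  ultimately have "nabla_omega H q x y z = \<Phi> q (along.D q n ?u) (J q z) (J q y)"
    unfolding nabla_omega_def nabla2_def by simp
  also have "\<dots> = - \<Phi> q (along.D q n ?u) (J q y) (J q z)"
    using V by (intro hyp.skew23 along.D_in J_in)
  finally show ?thesis using V by (simp add: pull_form_def shape \<Phi>_lin J_in)
qed

end

section \<open>Vanishing of the one-form \<open>eta\<close>\<close>

lemma (in onb_on) sum_skew_derivation: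
  assumes D: "\<And>i. D i \<in> V" and skew: "\<And>i j. g (D i) (e j) = - g (D j) (e i)"
    and f: "lin_on V f" and h: "lin_on V h"
  shows "(\<Sum>i\<in>UNIV. f (D i) * h (e i) + f (e i) * h (D i)) = 0"
proof -
  have "(\<Sum>i\<in>UNIV. f (D i) * h (e i)) = (\<Sum>i\<in>UNIV. \<Sum>j\<in>UNIV. g (D i) (e j) * f (e j) * h (e i))"
    using lin_on_expand[OF f D] by (simp add: sum_distrib_right)
  \<comment> \<open>Relabelling and skewness shift the derivative from \<open>f\<close> to
    \<open>h\<close> with a minus sign: an orthonormal frame moves by an infinitesimal rotation,
    which does not affect a contraction.\<close>
  also have "\<dots> = (\<Sum>i\<in>UNIV. \<Sum>j\<in>UNIV. g (D j) (e i) * f (e i) * h (e j))"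
    by (rule sum.swap)
  also have "\<dots> = - (\<Sum>i\<in>UNIV. \<Sum>j\<in>UNIV. f (e i) * (g (D i) (e j) * h (e j)))"
    by (subst skew) (simp add: sum_negf mult_ac)
  also have "\<dots> = - (\<Sum>i\<in>UNIV. f (e i) * h (D i))"
    using lin_on_expand[OF h D] by (simp add: sum_distrib_left)
  finally show ?thesis by (simp add: sum.distrib)
qed

context su3_space
begin

lemma \<phi>_13: "x \<in> V \<Longrightarrow> y \<in> V \<Longrightarrow> \<phi> x y x = 0"
  using skew12[of x y x] skew23[of y x x] by simp

lemma \<phi>_23: "x \<in> V \<Longrightarrow> y \<in> V \<Longrightarrow> \<phi> x y y = 0"
  using skew23[of x y y] by simp

lemma \<phi>_12: "x \<in> V \<Longrightarrow> y \<in> V \<Longrightarrow> \<phi> x x y = 0"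
  using skew12[of x x y] by simp

lemma \<phi>_I_same: "x \<in> V \<Longrightarrow> y \<in> V \<Longrightarrow> \<phi> x y (I y) = 0"
  using \<phi>_I23[of x y y] skew23[of x "I y" y] by simp

lemma \<phi>_expand3: "x \<in> V \<Longrightarrow> y \<in> V \<Longrightarrow> z \<in> V \<Longrightarrow> (\<Sum>k\<in>UNIV. g z (e k) * \<phi> x y (e k)) = \<phi> x y z"
  using lin_on_expand[OF trilin_onD(3)[OF tri]] by simp

lemma \<phi>_expand2: "x \<in> V \<Longrightarrow> y \<in> V \<Longrightarrow> z \<in> V \<Longrightarrow> (\<Sum>k\<in>UNIV. g z (e k) * \<phi> x (e k) y) = \<phi> x z y"
  using lin_on_expand[OF trilin_onD(2)[OF tri]] by simp

text \<open>Pairing b wedge \<omega> with \<phi>(I., ., .). In each of the three terms the sum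
  against \<omega> leaves \<phi> with a repeated argument or with a pair y, Iy, and both
  vanish.\<close>

lemma wedge_\<omega>_contraction:
  "(\<Sum>i\<in>UNIV. \<Sum>j\<in>UNIV. \<Sum>k\<in>UNIV. (b (e i) * g (I (e j)) (e k) - b (e j) * g (I (e i)) (e k) + b (e k) * g (I (e i)) (e j))
     * \<phi> (I (e i)) (e j) (e k)) = 0"
proof -
  have 1: "(\<Sum>k\<in>UNIV. b (e i) * (g (I (e j)) (e k) * \<phi> (I (e i)) (e j) (e k))) = 0" for i j
    by (simp add: \<phi>_expand3 \<phi>_I_same flip: sum_distrib_left)
  have 2: "(\<Sum>k\<in>UNIV. b (e j) * (g (I (e i)) (e k) * \<phi> (I (e i)) (e j) (e k))) = 0" for i j
    by (simp add: \<phi>_expand3 \<phi>_13 flip: sum_distrib_left)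
  have 3: "(\<Sum>j\<in>UNIV. \<Sum>k\<in>UNIV. b (e k) * (g (I (e i)) (e j) * \<phi> (I (e i)) (e j) (e k))) = 0" for i
    by (subst sum.swap) (simp add: \<phi>_expand2 \<phi>_12 flip: sum_distrib_left)
  show ?thesis
    by (simp add: ring_distribs sum.distrib sum_subtractf sum_negf mult.assoc 1 2 3)
qed

text \<open>The metric terms and the term with \<open>I a\<close> collapse to \<phi> with a repeated
  argument or a pair y, Iy. In the cubic term \<open>\<phi>_contraction\<close> turns two factors
  into 4 times the metric, leaving \<phi>(a, e i, e i).\<close>

lemma contraction_normal_part:
  assumes a: "a \<in> V"
  shows "(\<Sum>i\<in>UNIV. \<Sum>j\<in>UNIV. \<Sum>k\<in>UNIV. (b (e j) * g (e i) (e k) - b (e k) * g (e i) (e j)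
     - ((\<Sum>l\<in>UNIV. \<phi> a (e i) (e l) * \<phi> (e j) (e k) (e l)) + g (I a) (e i) * g (I (e j)) (e k)))
     * \<phi> (e i) (e j) (e k)) = 0"
proof -
  have 1: "(\<Sum>k\<in>UNIV. b (e j) * (g (e i) (e k) * \<phi> (e i) (e j) (e k))) = 0" for i j
    by (simp add: \<phi>_expand3 \<phi>_13 flip: sum_distrib_left)
  have 2: "(\<Sum>j\<in>UNIV. \<Sum>k\<in>UNIV. b (e k) * (g (e i) (e j) * \<phi> (e i) (e j) (e k))) = 0" for i
    by (subst sum.swap) (simp add: \<phi>_expand2 \<phi>_12 flip: sum_distrib_left)
  have 3: "(\<Sum>k\<in>UNIV. g (I a) (e i) * (g (I (e j)) (e k) * \<phi> (e i) (e j) (e k))) = 0" for i j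
    by (simp add: \<phi>_expand3 \<phi>_I_same flip: sum_distrib_left)
  have p: "\<phi> (e j) (e k) (e l) = \<phi> (e l) (e j) (e k)" for j k l
    using skew12[of "e l" "e j" "e k"] skew23[of "e j" "e l" "e k"] by simp
  have s: "(\<Sum>j\<in>UNIV. \<Sum>k\<in>UNIV. \<Sum>l\<in>UNIV. \<phi> a (e i) (e l) * \<phi> (e j) (e k) (e l) * \<phi> (e i) (e j) (e k)) = 0" for i
  proof -
    have "(\<Sum>j\<in>UNIV. \<Sum>k\<in>UNIV. \<Sum>l\<in>UNIV. \<phi> a (e i) (e l) * \<phi> (e j) (e k) (e l) * \<phi> (e i) (e j) (e k))
      = (\<Sum>j\<in>UNIV. \<Sum>l\<in>UNIV. \<Sum>k\<in>UNIV. \<phi> a (e i) (e l) * \<phi> (e j) (e k) (e l) * \<phi> (e i) (e j) (e k))"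
      by (rule sum.cong[OF refl]) (rule sum.swap)
    also have "\<dots> = (\<Sum>j\<in>UNIV. \<Sum>l\<in>UNIV. \<Sum>k\<in>UNIV. \<phi> a (e i) (e l) * (\<phi> (e l) (e j) (e k) * \<phi> (e i) (e j) (e k)))"
      by (intro sum.cong refl) (metis p mult.assoc)
    also have "\<dots> = (\<Sum>l\<in>UNIV. \<Sum>j\<in>UNIV. \<Sum>k\<in>UNIV. \<phi> a (e i) (e l) * (\<phi> (e l) (e j) (e k) * \<phi> (e i) (e j) (e k)))"
      by (rule sum.swap)
    also have "\<dots> = (\<Sum>l\<in>UNIV. \<phi> a (e i) (e l) * (4 * g (e l) (e i)))"
      by (simp add: \<phi>_contraction flip: sum_distrib_left)
    also have "\<dots> = 4 * \<phi> a (e i) (e i)"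
      by (simp add: g_e if_distrib cong: if_cong)
    finally show ?thesis using a by (simp add: \<phi>_23)
  qed
  show ?thesis
    by (simp add: ring_distribs sum.distrib sum_subtractf sum_negf mult.assoc sum_distrib_right 1 2 3 s[unfolded mult.assoc])
qed

end

context g2_hypersurface
begin

lemma star_eq_contraction:
  assumes V: "x \<in> V q" "y \<in> V q" "z \<in> V q"
  shows "pull_normal_star H q x y z = - (\<Sum>k\<in>UNIV. \<Phi> q (n q) (J q x) (E q k) * \<Phi> q (J q y) (J q z) (E q k))"
proof -
  have "pull_normal_star H q x y z = - (\<Sum>i\<in>UNIV. wedge [G q (E q (i + 2)), G q (E q (i + 4)), G q (E q (i + 5)), G q (E q (i + 6))]
      [n q, J q x, J q y, J q z])"
    unfolding pull_normal_star_def star_form_def Let_def E_def ..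
  then show ?thesis
    using V by (simp add: hyp.star_eq normal_in J_in normal_orth)
qed

lemma pull_normal_star_eq:
  assumes "x \<in> V q" "y \<in> V q" "z \<in> V q"
  shows "pull_normal_star H q x y z = - pull_form H q (cplx H q x) y z"
  using hyp.\<Phi>_cx[of x q y z] assms by (simp add: star_eq_contraction pull_form_def cx_eq)

text \<open>The pointwise choice \<open>E\<close> need not vary smoothly. Freedom of frame is what
  permits differentiating with a smooth local one.\<close>

lemma pull_normal_star_frame:
  assumes V: "x \<in> V q" "y \<in> V q" "z \<in> V q"
    and e: "G2_frame (amb_atlas H) (amb_metric H) (amb_form H) (incl H q) e"
  shows "pull_normal_star H q x y z = - (\<Sum>k\<in>UNIV. \<Phi> q (n q) (J q x) (e k) * \<Phi> q (J q y) (J q z) (e k))"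
proof -
  have "orthonormal_basis (T q) (G q) e" using e unfolding G2_frame_def by blast
  from hyp.contraction_basis_independent[OF this trilin_onD(3)[OF hyp.tri normal_in J_in[OF V(1)]]
      trilin_onD(3)[OF hyp.tri J_in[OF V(2)] J_in[OF V(3)]]]
  show ?thesis unfolding star_eq_contraction[OF V] by simp
qed

lemma const_ext_push:
  "const_ext (atlas H) q y = coord_field (atlas H) (along.c q) (coord y (along.c q))"
  unfolding const_ext_def along.c_def ..

text \<open>Tangential parts of the derivatives cancel against the connection terms. Each normal
  part contributes a value of the second fundamental form times \<open>\<Phi>\<close> with n
  inserted, which is \<omega> up to sign.\<close>

lemma nabla_pull_form:
  assumes V: "x \<in> V q" "y \<in> V q" "z \<in> V q" "w \<in> V q"
  shows "nabla3 (atlas H) (ind_metric H) (pull_form H) q x y z w =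
    second_ff H q x y * ind_metric H q (cplx H q z) w - second_ff H q x z * ind_metric H q (cplx H q y) w
    + second_ff H q x w * ind_metric H q (cplx H q y) z"
proof -
  let ?c = "along.c q" and ?u = "coord x (along.c q)" and ?N = "\<lambda>y. levi_civita (atlas H) (ind_metric H) q x (const_ext (atlas H) q y)"
  have "\<forall>\<^sub>F a in nhds (snd ?c q). \<Phi> (chart_inv ?c a) (push q y (chart_inv ?c a)) (push q z (chart_inv ?c a)) (push q w (chart_inv ?c a))
      = pull_form H (chart_inv ?c a) (const_ext (atlas H) q y (chart_inv ?c a)) (const_ext (atlas H) q z (chart_inv ?c a))
          (const_ext (atlas H) q w (chart_inv ?c a))"
    by (rule always_eventually) (simp add: const_ext_push push_J pull_form_def)
  from along.dir_deriv_eq_base[OF V(1)[unfolded TM_def] has_derivative_cong_nhds[OF this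
      form_derivative[OF along.diff_field_push along.diff_field_push along.diff_field_push]]]
  have "dir_deriv (atlas H) q x (\<lambda>p'. pull_form H p' (const_ext (atlas H) q y p') (const_ext (atlas H) q z p') (const_ext (atlas H) q w p'))
    = \<Phi> q (along.D q (push q y) ?u) (J q z) (J q w) + \<Phi> q (J q y) (along.D q (push q z) ?u) (J q w)
      + \<Phi> q (J q y) (J q z) (along.D q (push q w) ?u)"
    using V by (simp add: push_at)
  moreover have "\<Phi> q (n q) (J q z) (J q w) = ind_metric H q (cplx H q z) w" if "z \<in> V q" "w \<in> V q" for z w
    using hyp.g_cx[of z q w] that by (simp add: gV_eq cx_eq)
  moreover have "\<Phi> q (J q y) (n q) (J q w) = - \<Phi> q (n q) (J q y) (J q w)"
    "\<Phi> q (J q y) (J q z) (n q) = \<Phi> q (n q) (J q y) (J q z)"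
    using V J_in normal_in hyp.skew12[of "J q y" q "n q" "J q w"] hyp.skew12[of "J q y" q "n q" "J q z"]
      hyp.skew23[of "J q y" q "J q z" "n q"] by simp_all
  ultimately show ?thesis
    using V gauss_formula[OF V(1)]
    by (simp add: nabla3_def pull_form_def \<Phi>_lin J_in normal_in hyp.in_V)
qed

lemma frame_along:
  obtains e :: "7 \<Rightarrow> 'q \<Rightarrow> ('m, 7) tvec" where "\<And>k. along.diff_field q (e k)"
    "\<forall>\<^sub>F q' in nhds q. G2_frame (amb_atlas H) (amb_metric H) (amb_form H) (incl H q') (\<lambda>k. e k q')"
proof -
  obtain U e where U: "open U" "incl H q \<in> U" and e: "\<And>i. smooth_vector_field (amb_atlas H) U (e i)"
    and fr: "\<And>p. p \<in> U \<Longrightarrow> G2_frame (amb_atlas H) (amb_metric H) (amb_form H) p (\<lambda>i. e i p)"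
    using G2 unfolding G2_structure_def by blast
  have "open (incl H -` U)" using smooth_incl U unfolding smooth_map_def by (simp add: continuous_on_open_vimage)
  then have near: "\<forall>\<^sub>F q' in nhds q. incl H q' \<in> U"
    using U eventually_nhds_in_open[of "incl H -` U" q] by simp
  have "along.diff_field q (\<lambda>q'. e k (incl H q'))" for k
  proof -
    let ?d = "along.d q" and ?c = "along.c q"
    have s: "smooth_on (snd ?d ` (fst ?d \<inter> U)) (\<lambda>b. coord (e k (chart_inv ?d b)) ?d)"
      using e along.Dd(1) unfolding smooth_vector_field_def by blast
    have i: "snd ?d (incl H q) \<in> snd ?d ` (fst ?d \<inter> U)" using U along.Dd by blast
    have "((\<lambda>b. coord (e k (chart_inv ?d b)) ?d) has_derivative
        frechet_derivative (\<lambda>b. coord (e k (chart_inv ?d b)) ?d) (at (along.F q (snd ?c q)))) (at (along.F q (snd ?c q)))"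
      using smooth_on_has_derivative[OF s i] by simp
    from has_derivative_compose[OF along.F_derivative this]
    have D: "((\<lambda>a. coord (e k (chart_inv ?d (along.F q a))) ?d) has_derivative
      (\<lambda>h. frechet_derivative (\<lambda>b. coord (e k (chart_inv ?d b)) ?d) (at (along.F q (snd ?c q))) (along.F' q h))) (at (snd ?c q))" .
    have "\<forall>\<^sub>F a in nhds (snd ?c q). coord (e k (chart_inv ?d (along.F q a))) ?d = along.comps q (\<lambda>q'. e k (incl H q')) a"
      using along.near by eventually_elim (simp add: along.comps_def)
    from has_derivative_cong_nhds[OF this D]
    have "along.comps q (\<lambda>q'. e k (incl H q')) differentiable (at (snd ?c q))"
      unfolding differentiable_def by blast
    moreover have "\<forall>\<^sub>F q' in nhds q. e k (incl H q') \<in> T q'"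
      using near by eventually_elim (use e in \<open>auto simp: smooth_vector_field_def\<close>)
    ultimately show ?thesis unfolding along.diff_field_def by blast
  qed
  moreover have "\<forall>\<^sub>F q' in nhds q. G2_frame (amb_atlas H) (amb_metric H) (amb_form H) (incl H q') (\<lambda>k. e k (incl H q'))"
    using near by eventually_elim (rule fr)
  ultimately show thesis by (rule that)
qed

lemma frame_D_skew:
  assumes e: "\<And>k. along.diff_field q (e k)"
    and fr: "\<forall>\<^sub>F q' in nhds q. G2_frame (amb_atlas H) (amb_metric H) (amb_form H) (incl H q') (\<lambda>k. e k q')"
  shows "G q (along.D q (e i) u) (e j q) = - G q (along.D q (e j) u) (e i q)"
proof -
  let ?c = "along.c q"
  have ev: "\<forall>\<^sub>F a in nhds (snd ?c q). G (chart_inv ?c a) (e i (chart_inv ?c a)) (e j (chart_inv ?c a)) = (if i = j then 1 else 0)"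
    using eventually_chart_inv[OF along.C(3,2) fr]
    by eventually_elim (simp add: G2_frame_def orthonormal_basis_def)
  have "(\<lambda>u. G q (along.D q (e i) u) (e j q) + G q (e i q) (along.D q (e j) u)) = (\<lambda>u. 0)"
    by (rule has_derivative_unique[OF has_derivative_cong_nhds[OF ev along.g_derivative[OF e e]]]) simp
  from fun_cong[OF this, of u] show ?thesis
    using hyp.sym[of "e i q" q "along.D q (e j) u"] along.diff_field_base[OF e] by simp
qed

text \<open>The right side is *\<phi> evaluated on J(shape x), Jy, Jz, Jw, rewritten by
  \<open>star_eq\<close> in terms of the hypersurface. That no other term appears reflects the
  parallelism of *\<phi>, which is used only through that of \<phi>.\<close>

lemma nabla_star:
  assumes V: "x \<in> V q" "y \<in> V q" "z \<in> V q" "w \<in> V q"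
  shows "nabla3 (atlas H) (ind_metric H) (\<lambda>q x y z. - pull_normal_star H q x y z) q x y z w =
    second_ff H q x z * ind_metric H q y w - second_ff H q x w * ind_metric H q y z
    - ((\<Sum>l\<in>UNIV. pull_form H q (shape q x) y (onb (V q) (ind_metric H q) l) * pull_form H q z w (onb (V q) (ind_metric H q) l))
      + ind_metric H q (cplx H q (shape q x)) y * ind_metric H q (cplx H q z) w)"
proof -
  let ?c = "along.c q" and ?u = "coord x (along.c q)" and ?N = "\<lambda>y. levi_civita (atlas H) (ind_metric H) q x (const_ext (atlas H) q y)"
  let ?\<psi> = "\<lambda>q x y z. - pull_normal_star H q x y z"
  obtain e where e: "\<And>k. along.diff_field q (e k)"
    and fr: "\<forall>\<^sub>F q' in nhds q. G2_frame (amb_atlas H) (amb_metric H) (amb_form H) (incl H q') (\<lambda>k. e k q')"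
    using frame_along[of q] by blast
  have fr0: "G2_frame (amb_atlas H) (amb_metric H) (amb_form H) (incl H q) (\<lambda>k. e k q)"
    using eventually_nhds_x_imp_x[OF fr] .
  interpret g2: g2_space "T q" "G q" "\<lambda>k. e k q" "\<Phi> q" by (rule g2_space_frame[OF fr0])
  have e_in: "e k q \<in> T q" for k by (rule g2.e_in)
  let ?Y = "push q y" and ?Z = "push q z" and ?W = "push q w"
  let ?DY = "along.D q ?Y ?u" and ?DZ = "along.D q ?Z ?u" and ?DW = "along.D q ?W ?u" and ?Dn = "along.D q n ?u"
    and ?De = "\<lambda>k. along.D q (e k) ?u"
  let ?f = "\<lambda>k p. \<Phi> p (n p) (?Y p) (e k p)" and ?h = "\<lambda>k p. \<Phi> p (?Z p) (?W p) (e k p)"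
  have cf: "coord_field (atlas H) ?c v (chart_inv ?c a) \<in> V (chart_inv ?c a)"
    if "?c \<in> charts_at (atlas H) (chart_inv ?c a)" for v a
    unfolding TM_def by (rule coord_field_in_tangent_space[OF A that])
  have ev: "\<forall>\<^sub>F a in nhds (snd ?c q). (\<Sum>k\<in>UNIV. ?f k (chart_inv ?c a) * ?h k (chart_inv ?c a))
      = ?\<psi> (chart_inv ?c a) (const_ext (atlas H) q y (chart_inv ?c a)) (const_ext (atlas H) q z (chart_inv ?c a))
          (const_ext (atlas H) q w (chart_inv ?c a))"
    using along.near[of q] eventually_chart_inv[OF along.C(3,2) fr]
    by eventually_elim (simp add: const_ext_push push_J pull_normal_star_frame cf)
  have "((\<lambda>a. \<Sum>k\<in>UNIV. ?f k (chart_inv ?c a) * ?h k (chart_inv ?c a)) has_derivative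
     (\<lambda>u. \<Sum>k\<in>UNIV. ?f k q * (\<Phi> q (along.D q ?Z u) (?W q) (e k q) + \<Phi> q (?Z q) (along.D q ?W u) (e k q) + \<Phi> q (?Z q) (?W q) (along.D q (e k) u))
       + (\<Phi> q (along.D q n u) (?Y q) (e k q) + \<Phi> q (n q) (along.D q ?Y u) (e k q) + \<Phi> q (n q) (?Y q) (along.D q (e k) u)) * ?h k q))
     (at (snd ?c q))"
    using has_derivative_mult[OF form_derivative[OF diff_field_normal along.diff_field_push e]
        form_derivative[OF along.diff_field_push along.diff_field_push e]]
    by (intro has_derivative_sum) simp
  from along.dir_deriv_eq_base[OF V(1)[unfolded TM_def] has_derivative_cong_nhds[OF ev this]]
  have 1: "dir_deriv (atlas H) q x (\<lambda>p'. ?\<psi> p' (const_ext (atlas H) q y p') (const_ext (atlas H) q z p') (const_ext (atlas H) q w p'))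
    = (\<Sum>k\<in>UNIV. \<Phi> q (n q) (J q y) (e k q) * (\<Phi> q ?DZ (J q w) (e k q) + \<Phi> q (J q z) ?DW (e k q) + \<Phi> q (J q z) (J q w) (?De k))
       + (\<Phi> q ?Dn (J q y) (e k q) + \<Phi> q (n q) ?DY (e k q) + \<Phi> q (n q) (J q y) (?De k)) * \<Phi> q (J q z) (J q w) (e k q))"
    using V by (simp add: push_at)
  \<comment> \<open>The terms that differentiate the frame itself.\<close>
  have skew: "(\<Sum>k\<in>UNIV. \<Phi> q (n q) (J q y) (?De k) * \<Phi> q (J q z) (J q w) (e k q) + \<Phi> q (n q) (J q y) (e k q) * \<Phi> q (J q z) (J q w) (?De k)) = 0"
    by (rule g2.sum_skew_derivation[OF along.D_in frame_D_skew[OF e fr]])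
      (intro trilin_onD(3)[OF hyp.tri] normal_in J_in V)+
  \<comment> \<open>Connection terms by the Gauss formula. The first has no correction, since its
    normal part stands next to n; the sign in the third comes from exchanging n with Jz.\<close>
  have N: "?\<psi> q (?N y) z w = (\<Sum>k\<in>UNIV. \<Phi> q (n q) ?DY (e k q) * \<Phi> q (J q z) (J q w) (e k q))"
    "?\<psi> q y (?N z) w = (\<Sum>k\<in>UNIV. \<Phi> q (n q) (J q y) (e k q) * (\<Phi> q ?DZ (J q w) (e k q) - second_ff H q x z * \<Phi> q (n q) (J q w) (e k q)))"
    "?\<psi> q y z (?N w) = (\<Sum>k\<in>UNIV. \<Phi> q (n q) (J q y) (e k q) * (\<Phi> q (J q z) ?DW (e k q) + second_ff H q x w * \<Phi> q (n q) (J q z) (e k q)))"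
    using V gauss_formula[OF V(1)]
    by (simp_all add: pull_normal_star_frame[OF _ _ _ fr0] \<Phi>_lin J_in normal_in hyp.in_V e_in hyp.\<phi>_same
        hyp.skew12[of "J q z" q "n q"])
  have nn: "(\<Sum>k\<in>UNIV. \<Phi> q (n q) (J q y) (e k q) * \<Phi> q (n q) (J q w) (e k q)) = ind_metric H q y w" if "w \<in> V q" for w
    using V that by (simp add: g2.\<phi>_norm normal_in J_in normal_unit normal_orth ind_metric_def)
  have K: "(\<Sum>k\<in>UNIV. \<Phi> q ?Dn (J q y) (e k q) * \<Phi> q (J q z) (J q w) (e k q))
     = - (\<Sum>k\<in>UNIV. \<Phi> q (J q (shape q x)) (J q y) (e k q) * \<Phi> q (J q z) (J q w) (e k q))"
    using V by (simp add: shape \<Phi>_lin J_in e_in sum_negf)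
  have K': "(\<Sum>k\<in>UNIV. \<Phi> q (J q (shape q x)) (J q y) (e k q) * \<Phi> q (J q z) (J q w) (e k q))
    = (\<Sum>k\<in>UNIV. \<Phi> q (J q (shape q x)) (J q y) (E q k) * \<Phi> q (J q z) (J q w) (E q k))"
    by (intro hyp.contraction_basis_independent g2.onb trilin_onD(3)[OF hyp.tri] J_in shape V)
  have m: "\<Phi> q (J q a) (J q b) (n q) = ind_metric H q (cplx H q a) b" if "a \<in> V q" "b \<in> V q" for a b
    using hyp.g_cx[of a q b] that hyp.skew23[of "J q a" q "J q b" "n q"] hyp.skew12[of "J q a" q "n q" "J q b"]
    by (simp add: gV_eq cx_eq J_in normal_in)
  \<comment> \<open>Passing from the ambient contraction to a basis of \<open>V\<close> splits off
    the normal direction, whose product is the term with \<open>cplx\<close>.\<close>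
  have K'': "(\<Sum>k\<in>UNIV. \<Phi> q (J q (shape q x)) (J q y) (E q k) * \<Phi> q (J q z) (J q w) (E q k))
    = (\<Sum>l\<in>UNIV. pull_form H q (shape q x) y (onb (V q) (ind_metric H q) l) * pull_form H q z w (onb (V q) (ind_metric H q) l))
      + ind_metric H q (cplx H q (shape q x)) y * ind_metric H q (cplx H q z) w"
    using hyp.contraction_V[of "J q (shape q x)" q "J q y" "J q z" "J q w"] V shape(1)[of q x]
    by (simp add: J_in m pull_form_def)
  let ?S = "\<lambda>t. \<Sum>k\<in>UNIV. t k"
  have "nabla3 (atlas H) (ind_metric H) ?\<psi> q x y z w =
      ?S (\<lambda>k. \<Phi> q ?Dn (J q y) (e k q) * \<Phi> q (J q z) (J q w) (e k q))
    + ?S (\<lambda>k. \<Phi> q (n q) (J q y) (?De k) * \<Phi> q (J q z) (J q w) (e k q) + \<Phi> q (n q) (J q y) (e k q) * \<Phi> q (J q z) (J q w) (?De k))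
    + second_ff H q x z * ?S (\<lambda>k. \<Phi> q (n q) (J q y) (e k q) * \<Phi> q (n q) (J q w) (e k q))
    - second_ff H q x w * ?S (\<lambda>k. \<Phi> q (n q) (J q y) (e k q) * \<Phi> q (n q) (J q z) (e k q))"
    unfolding nabla3_def 1 N sum_distrib_left sum.distrib[symmetric] sum_subtractf[symmetric]
    by (intro sum.cong refl) (simp add: algebra_simps)
  then show ?thesis unfolding skew nn[OF V(4)] nn[OF V(3)] K K' K'' by simp
qed

lemma eta_zero:
  assumes \<theta>: "\<theta> = 0 \<or> \<theta> = pi / 2" and x: "x \<in> V q"
  shows "eta H \<theta> q x = 0"
proof -
  let ?e = "onb (V q) (ind_metric H q)"
  have cx: "cplx H q x \<in> V q" using x by simp
  show ?thesis
  proof (cases "\<theta> = 0")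
    case True
    have p: "psi_plus H \<theta> = pull_form H" "psi_minus H \<theta> = pull_normal_star H"
      by (auto simp: psi_plus_def psi_minus_def True fun_eq_iff)
    have "inner_3form (V q) (ind_metric H q) (nabla3 (atlas H) (ind_metric H) (psi_plus H \<theta>) q (cplx H q x)) (psi_minus H \<theta> q)
      = - (1 / fact 3) * (\<Sum>i\<in>UNIV. \<Sum>j\<in>UNIV. \<Sum>k\<in>UNIV.
        (second_ff H q (cplx H q x) (?e i) * ind_metric H q (cplx H q (?e j)) (?e k)
          - second_ff H q (cplx H q x) (?e j) * ind_metric H q (cplx H q (?e i)) (?e k)
          + second_ff H q (cplx H q x) (?e k) * ind_metric H q (cplx H q (?e i)) (?e j))
        * pull_form H q (cplx H q (?e i)) (?e j) (?e k))"
      unfolding inner_3form_def p using cx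
      by (simp add: nabla_pull_form pull_normal_star_eq sum_negf)
    then show ?thesis unfolding eta_def su3.wedge_\<omega>_contraction by simp
  next
    case False
    then have "\<theta> = pi / 2" using \<theta> by simp
    then have p: "psi_plus H \<theta> = (\<lambda>q x y z. - pull_normal_star H q x y z)" "psi_minus H \<theta> = pull_form H"
      by (simp_all only: psi_plus_def psi_minus_def fun_eq_iff cos_pi_half sin_pi_half) simp_all
    have "inner_3form (V q) (ind_metric H q) (nabla3 (atlas H) (ind_metric H) (psi_plus H \<theta>) q (cplx H q x)) (psi_minus H \<theta> q) = 0"
      unfolding inner_3form_def p
      using su3.contraction_normal_part[OF shape(1)[of q "cplx H q x"], where b = "second_ff H q (cplx H q x)"]
      by (simp add: nabla_star[OF cx])
    then show ?thesis unfolding eta_def by simp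
  qed
qed

section \<open>The types of the induced \<open>SU(3)\<close>-structures\<close>

definition torsion_of :: "'q \<Rightarrow> (('q, 6) tvec \<Rightarrow> ('q, 6) tvec) \<Rightarrow> ('q, 6) tvec \<Rightarrow> ('q, 6) tvec \<Rightarrow> ('q, 6) tvec \<Rightarrow> real" where
  "torsion_of q B x y z = pull_form H q (B x) y z"

lemma mean_h_eq: "mean_h H q = su3.trace_op q (shape q) / 6"
  unfolding mean_h_def trace_form_def su3.trace_op_def by (simp add: ind_metric_shape)

lemma torsion_of_GH:
  assumes B: "su3.selfadjoint q B"
  shows "torsion_of q B \<in> GH_space H q"
  unfolding GH_space_def torsion_of_def
  by (intro CollectI conjI ballI su3.trilin_on_\<phi>_op[OF B] su3.skew23 su3.\<phi>_type su3.selfadjoint_in[OF B])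

text \<open>The constants cancel: 1/2 from \<open>r_map\<close>, 1/2! from the product of two-forms,
  and 4 from \<open>\<phi>_contraction\<close>. For \<theta> = pi / 2 the form
  \<open>psi_plus\<close> is \<phi>(I., ., .), which puts \<open>cplx\<close> on the second
  argument.\<close>

lemma r_map_torsion_of:
  assumes B: "su3.selfadjoint q B" and V: "x \<in> V q" "y \<in> V q"
  shows "r_map H 0 q (torsion_of q B) x y = ind_metric H q (B x) y"
    "r_map H (pi / 2) q (torsion_of q B) x y = ind_metric H q (B x) (cplx H q y)"
  using B V
  by (simp_all add: r_map_def inner_2form_def torsion_of_def psi_plus_def pull_normal_star_eq su3.\<phi>_contraction)

text \<open>A self-adjoint operator commuting with \<open>I\<close> stays symmetric when paired as
  <Bx, y> and becomes skew when paired as <Bx, Iy>.\<close>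

lemma r_parity_torsion_of:
  assumes \<theta>: "\<theta> = 0 \<and> \<epsilon> = Plus \<or> \<theta> = pi / 2 \<and> \<epsilon> = Minus"
    and B: "su3.selfadjoint q B" and comm: "\<And>x. x \<in> V q \<Longrightarrow> B (cplx H q x) = cplx H q (B x)"
  shows "r_parity H \<theta> q \<epsilon> (torsion_of q B)"
proof -
  have 1: "ind_metric H q (B y) x = ind_metric H q (B x) y" if "x \<in> V q" "y \<in> V q" for x y
    using su3.selfadjoint_sym[OF B] that by blast
  have 2: "ind_metric H q (B y) (cplx H q x) = - ind_metric H q (B x) (cplx H q y)" if "x \<in> V q" "y \<in> V q" for x y
    using that B su3.selfadjoint_sym[OF B, of y "cplx H q x"] by (simp add: comm su3.g_I_left)
  show ?thesis
    using \<theta>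
  proof
    assume "\<theta> = 0 \<and> \<epsilon> = Plus"
    then have t: "\<theta> = 0" "\<epsilon> = Plus" by auto
    show ?thesis
      unfolding r_parity_def t
    proof (intro ballI)
      fix x y assume V: "x \<in> V q" "y \<in> V q"
      show "r_map H 0 q (torsion_of q B) y x = (case Plus of Plus \<Rightarrow> r_map H 0 q (torsion_of q B) x y
          | Minus \<Rightarrow> - r_map H 0 q (torsion_of q B) x y)"
        using 1[OF V] V by (simp add: r_map_torsion_of[OF B])
    qed
  next
    assume "\<theta> = pi / 2 \<and> \<epsilon> = Minus"
    then have t: "\<theta> = pi / 2" "\<epsilon> = Minus" by auto
    show ?thesis
      unfolding r_parity_def t
    proof (intro ballI)
      fix x y assume V: "x \<in> V q" "y \<in> V q"
      show "r_map H (pi / 2) q (torsion_of q B) y x = (case Minus of Plus \<Rightarrow> r_map H (pi / 2) q (torsion_of q B) x y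
          | Minus \<Rightarrow> - r_map H (pi / 2) q (torsion_of q B) x y)"
        using 2[OF V] V by (simp add: r_map_torsion_of[OF B])
    qed
  qed
qed

lemma torsion_of_zero: "y \<in> V q \<Longrightarrow> z \<in> V q \<Longrightarrow> torsion_of q (\<lambda>_. 0) x y z = 0"
  by (simp add: torsion_of_def su3.\<phi>_1)

text \<open>Supplies the components in the classes of opposite sign and in
  \<open>W4\<close>.\<close>

lemma torsion_of_zero_W_space:
  assumes "w \<in> GH_classes"
  shows "torsion_of q (\<lambda>_. 0) \<in> W_space H \<theta> q w"
proof -
  have sa: "su3.selfadjoint q (\<lambda>_. 0)" unfolding su3.selfadjoint_def by (simp add: su3.in_zero)
  have r: "r_parity H \<theta> q s (torsion_of q (\<lambda>_. 0))" for s
    by (simp add: r_parity_def r_map_def inner_2form_def torsion_of_zero split: pm.split)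
  have "lin_on (V q) (\<lambda>_. 0)" by (simp add: lin_on_def)
  then have "W_condition H \<theta> q W4 (torsion_of q (\<lambda>_. 0))"
    by (auto simp: torsion_of_zero intro!: exI[of _ "\<lambda>_. 0"])
  then show ?thesis
    using assms torsion_of_GH[OF sa] r unfolding W_space_def GH_classes_def
    by (auto simp: torsion_of_zero trace_form_def)
qed

lemma torsion_of_homothety_W1:
  assumes \<theta>: "\<theta> = 0 \<and> \<epsilon> = Plus \<or> \<theta> = pi / 2 \<and> \<epsilon> = Minus"
  shows "torsion_of q (\<lambda>x. r *\<^sub>R x) \<in> W_space H \<theta> q (W1 \<epsilon>)"
proof -
  have sa: "su3.selfadjoint q (\<lambda>x. r *\<^sub>R x)" unfolding su3.selfadjoint_def by (simp add: su3.in_V)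
  have skew: "torsion_of q (\<lambda>x. r *\<^sub>R x) x y z = - torsion_of q (\<lambda>x. r *\<^sub>R x) y x z
      \<and> torsion_of q (\<lambda>x. r *\<^sub>R x) x y z = - torsion_of q (\<lambda>x. r *\<^sub>R x) x z y"
    if "x \<in> V q" "y \<in> V q" "z \<in> V q" for x y z
    using that su3.skew12[of x q y z] su3.skew23[of x q y z] by (simp add: torsion_of_def su3.\<phi>_1)
  have "r_parity H \<theta> q \<epsilon> (torsion_of q (\<lambda>x. r *\<^sub>R x))"
    by (rule r_parity_torsion_of[OF \<theta> sa]) (simp add: su3.I_simps)
  then show ?thesis
    unfolding W_space_def W_condition.simps using torsion_of_GH[OF sa] skew by blast
qed

lemma torsion_of_tracefree_W2:
  assumes \<theta>: "\<theta> = 0 \<and> \<epsilon> = Plus \<or> \<theta> = pi / 2 \<and> \<epsilon> = Minus" and B: "su3.selfadjoint q B"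
  shows "torsion_of q (su3.tracefree_part q B) \<in> W_space H \<theta> q (W2 \<epsilon>)"
proof -
  note sa = su3.selfadjoint_parts(3)[OF B]
  have "r_parity H \<theta> q \<epsilon> (torsion_of q (su3.tracefree_part q B))"
    by (rule r_parity_torsion_of[OF \<theta> sa su3.tracefree_part_I[OF B]])
  then show ?thesis
    unfolding W_space_def W_condition.simps
    using torsion_of_GH[OF sa] su3.\<phi>_tracefree_cyclic[OF B, folded torsion_of_def] by blast
qed

lemma torsion_of_antilinear_W3:
  assumes B: "su3.selfadjoint q B"
  shows "torsion_of q (su3.antilinear_part q B) \<in> W_space H \<theta> q W3"
proof -
  note sa = su3.selfadjoint_parts(2)[OF B]
  show ?thesis
    unfolding W_space_def W_condition.simps trace_form_def
    using torsion_of_GH[OF sa] su3.\<phi>_antilinear_I[OF B, folded torsion_of_def]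
      su3.selfadjoint_trace_\<phi>[OF sa, folded torsion_of_def] by blast
qed

lemma sum_GH_classes:
  "(\<Sum>w\<in>GH_classes. f w) = f (W1 Plus) + f (W1 Minus) + f (W2 Plus) + f (W2 Minus) + f W3 + (f W4 :: real)"
  by (simp add: GH_classes_def)

lemma su3_typeI:
  assumes \<theta>: "\<theta> = 0 \<and> \<epsilon> = Plus \<or> \<theta> = pi / 2 \<and> \<epsilon> = Minus"
    and 1: "W1 \<epsilon> \<in> U \<or> (\<forall>q. mean_h H q = 0)"
    and 2: "W2 \<epsilon> \<in> U \<or> (\<forall>q. \<forall>x\<in>V q. su3.tracefree_part q (shape q) x = 0)"
    and 3: "W3 \<in> U \<or> (\<forall>q. \<forall>x\<in>V q. su3.antilinear_part q (shape q) x = 0)"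
  shows "su3_type H \<theta> U"
proof -
  \<comment> \<open>Operators whose torsions serve as the components; \<open>mean_h\<close> is one
    sixth of the trace, so the three nonzero entries add up to the shape operator.\<close>
  define B where "B q w = (if w = W1 \<epsilon> then (\<lambda>x. mean_h H q *\<^sub>R x) else if w = W2 \<epsilon> then su3.tracefree_part q (shape q)
      else if w = W3 then su3.antilinear_part q (shape q) else (\<lambda>_. 0))" for q w
  note sa = selfadjoint_shape
  have W: "torsion_of q (B q w) \<in> W_space H \<theta> q w" if "w \<in> GH_classes" for q w
    unfolding B_def using torsion_of_homothety_W1[OF \<theta>] torsion_of_tracefree_W2[OF \<theta> sa] torsion_of_antilinear_W3[OF sa]
      torsion_of_zero_W_space[OF that] by auto
  have zero: "torsion_of q (B q w) x y z = 0" if "w \<notin> U" "x \<in> V q" "y \<in> V q" "z \<in> V q" for q w x y z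
    using 1 2 3 that by (auto simp: B_def torsion_of_def su3.\<phi>_1)
  have sum: "nabla_omega H q x y z = (\<Sum>w\<in>GH_classes. torsion_of q (B q w) x y z)"
    if V: "x \<in> V q" "y \<in> V q" "z \<in> V q" for q x y z
  proof -
    have "(\<Sum>w\<in>GH_classes. torsion_of q (B q w) x y z) = torsion_of q (B q (W1 \<epsilon>)) x y z + torsion_of q (B q (W2 \<epsilon>)) x y z
        + torsion_of q (B q W3) x y z"
      unfolding sum_GH_classes using V by (cases \<epsilon>) (simp_all add: B_def torsion_of_zero)
    also have "\<dots> = pull_form H q (mean_h H q *\<^sub>R x + su3.tracefree_part q (shape q) x + su3.antilinear_part q (shape q) x) y z"
      using V by (simp add: B_def torsion_of_def su3.\<phi>_1 su3.in_V sa)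
    also have "\<dots> = pull_form H q (shape q x) y z"
      unfolding mean_h_eq su3.parts_sum[OF sa V(1), symmetric] ..
    finally show ?thesis using V by (simp add: nabla_omega_eq)
  qed
  have eta: "eta H \<theta> q x = 0" if "x \<in> V q" for q x
    using \<theta> that by (intro eta_zero) auto
  show ?thesis
    unfolding su3_type_def
  proof (intro conjI allI impI ballI)
    fix q
    show "\<exists>\<beta>. (\<forall>w\<in>GH_classes. \<beta> w \<in> W_space H \<theta> q w) \<and> (\<forall>x\<in>V q. \<forall>y\<in>V q. \<forall>z\<in>V q.
        nabla_omega H q x y z = (\<Sum>w\<in>GH_classes. \<beta> w x y z) \<and> (\<forall>w\<in>GH_classes - U. \<beta> w x y z = 0))"
      by (rule exI[of _ "\<lambda>w. torsion_of q (B q w)"]) (use W zero sum in auto)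
  qed (rule eta)
qed

text \<open>The given components need not be the ones constructed from the shape operator.
  \<open>parts_of_components\<close> shows that the first two together belong to its complex part
  and the third to its antilinear part. Without \<open>W1\<close> the complex part satisfies the
  cyclic identity, without \<open>W2\<close> it is skew, without \<open>W3\<close> the antilinear
  torsion is zero.\<close>

lemma su3_typeD:
  assumes t: "su3_type H \<theta> U" and U: "U \<subseteq> {W1 \<epsilon>, W2 \<epsilon>, W3}"
  shows "W1 \<epsilon> \<notin> U \<Longrightarrow> mean_h H q = 0"
    and "W2 \<epsilon> \<notin> U \<Longrightarrow> x \<in> V q \<Longrightarrow> su3.tracefree_part q (shape q) x = 0"
    and "W3 \<notin> U \<Longrightarrow> x \<in> V q \<Longrightarrow> su3.antilinear_part q (shape q) x = 0"
proof -
  note sa = selfadjoint_shape[of q]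
  obtain \<beta> where b: "(\<forall>w\<in>GH_classes. \<beta> w \<in> W_space H \<theta> q w) \<and> (\<forall>x\<in>V q. \<forall>y\<in>V q. \<forall>z\<in>V q.
      nabla_omega H q x y z = (\<Sum>w\<in>GH_classes. \<beta> w x y z) \<and> (\<forall>w\<in>GH_classes - U. \<beta> w x y z = 0))"
    using spec[OF conjunct1[OF t[unfolded su3_type_def]], of q] by (rule exE)
  have \<beta>: "\<beta> w \<in> W_space H \<theta> q w" if "w \<in> GH_classes" for w
    using b that by (elim conjE bspec)
  have *: "nabla_omega H q x y z = (\<Sum>w\<in>GH_classes. \<beta> w x y z) \<and> (\<forall>w\<in>GH_classes - U. \<beta> w x y z = 0)"
    if "x \<in> V q" "y \<in> V q" "z \<in> V q" for x y z
    by (rule bspec[OF bspec[OF bspec[OF conjunct2[OF b] that(1)] that(2)] that(3)])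
  have sum: "nabla_omega H q x y z = (\<Sum>w\<in>GH_classes. \<beta> w x y z)"
    if "x \<in> V q" "y \<in> V q" "z \<in> V q" for x y z
    using *[OF that] by (rule conjunct1)
  have zero: "\<beta> w x y z = 0" if "x \<in> V q" "y \<in> V q" "z \<in> V q" "w \<in> GH_classes - U" for x y z w
    by (rule bspec[OF conjunct2[OF *[OF that(1-3)]] that(4)])
  have W: "W1 \<epsilon> \<in> GH_classes" "W2 \<epsilon> \<in> GH_classes" "W3 \<in> GH_classes"
    unfolding GH_classes_def by (cases \<epsilon>; simp)+
  have GH: "trilin_on (V q) (\<beta> w)" "x \<in> V q \<Longrightarrow> y \<in> V q \<Longrightarrow> z \<in> V q \<Longrightarrow>
      \<beta> w x y z = - \<beta> w x z y \<and> \<beta> w x y z = - \<beta> w x (cplx H q y) (cplx H q z)" if "w \<in> GH_classes" for w x y z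
    using \<beta>[OF that] unfolding W_space_def GH_space_def by blast+
  have W1: "\<beta> (W1 \<epsilon>) x y z = - \<beta> (W1 \<epsilon>) y x z \<and> \<beta> (W1 \<epsilon>) x y z = - \<beta> (W1 \<epsilon>) x z y"
    if "x \<in> V q" "y \<in> V q" "z \<in> V q" for x y z
    using \<beta>[OF W(1)] that unfolding W_space_def W_condition.simps by blast
  have W2: "\<beta> (W2 \<epsilon>) x y z + \<beta> (W2 \<epsilon>) y z x + \<beta> (W2 \<epsilon>) z x y = 0" if "x \<in> V q" "y \<in> V q" "z \<in> V q" for x y z
    using \<beta>[OF W(2)] that unfolding W_space_def W_condition.simps by blast
  have W3: "\<beta> W3 (cplx H q x) (cplx H q y) z = \<beta> W3 x y z" if "x \<in> V q" "y \<in> V q" "z \<in> V q" for x y z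
    using \<beta>[OF W(3)] that unfolding W_space_def W_condition.simps by blast
  have eq: "pull_form H q (shape q x) y z = \<beta> (W1 \<epsilon>) x y z + \<beta> (W2 \<epsilon>) x y z + \<beta> W3 x y z"
    if "x \<in> V q" "y \<in> V q" "z \<in> V q" for x y z
  proof -
    \<comment> \<open>The opposite signs and \<open>W4\<close> lie outside \<open>U\<close>, so
      their components vanish by the definition of the type.\<close>
    have o: "\<beta> w x y z = 0" if "w \<in> GH_classes" "w \<noteq> W1 \<epsilon>" "w \<noteq> W2 \<epsilon>" "w \<noteq> W3" for w
      using that U \<open>x \<in> V q\<close> \<open>y \<in> V q\<close> \<open>z \<in> V q\<close> by (intro zero) auto
    then show ?thesis
      using sum[OF that] nabla_omega_eq[OF that] o[of "W1 Plus"] o[of "W1 Minus"] o[of "W2 Plus"] o[of "W2 Minus"] o[of W4]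
      unfolding sum_GH_classes by (cases \<epsilon>) (auto simp: GH_classes_def)
  qed
  have parts: "pull_form H q (su3.complex_part q (shape q) x) y z = \<beta> (W1 \<epsilon>) x y z + \<beta> (W2 \<epsilon>) x y z"
    "pull_form H q (su3.antilinear_part q (shape q) x) y z = \<beta> W3 x y z"
    if "x \<in> V q" "y \<in> V q" "z \<in> V q" for x y z
  proof -
    have ty: "\<beta>' x y z = - \<beta>' x z y \<and> \<beta>' x y z = - \<beta>' x (cplx H q y) (cplx H q z)"
      if "\<beta>' \<in> {\<beta> (W1 \<epsilon>), \<beta> (W2 \<epsilon>)}" "x \<in> V q" "y \<in> V q" "z \<in> V q" for \<beta>' x y z
      using that GH(2)[OF W(1)] GH(2)[OF W(2)] by blast
    show "pull_form H q (su3.complex_part q (shape q) x) y z = \<beta> (W1 \<epsilon>) x y z + \<beta> (W2 \<epsilon>) x y z"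
      by (rule su3.parts_of_components(1)[where \<beta>\<^sub>1 = "\<beta> (W1 \<epsilon>)" and \<beta>\<^sub>2 = "\<beta> (W2 \<epsilon>)" and \<beta>\<^sub>3 = "\<beta> W3", OF sa GH(1)[OF W(2)]])
        (assumption | rule ty W1 W2 W3 eq that)+
    show "pull_form H q (su3.antilinear_part q (shape q) x) y z = \<beta> W3 x y z"
      by (rule su3.parts_of_components(2)[where \<beta>\<^sub>1 = "\<beta> (W1 \<epsilon>)" and \<beta>\<^sub>2 = "\<beta> (W2 \<epsilon>)" and \<beta>\<^sub>3 = "\<beta> W3", OF sa GH(1)[OF W(2)]])
        (assumption | rule ty W1 W2 W3 eq that)+
  qed
  show "mean_h H q = 0" if "W1 \<epsilon> \<notin> U"
  proof -
    have "su3.trace_op q (shape q) = 0"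
      by (rule su3.trace_of_cyclic[OF sa]) (use that W zero W2 parts(1) in simp)
    then show ?thesis by (simp add: mean_h_eq)
  qed
  show "su3.tracefree_part q (shape q) x = 0" if "W2 \<epsilon> \<notin> U" "x \<in> V q"
  proof -
    have "su3.complex_part q (shape q) x = (su3.trace_op q (shape q) / 6) *\<^sub>R x"
    proof (rule su3.complex_part_of_skew[OF sa _ that(2)])
      fix x y z assume V: "x \<in> V q" "y \<in> V q" "z \<in> V q"
      then show "pull_form H q (su3.complex_part q (shape q) x) y z = - pull_form H q (su3.complex_part q (shape q) y) x z"
        using that(1) W zero W1[OF V] by (simp add: parts(1))
    qed
    then show ?thesis by (simp add: su3.tracefree_part_def)
  qed
  show "su3.antilinear_part q (shape q) x = 0" if "W3 \<notin> U" "x \<in> V q"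
    by (rule su3.\<phi>_nondegenerate[of _ q]) (use that W zero parts(2) sa in simp_all)
qed

lemma su3_type_iff:
  assumes "\<theta> = 0 \<and> \<epsilon> = Plus \<or> \<theta> = pi / 2 \<and> \<epsilon> = Minus" and "U \<subseteq> {W1 \<epsilon>, W2 \<epsilon>, W3}"
  shows "su3_type H \<theta> U \<longleftrightarrow> (W1 \<epsilon> \<in> U \<or> minimal_variety H)
    \<and> (W2 \<epsilon> \<in> U \<or> (\<forall>q. \<forall>x\<in>V q. su3.tracefree_part q (shape q) x = 0))
    \<and> (W3 \<in> U \<or> (\<forall>q. \<forall>x\<in>V q. su3.antilinear_part q (shape q) x = 0))"
  unfolding minimal_variety_def
proof
  assume t: "su3_type H \<theta> U"
  show "(W1 \<epsilon> \<in> U \<or> (\<forall>q. mean_h H q = 0))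
    \<and> (W2 \<epsilon> \<in> U \<or> (\<forall>q. \<forall>x\<in>V q. su3.tracefree_part q (shape q) x = 0))
    \<and> (W3 \<in> U \<or> (\<forall>q. \<forall>x\<in>V q. su3.antilinear_part q (shape q) x = 0))"
    using su3_typeD(1)[OF t assms(2)] su3_typeD(2)[OF t assms(2)] su3_typeD(3)[OF t assms(2)]
    by (cases "W1 \<epsilon> \<in> U"; cases "W2 \<epsilon> \<in> U"; cases "W3 \<in> U"; simp)
next
  assume "(W1 \<epsilon> \<in> U \<or> (\<forall>q. mean_h H q = 0))
    \<and> (W2 \<epsilon> \<in> U \<or> (\<forall>q. \<forall>x\<in>V q. su3.tracefree_part q (shape q) x = 0))
    \<and> (W3 \<in> U \<or> (\<forall>q. \<forall>x\<in>V q. su3.antilinear_part q (shape q) x = 0))"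
  then show "su3_type H \<theta> U" by (elim conjE) (rule su3_typeI[OF assms(1)])
qed

section \<open>Translation into conditions on the second fundamental form\<close>

lemma antilinear_part_zero_iff:
  "(\<forall>x\<in>V q. su3.antilinear_part q (shape q) x = 0) \<longleftrightarrow>
    (\<forall>x\<in>V q. \<forall>y\<in>V q. cplx_act H (second_ff H) q x y = second_ff H q x y)"
proof -
  note sa = selfadjoint_shape[of q]
  have g: "ind_metric H q (su3.antilinear_part q (shape q) x) y = (second_ff H q x y - cplx_act H (second_ff H) q x y) / 2"
    if "x \<in> V q" "y \<in> V q" for x y
    using that by (simp add: su3.g_antilinear_part[OF sa] ind_metric_shape cplx_act_def)
  show ?thesis
  proof (intro iffI ballI)
    fix x y assume "\<forall>x\<in>V q. su3.antilinear_part q (shape q) x = 0" "x \<in> V q" "y \<in> V q"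
    then show "cplx_act H (second_ff H) q x y = second_ff H q x y" using g[of x y] by simp
  next
    fix x assume "\<forall>x\<in>V q. \<forall>y\<in>V q. cplx_act H (second_ff H) q x y = second_ff H q x y" "x \<in> V q"
    then show "su3.antilinear_part q (shape q) x = 0"
      using g sa by (intro su3.eqI[of _ q]) (simp_all add: su3.in_zero)
  qed
qed

lemma tracefree_part_zero_iff:
  "(\<forall>x\<in>V q. su3.tracefree_part q (shape q) x = 0) \<longleftrightarrow>
    (\<forall>x\<in>V q. \<forall>y\<in>V q. second_ff H q x y + cplx_act H (second_ff H) q x y = 2 * mean_h H q * ind_metric H q x y)"
proof -
  note sa = selfadjoint_shape[of q]
  have g: "ind_metric H q (su3.tracefree_part q (shape q) x) y
      = (second_ff H q x y + cplx_act H (second_ff H) q x y - 2 * mean_h H q * ind_metric H q x y) / 2"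
    if "x \<in> V q" "y \<in> V q" for x y
    using that sa by (simp add: su3.tracefree_part_def su3.g_complex_part[OF sa] ind_metric_shape cplx_act_def
        su3.in_V mean_h_eq field_simps)
  show ?thesis
  proof (intro iffI ballI)
    fix x y assume "\<forall>x\<in>V q. su3.tracefree_part q (shape q) x = 0" "x \<in> V q" "y \<in> V q"
    then show "second_ff H q x y + cplx_act H (second_ff H) q x y = 2 * mean_h H q * ind_metric H q x y"
      using g[of x y] by simp
  next
    fix x assume "\<forall>x\<in>V q. \<forall>y\<in>V q. second_ff H q x y + cplx_act H (second_ff H) q x y = 2 * mean_h H q * ind_metric H q x y" "x \<in> V q"
    then show "su3.tracefree_part q (shape q) x = 0"
      using g sa by (intro su3.eqI[of _ q]) (simp_all add: su3.in_zero)
  qed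
qed

text \<open>\<open>second_ff\<close> and its image under \<open>cplx_act\<close> have the same
  trace, hence 1/12 in place of 1/6. It shows that IB = -B implies minimality.\<close>

lemma mean_h_cplx_act:
  "mean_h H q = (1 / 12) * trace_form (V q) (ind_metric H q) (\<lambda>x y. second_ff H q x y + cplx_act H (second_ff H) q x y)"
  using su3.trace_op_conj[OF selfadjoint_shape, of q]
  by (simp add: mean_h_eq trace_form_def cplx_act_def sum.distrib ind_metric_shape su3.trace_op_def)

end

theorem theorem4p6:
  fixes H :: "('m::{t2_space, second_countable_topology},
               'q::{t2_space, second_countable_topology}) hypersurface"
    and \<theta> :: real and \<epsilon> :: pm
  assumes "smooth_atlas (amb_atlas H)"
    and "riemannian_metric (amb_atlas H) (amb_metric H)"
    and "G2_structure (amb_atlas H) (amb_metric H) (amb_form H)"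
    and "type_P (amb_atlas H) (amb_metric H) (amb_form H)"
    and "smooth_atlas (atlas H)"
    and "immersion (atlas H) (amb_atlas H) (incl H)"
    and "unit_normal H"
    and "\<theta> = 0 \<and> \<epsilon> = Plus \<or> \<theta> = pi / 2 \<and> \<epsilon> = Minus"
  shows "(su3_type H \<theta> {W1 \<epsilon>, W2 \<epsilon>, W3})
    \<and> (su3_type H \<theta> {W1 \<epsilon>, W2 \<epsilon>} \<longleftrightarrow>
           (\<forall>q. \<forall>x\<in>TM H q. \<forall>y\<in>TM H q. cplx_act H (second_ff H) q x y = second_ff H q x y))
    \<and> (su3_type H \<theta> {W1 \<epsilon>, W3} \<longleftrightarrow>
           (\<forall>q. \<forall>x\<in>TM H q. \<forall>y\<in>TM H q.
              second_ff H q x y + cplx_act H (second_ff H) q x y = 2 * mean_h H q * ind_metric H q x y))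
    \<and> (su3_type H \<theta> {W2 \<epsilon>, W3} \<longleftrightarrow> minimal_variety H)
    \<and> (su3_type H \<theta> {W3} \<longleftrightarrow>
           (\<forall>q. \<forall>x\<in>TM H q. \<forall>y\<in>TM H q. cplx_act H (second_ff H) q x y = - second_ff H q x y))
    \<and> (su3_type H \<theta> {W2 \<epsilon>} \<longleftrightarrow>
           (\<forall>q. \<forall>x\<in>TM H q. \<forall>y\<in>TM H q. cplx_act H (second_ff H) q x y = second_ff H q x y)
           \<and> minimal_variety H)
    \<and> (su3_type H \<theta> {W1 \<epsilon>} \<longleftrightarrow> totally_umbilic H)
    \<and> (su3_type H \<theta> {} \<longleftrightarrow> totally_geodesic H)"
proof -
  interpret g2_hypersurface H by unfold_locales (rule assms)+
  let ?inv = "\<forall>q. \<forall>x\<in>V q. \<forall>y\<in>V q. cplx_act H (second_ff H) q x y = second_ff H q x y"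
  let ?tf = "\<forall>q. \<forall>x\<in>V q. \<forall>y\<in>V q. second_ff H q x y + cplx_act H (second_ff H) q x y = 2 * mean_h H q * ind_metric H q x y"
  let ?anti = "\<forall>q. \<forall>x\<in>V q. \<forall>y\<in>V q. cplx_act H (second_ff H) q x y = - second_ff H q x y"
  \<comment> \<open>Each class missing from \<open>U\<close> contributes one condition on the second
    fundamental form.\<close>
  have type: "su3_type H \<theta> U \<longleftrightarrow> (W1 \<epsilon> \<in> U \<or> minimal_variety H) \<and> (W2 \<epsilon> \<in> U \<or> ?tf) \<and> (W3 \<in> U \<or> ?inv)"
    if "U \<subseteq> {W1 \<epsilon>, W2 \<epsilon>, W3}" for U
    unfolding su3_type_iff[OF assms(8) that] antilinear_part_zero_iff tracefree_part_zero_iff ..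
  have anti: "minimal_variety H \<and> ?tf \<longleftrightarrow> ?anti"
  proof
    assume "minimal_variety H \<and> ?tf"
    then show ?anti unfolding minimal_variety_def by (metis add_eq_0_iff mult_zero_left mult_zero_right)
  next
    assume a: ?anti
    then have "mean_h H q = 0" for q
      unfolding mean_h_cplx_act trace_form_def by simp
    then show "minimal_variety H \<and> ?tf" using a by (simp add: minimal_variety_def)
  qed
  \<comment> \<open>Adding IB = B to (1+I)B = 2h<.,.> gives B = h<.,.>; the reverse direction uses
    that \<open>cplx\<close> is an isometry.\<close>
  have umbilic: "?tf \<and> ?inv \<longleftrightarrow> totally_umbilic H"
  proof
    assume "?tf \<and> ?inv"
    then show "totally_umbilic H" unfolding totally_umbilic_def by fastforce
  next
    assume "totally_umbilic H"
    then show "?tf \<and> ?inv" unfolding totally_umbilic_def cplx_act_def by simp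
  qed
  have geodesic: "totally_umbilic H \<and> minimal_variety H \<longleftrightarrow> totally_geodesic H"
  proof
    assume "totally_umbilic H \<and> minimal_variety H"
    then show "totally_geodesic H" unfolding totally_umbilic_def minimal_variety_def totally_geodesic_def by simp
  next
    assume t: "totally_geodesic H"
    then have "mean_h H q = 0" for q
      unfolding mean_h_def trace_form_def totally_geodesic_def by simp
    then show "totally_umbilic H \<and> minimal_variety H"
      using t unfolding totally_umbilic_def minimal_variety_def totally_geodesic_def by simp
  qed
  show ?thesis
    using type[of "{W1 \<epsilon>, W2 \<epsilon>, W3}"] type[of "{W1 \<epsilon>, W2 \<epsilon>}"] type[of "{W1 \<epsilon>, W3}"] type[of "{W2 \<epsilon>, W3}"]
      type[of "{W3}"] type[of "{W2 \<epsilon>}"] type[of "{W1 \<epsilon>}"] type[of "{}"] anti umbilic geodesic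
    by simp blast
qed

end
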